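(* Let $G$ be a bipartite graph. Then $\operatorname{conn}(L(G)) = \frac{\nu(G)}{2} - 2$ if and only if $G$ has a collection of $\nu(G)/2$ pairwise vertex-disjoint subgraphs, each of them a $C_4$ or a $P_4$, such that every edge of $G$ is parallel to an edge of one of the $C_4$'s or is incident to an interior vertex of one of the $P_4$'s.
   Context: Graphs are finite and may have parallel edges (the edge set is a multiset of $2$-element sets of vertices). Two edges are parallel if they have the same pair of endpoints; in particular every edge is parallel to itself. $C_4$ is the cycle on $4$ vertices and $P_4$ is the path on $4$ vertices; the interior vertices of a $P_4$ are its two vertices of degree $2$. A matching is a set of pairwise disjoint edges, and $\nu(G)$ is the maximum size of a matching in $G$. (The existence of a collection of $\nu(G)/2$ subgraphs entails that $\nu(G)$ is even.) Line graph: $L(G)$ is the simple graph whose vertex set is $E(G)$ (parallel edges being distinct vertices), with two distinct edges $e, f$ adjacent iff $e \cap f \neq \emptyset$. Connectedness: for an integer $k\ge -1$, a space $X$ is $k$-connected if for every integer $-1\le j\le k$ every continuous map $S^j \to X$ extends to a continuous map $B^{j+1} \to X$ (with $S^{-1}=\emptyset$, so $(-1)$-connected means nonempty). $\operatorname{conn}(X)$ is the largest $k$ such that $X$ is $k$-connected; it is $-2$ if $X$ is empty and $+\infty$ if $X$ is $k$-connected for all $k$. For a graph $H$, $\operatorname{conn}(H)$ means $\operatorname{conn}$ of (the geometric realization of) the independence complex of $H$, i.e. the abstract simplicial complex on $V(H)$ whose simplices are the independent sets of $H$. *)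

theory Defs
  imports "HOL-Analysis.Analysis"
begin

section \<open>Multigraphs\<close>

text \<open>
  The multiset of edges is represented by a set of edge names, each with its set of endpoints;
  parallel edges are different names with the same endpoints.  A simple graph is a multigraph
  in which every edge is its own set of endpoints.
\<close>

record ('v, 'e) multigraph =
  verts :: "'v set"
  edges :: "'e set"
  ends :: "'e \<Rightarrow> 'v set"

definition finite_multigraph :: "('v, 'e) multigraph \<Rightarrow> bool" where
  "finite_multigraph G \<longleftrightarrow>
     finite (verts G) \<and> finite (edges G) \<and>
     (\<forall>e\<in>edges G. ends G e \<subseteq> verts G \<and> card (ends G e) = 2)"

definition bipartite :: "('v, 'e) multigraph \<Rightarrow> bool" where
  "bipartite G \<longleftrightarrow>
     (\<exists>A B. A \<union> B = verts G \<and> A \<inter> B = {} \<and>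
        (\<forall>e\<in>edges G. \<exists>a\<in>A. \<exists>b\<in>B. ends G e = {a, b}))"

definition parallel :: "('v, 'e) multigraph \<Rightarrow> 'e \<Rightarrow> 'e \<Rightarrow> bool" where
  "parallel G e f \<longleftrightarrow> ends G e = ends G f"

definition incident :: "('v, 'e) multigraph \<Rightarrow> 'e \<Rightarrow> 'v \<Rightarrow> bool" where
  "incident G e v \<longleftrightarrow> v \<in> ends G e"

definition degree :: "('v, 'e) multigraph \<Rightarrow> 'v \<Rightarrow> nat" where
  "degree G v = card {e \<in> edges G. incident G e v}"

definition subgraph :: "('v, 'e) multigraph \<Rightarrow> ('v, 'e) multigraph \<Rightarrow> bool" where
  "subgraph H G \<longleftrightarrow>
     finite_multigraph H \<and> verts H \<subseteq> verts G \<and> edges H \<subseteq> edges G \<and> ends H = ends G"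

definition is_C4 :: "('v, 'e) multigraph \<Rightarrow> bool" where
  "is_C4 H \<longleftrightarrow>
     (\<exists>a b c d e\<^sub>1 e\<^sub>2 e\<^sub>3 e\<^sub>4. distinct [a, b, c, d] \<and>
        verts H = {a, b, c, d} \<and> edges H = {e\<^sub>1, e\<^sub>2, e\<^sub>3, e\<^sub>4} \<and>
        ends H e\<^sub>1 = {a, b} \<and> ends H e\<^sub>2 = {b, c} \<and> ends H e\<^sub>3 = {c, d} \<and> ends H e\<^sub>4 = {d, a})"

definition is_P4 :: "('v, 'e) multigraph \<Rightarrow> bool" where
  "is_P4 H \<longleftrightarrow>
     (\<exists>a b c d e\<^sub>1 e\<^sub>2 e\<^sub>3. distinct [a, b, c, d] \<and>
        verts H = {a, b, c, d} \<and> edges H = {e\<^sub>1, e\<^sub>2, e\<^sub>3} \<and>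
        ends H e\<^sub>1 = {a, b} \<and> ends H e\<^sub>2 = {b, c} \<and> ends H e\<^sub>3 = {c, d})"

definition interior_verts :: "('v, 'e) multigraph \<Rightarrow> 'v set" where
  "interior_verts H = {v \<in> verts H. degree H v = 2}"

definition is_matching :: "('v, 'e) multigraph \<Rightarrow> 'e set \<Rightarrow> bool" where
  "is_matching G M \<longleftrightarrow> M \<subseteq> edges G \<and> disjoint_family_on (ends G) M"

definition matching_number :: "('v, 'e) multigraph \<Rightarrow> nat" where
  "matching_number G = Max {card M | M. is_matching G M}"

definition line_graph :: "('v, 'e) multigraph \<Rightarrow> ('e, 'e set) multigraph" where
  "line_graph G =
     \<lparr>verts = edges G,
      edges = {{e, f} | e f. e \<in> edges G \<and> f \<in> edges G \<and> e \<noteq> f \<and> ends G e \<inter> ends G f \<noteq> {}},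
      ends = (\<lambda>p. p)\<rparr>"

section \<open>Independence complexes\<close>

definition independent_set :: "('v, 'e) multigraph \<Rightarrow> 'v set \<Rightarrow> bool" where
  "independent_set H I \<longleftrightarrow> I \<subseteq> verts H \<and> (\<forall>e\<in>edges H. \<not> ends H e \<subseteq> I)"

definition independence_complex :: "('v, 'e) multigraph \<Rightarrow> 'v set set" where
  "independence_complex H = {I. independent_set H I}"

text \<open>
  Points of the geometric realization are given by barycentric coordinates, with the topology
  of pointwise convergence.  This is the usual topology for complexes with finitely many vertices,
  the only ones considered here.  The empty simplex contributes no point.
\<close>

definition geometric_realization :: "'a set set \<Rightarrow> ('a \<Rightarrow> real) topology" where
  "geometric_realization K =
     subtopology (powertop_real UNIV)
       {x. (\<forall>v. 0 \<le> x v) \<and> {v. x v \<noteq> 0} \<in> K \<and> (\<Sum>v | x v \<noteq> 0. x v) = 1}"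

section \<open>Connectedness\<close>

definition sphere_top :: "int \<Rightarrow> (nat \<Rightarrow> real) topology" where
  "sphere_top j = (if j < 0 then discrete_topology {} else nsphere (nat j))"

definition ball_top :: "int \<Rightarrow> (nat \<Rightarrow> real) topology" where
  "ball_top n = subtopology (Euclidean_space (nat n)) {x. (\<Sum>i<nat n. x i ^ 2) \<le> 1}"

definition k_connected :: "int \<Rightarrow> 'a topology \<Rightarrow> bool" where
  "k_connected k X \<longleftrightarrow>
     (\<forall>j. - 1 \<le> j \<and> j \<le> k \<longrightarrow>
        (\<forall>f. continuous_map (sphere_top j) X f \<longrightarrow>
           (\<exists>g. continuous_map (ball_top (j + 1)) X g \<and>
                (\<forall>x\<in>topspace (sphere_top j). g x = f x))))"

text \<open>
  Being k-connected is inherited by smaller k, so in the last case the set of admissible k is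
  bounded above and contains -1, and the greatest element exists.
\<close>

definition conn :: "'a topology \<Rightarrow> ereal" where
  "conn X =
     (if topspace X = {} then - 2
      else if \<forall>k\<ge>- 1. k_connected k X then \<infinity>
      else ereal (of_int (GREATEST k. - 1 \<le> k \<and> k_connected k X)))"

definition graph_conn :: "('v, 'e) multigraph \<Rightarrow> ereal" where
  "graph_conn H = conn (geometric_realization (independence_complex H))"

end

theory Submission
  imports Defs "HOL-Homology.Brouwer_Degree"
begin

text \<open>
  The independent sets of the line graph are the matchings of G, and conn is governed by the shifted
  connectivity eta of the complex of matchings.  The bound conn + 2 \<ge> \<nu> / 2 holds for every bipartite graph
  (\<open>eta_ge_half_nu\<close>): the matchings through an edge form a cone, and deleting the two ends of an edge
  lowers \<nu> by at most two.  So with \<nu> = 2n the theorem says that the complex fails to be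
  (n-1)-connected if and only if the pieces exist.

  If the pieces exist, assign every edge to a piece covering it and give it a sign such that edges of opposite sign
  in one piece intersect.  This maps the complex of matchings to the boundary of the n-dimensional cross-polytope.
  Two disjoint pieces do not interfere, so picking one edge of each sign in every piece embeds
  that boundary, and the composition is the identity.  Hence an (n-1)-sphere is a retract of
  the complex (\<open>not_k_connected_if_cross_polytope\<close>, \<open>not_k_connected_if_pieces\<close>).

  For the converse (\<open>decomposable_if_tight\<close>) take a minimal graph without pieces whose
  connectivity is as small as possible.  Two operations are controlled by the connectivity of smaller graphs: deleting an edge
  (\<open>eta_delete_edge\<close>) and splitting a vertex into two
  (\<open>eta_split_vertex\<close>), the latter being Meshulam's edge removal in the line graph (\<open>edge_removal\<close>).  Whenever the resulting graph is not connected enough, it has pieces by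
  minimality.  This excludes parallel edges and leaves.  If every set of left vertices has more neighbours than elements, then a
  vertex of degree two exists, and splitting it contradicts Hall's theorem.  Otherwise a
  minimal set P violating this again contains a vertex of degree two; analysing the link
  there shows that P has two elements, which span a four-cycle with their neighbours, and this leads to a
  decomposition of the whole graph.

  Connectivity is handled through extension of maps from closed subsets of bricks.  A finite complex is a
  neighbourhood retract, so it is enough to fill spheres (\<open>extensor_Suc\<close>); in return excision
  (\<open>extensor_excision\<close>) has a direct proof, and no homology or fundamental group enters the lower bounds.
\<close>

section \<open>Geometric realizations as neighbourhood retracts\<close>

definition simplicial_complex :: "'a set set \<Rightarrow> bool" where
  "simplicial_complex K \<longleftrightarrow> finite (\<Union>K) \<and> (\<forall>\<sigma>\<in>K. \<forall>\<tau>\<subseteq>\<sigma>. \<tau> \<in> K)"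

definition realize :: "'a set set \<Rightarrow> ('a \<Rightarrow> real) set" where
  "realize K = {x. (\<forall>v. 0 \<le> x v) \<and> {v. x v \<noteq> 0} \<in> K \<and> (\<Sum>v | x v \<noteq> 0. x v) = 1}"

lemma simplicial_complexD:
  assumes "simplicial_complex K" "\<sigma> \<in> K" "\<tau> \<subseteq> \<sigma>"
  shows "\<tau> \<in> K"
  using assms unfolding simplicial_complex_def by blast

lemma realizeI:
  assumes "finite W" "\<And>v. 0 \<le> x v" "\<sigma> \<in> K" "simplicial_complex K" "\<And>v. x v \<noteq> 0 \<Longrightarrow> v \<in> \<sigma>"
    "\<And>v. v \<notin> W \<Longrightarrow> x v = 0" "sum x W = 1"
  shows "x \<in> realize K"
proof -
  have "sum x {v. x v \<noteq> 0} = sum x W"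
    by (rule sum.mono_neutral_left) (use assms(1,6) in blast)+
  then have "sum x {v. x v \<noteq> 0} = 1" unfolding assms(7) .
  moreover have "{v. x v \<noteq> 0} \<subseteq> \<sigma>" using assms(5) by blast
  then have "{v. x v \<noteq> 0} \<in> K" by (rule simplicial_complexD[OF assms(4,3)])
  ultimately show ?thesis
    unfolding realize_def mem_Collect_eq using assms(2) by (intro conjI allI)
qed

lemma realizeD:
  assumes "x \<in> realize K"
  shows "0 \<le> x v" "{v. x v \<noteq> 0} \<in> K"
    "\<And>W. finite W \<Longrightarrow> {v. x v \<noteq> 0} \<subseteq> W \<Longrightarrow> sum x W = 1" "x v \<le> 1"
proof -
  show 1: "0 \<le> x v" for v
    using assms unfolding realize_def by auto
  show "{v. x v \<noteq> 0} \<in> K"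
    using assms unfolding realize_def by auto
  have fin: "finite {v. x v \<noteq> 0}"
    using assms unfolding realize_def by (auto intro: ccontr)
  show 2: "sum x W = 1" if "finite W" "{v. x v \<noteq> 0} \<subseteq> W" for W
  proof -
    have "sum x {v. x v \<noteq> 0} = sum x W"
      by (rule sum.mono_neutral_left) (use that in auto)
    then show ?thesis using assms unfolding realize_def by auto
  qed
  show "x v \<le> 1"
  proof (cases "x v = 0")
    case False
    then have "x v \<le> sum x {v. x v \<noteq> 0}"
      using fin 1 by (intro member_le_sum) auto
    then show ?thesis using 2[OF fin] by simp
  qed simp
qed

lemma realize_vertices:
  assumes "x \<in> realize K" "x v \<noteq> 0" shows "v \<in> \<Union>K"
  using realizeD(2)[OF assms(1)] assms(2) by blast

lemma realize_mono: "K \<subseteq> L \<Longrightarrow> realize K \<subseteq> realize L"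
  by (auto simp: realize_def)

lemma realize_Un: "realize (K \<union> L) = realize K \<union> realize L"
  by (auto simp: realize_def)

lemma realize_Int: "realize (K \<inter> L) = realize K \<inter> realize L"
  by (auto simp: realize_def)

lemma simplicial_complex_Un:
  "simplicial_complex K \<Longrightarrow> simplicial_complex L \<Longrightarrow> simplicial_complex (K \<union> L)"
  unfolding simplicial_complex_def by (auto simp: Union_Un_distrib)

lemma vertex_in_realize:
  assumes "{v} \<in> K"
  shows "(\<lambda>u. if u = v then 1 else 0) \<in> realize K"
proof -
  have "{u. (if u = v then 1 else (0::real)) \<noteq> 0} = {v}" by auto
  then show ?thesis using assms by (auto simp: realize_def)
qed

text \<open>
  The root of the product over a set of vertices is a geometric mean: it is at least the smallest
  factor, vanishes with any factor and is continuous.  Subtracting the sum of these means over all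
  nonfaces therefore kills, on every nonface, at least one coordinate, and changes nothing on the
  complex itself.  After renormalization this is a retraction of a neighbourhood onto the complex.
\<close>

definition nonface_excess :: "'a set set \<Rightarrow> ('a \<Rightarrow> real) \<Rightarrow> real" where
  "nonface_excess K x = (\<Sum>\<tau> | \<tau> \<subseteq> \<Union>K \<and> \<tau> \<notin> K. root (card \<tau>) (\<Prod>v\<in>\<tau>. x v))"

definition trimmed :: "'a set set \<Rightarrow> ('a \<Rightarrow> real) \<Rightarrow> 'a \<Rightarrow> real" where
  "trimmed K x v = (if v \<in> \<Union>K then max 0 (x v - nonface_excess K x) else 0)"

definition trimmed_mass :: "'a set set \<Rightarrow> ('a \<Rightarrow> real) \<Rightarrow> real" where
  "trimmed_mass K x = (\<Sum>v\<in>\<Union>K. trimmed K x v)"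

definition retraction_onto :: "'a set set \<Rightarrow> ('a \<Rightarrow> real) \<Rightarrow> 'a \<Rightarrow> real" where
  "retraction_onto K x v = trimmed K x v / trimmed_mass K x"

lemma retraction_onto_in_realize:
  assumes K: "simplicial_complex K" and pos: "\<And>v. 0 \<le> x v" and mass: "trimmed_mass K x > 0"
  shows "retraction_onto K x \<in> realize K"
proof -
  define V where "V = \<Union>K"
  have finV: "finite V" using K by (auto simp: simplicial_complex_def V_def)
  define \<tau> where "\<tau> = {v. trimmed K x v \<noteq> 0}"
  have \<tau>V: "\<tau> \<subseteq> V" unfolding \<tau>_def trimmed_def V_def by auto
  have fin\<tau>: "finite \<tau>" using \<tau>V finV finite_subset by blast
  have "V \<noteq> {}" using mass unfolding trimmed_mass_def V_def by fastforce
  then have Kne: "{} \<in> K" using K unfolding simplicial_complex_def V_def by blast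
  have "\<tau> \<in> K"
  proof (rule ccontr)
    assume nK: "\<tau> \<notin> K"
    then have ne: "\<tau> \<noteq> {}" using Kne by auto
    then have card: "0 < card \<tau>" using fin\<tau> by auto
    define e where "e = nonface_excess K x"
    have gt: "x v > e" if "v \<in> \<tau>" for v
      using that unfolding \<tau>_def trimmed_def e_def by (auto split: if_splits)
    have rt0: "0 \<le> root (card t) (\<Prod>v\<in>t. x v)" for t
      using pos by (intro real_root_ge_zero prod_nonneg) auto
    have fin: "finite {\<tau>. \<tau> \<subseteq> \<Union>K \<and> \<tau> \<notin> K}"
      using finV unfolding V_def by auto
    have "root (card \<tau>) (\<Prod>v\<in>\<tau>. x v) \<le> e"
      unfolding e_def nonface_excess_def
      by (rule member_le_sum) (use fin rt0 nK \<tau>V V_def in auto)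
    moreover have "e < root (card \<tau>) (\<Prod>v\<in>\<tau>. x v)"
    proof -
      have e0: "0 \<le> e" unfolding e_def nonface_excess_def using rt0 by (intro sum_nonneg) auto
      have "e ^ card \<tau> = (\<Prod>v\<in>\<tau>. e)" by simp
      also have "\<dots> < (\<Prod>v\<in>\<tau>. x v)"
      proof (cases "e = 0")
        case True
        then show ?thesis using gt card fin\<tau> by (auto simp: power_0_left intro: prod_pos)
      next
        case False
        obtain w where "w \<in> \<tau>" using ne by blast
        then show ?thesis
          using False e0 gt fin\<tau>
          by (intro prod_mono_strict[of w]) (auto intro: less_imp_le order.strict_trans1)
      qed
      finally have "root (card \<tau>) (e ^ card \<tau>) < root (card \<tau>) (\<Prod>v\<in>\<tau>. x v)"
        using card by simp
      then show ?thesis using e0 card by (simp add: real_root_power_cancel)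
    qed
    ultimately show False by simp
  qed
  moreover have nn: "0 \<le> trimmed K x v" for v unfolding trimmed_def by auto
  ultimately show ?thesis
    using mass
    by (intro realizeI[OF finV _ _ K, of _ \<tau>])
       (auto simp: retraction_onto_def \<tau>_def trimmed_def V_def trimmed_mass_def
          simp flip: sum_divide_distrib)
qed

lemma retraction_onto_fixes:
  assumes K: "simplicial_complex K" and x: "x \<in> realize K"
  shows "trimmed_mass K x = 1" "retraction_onto K x = x"
proof -
  have finV: "finite (\<Union>K)" using K by (auto simp: simplicial_complex_def)
  have "(\<Prod>v\<in>\<tau>. x v) = 0" if "\<tau> \<subseteq> \<Union>K" "\<tau> \<notin> K" for \<tau>
  proof -
    have "\<not> \<tau> \<subseteq> {v. x v \<noteq> 0}"
      using simplicial_complexD[OF K realizeD(2)[OF x]] that by blast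
    moreover have "finite \<tau>" using that finV finite_subset by blast
    ultimately show ?thesis by auto
  qed
  then have e: "nonface_excess K x = 0" unfolding nonface_excess_def by (intro sum.neutral) auto
  then have tr: "trimmed K x = x"
    using realizeD(1)[OF x] realize_vertices[OF x] unfolding trimmed_def by (auto simp: fun_eq_iff)
  show m: "trimmed_mass K x = 1"
    unfolding trimmed_mass_def tr
    by (rule realizeD(3)[OF x finV]) (use realize_vertices[OF x] in blast)
  show "retraction_onto K x = x"
    unfolding retraction_onto_def tr m by simp
qed

lemma continuous_on_trimmed:
  fixes F :: "'x::topological_space \<Rightarrow> 'a \<Rightarrow> real"
  assumes "simplicial_complex K" "\<And>v. continuous_on S (\<lambda>p. F p v)"
  shows "continuous_on S (\<lambda>p. trimmed K (F p) v)" "continuous_on S (\<lambda>p. trimmed_mass K (F p))"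
proof -
  have 1: "continuous_on S (\<lambda>p. nonface_excess K (F p))"
    unfolding nonface_excess_def
    by (intro continuous_intros continuous_on_real_root assms)
  show 2: "continuous_on S (\<lambda>p. trimmed K (F p) v)" for v
    unfolding trimmed_def by (cases "v \<in> \<Union>K") (auto intro!: continuous_intros assms 1)
  show "continuous_on S (\<lambda>p. trimmed_mass K (F p))"
    unfolding trimmed_mass_def by (intro continuous_intros 2)
qed

lemma continuous_on_retraction_onto:
  fixes F :: "'x::topological_space \<Rightarrow> 'a \<Rightarrow> real"
  assumes "simplicial_complex K" "\<And>v. continuous_on S (\<lambda>p. F p v)"
    "\<And>p. p \<in> S \<Longrightarrow> trimmed_mass K (F p) > 0"
  shows "continuous_on S (\<lambda>p. retraction_onto K (F p))"
proof (rule continuous_on_coordinatewise_then_product)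
  fix v
  have "trimmed_mass K (F p) \<noteq> 0" if "p \<in> S" for p using assms(3)[OF that] by simp
  then show "continuous_on S (\<lambda>p. retraction_onto K (F p) v)"
    unfolding retraction_onto_def
    by (intro continuous_intros continuous_on_trimmed assms(1,2)) auto
qed

lemma continuous_on_coord:
  assumes "continuous_on S f" shows "continuous_on S (\<lambda>x. f x v)"
  using assms by (rule continuous_on_product_then_coordinatewise)

lemma coordinate_extension:
  fixes f :: "'x::{metric_space,second_countable_topology} \<Rightarrow> 'a \<Rightarrow> real"
  assumes "closed C" "continuous_on C f" "f ` C \<subseteq> realize K"
  obtains F where "\<And>v. continuous_on UNIV (\<lambda>x. F x v)" "\<And>x v. (0::real) \<le> F x v" "\<And>x. x \<in> C \<Longrightarrow> F x = f x"
proof -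
  have "\<exists>g. continuous_on UNIV g \<and> (\<forall>x\<in>C. g x = f x v) \<and> (\<forall>x. (0::real) \<le> g x)" for v
  proof -
    have c: "continuous_on C (\<lambda>x. f x v)" using assms(2) by (rule continuous_on_coord)
    have "f x v \<in> cbox 0 1" if "x \<in> C" for x
      using realizeD(1,4)[of "f x" K v] assms(3) that by auto
    then obtain g where "continuous_on UNIV g" "\<And>x. x \<in> C \<Longrightarrow> g x = f x v" "\<And>x. x \<in> UNIV \<Longrightarrow> g x \<in> cbox 0 1"
      using Tietze_closed_interval_1[OF c, of UNIV 0 1] assms(1) by auto
    then show ?thesis by (intro exI[of _ g]) auto
  qed
  then obtain g where "\<And>v. continuous_on UNIV (g v) \<and> (\<forall>x\<in>C. g v x = f x v) \<and> (\<forall>x. (0::real) \<le> g v x)"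
    by metis
  then show thesis by (intro that[of "\<lambda>x v. g v x"]) auto
qed

text \<open>
  A finite complex is an absolute neighbourhood retract: extend the coordinates separately by Tietze's
  theorem and retract wherever the trimmed mass is still positive.
\<close>

lemma neighbourhood_extension:
  fixes f :: "'x::{metric_space,second_countable_topology} \<Rightarrow> 'a \<Rightarrow> real"
  assumes K: "simplicial_complex K" and C: "closed C" and f: "continuous_on C f" "f ` C \<subseteq> realize K"
  obtains U F where "open U" "C \<subseteq> U" "continuous_on U F" "F ` U \<subseteq> realize K"
    "\<And>x. x \<in> C \<Longrightarrow> F x = f x"
proof -
  obtain F where F: "\<And>v. continuous_on UNIV (\<lambda>x. F x v)" "\<And>x v. (0::real) \<le> F x v"
    "\<And>x. x \<in> C \<Longrightarrow> F x = f x"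
    using coordinate_extension[OF C f] by blast
  define U where "U = {x. trimmed_mass K (F x) > 0}"
  have "open U"
    unfolding U_def by (intro open_Collect_less continuous_on_trimmed(2)[OF K F(1)] continuous_intros)
  moreover have "C \<subseteq> U"
    using retraction_onto_fixes(1)[OF K] F(3) f(2) unfolding U_def by fastforce
  moreover have "continuous_on U (\<lambda>x. retraction_onto K (F x))"
    by (intro continuous_on_retraction_onto[OF K])
       (auto intro: continuous_on_subset[OF F(1)] simp: U_def)
  moreover have "(\<lambda>x. retraction_onto K (F x)) ` U \<subseteq> realize K"
    using retraction_onto_in_realize[OF K F(2)] unfolding U_def by auto
  moreover have "retraction_onto K (F x) = f x" if "x \<in> C" for x
    using retraction_onto_fixes(2)[OF K] F(3) f(2) that by auto
  ultimately show thesis by (rule that)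
qed

text \<open>
  Contiguous maps are homotopic by straight segments, and extendability is a homotopy invariant.
  The homotopy is written on all of Q with Tietze-extended coordinates, where it may leave the complex;
  a parameter that is one on C and zero on the bad set keeps it inside the domain of the retraction.
\<close>

lemma extension_of_contiguous:
  fixes f :: "'x::{metric_space,second_countable_topology} \<Rightarrow> 'a \<Rightarrow> real"
  assumes K: "simplicial_complex K" and Q: "compact Q" and C: "closed C" "C \<subseteq> Q"
    and f: "continuous_on C f" "f ` C \<subseteq> realize K"
    and g: "continuous_on Q g" "g ` Q \<subseteq> realize K"
    and contig: "\<And>x. x \<in> C \<Longrightarrow> {v. f x v \<noteq> 0} \<union> {v. g x v \<noteq> 0} \<in> K"
  obtains h where "continuous_on Q h" "h ` Q \<subseteq> realize K" "\<And>x. x \<in> C \<Longrightarrow> h x = f x"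
proof -
  obtain F where F: "\<And>v. continuous_on UNIV (\<lambda>x. F x v)" "\<And>x v. (0::real) \<le> F x v"
    "\<And>x. x \<in> C \<Longrightarrow> F x = f x"
    using coordinate_extension[OF C(1) f] by blast
  \<comment> \<open>the straight homotopy from g (time 0) to the extended coordinates of f (time 1)\<close>
  define \<Phi> where "\<Phi> p v = (1 - snd p) * g (fst p) v + snd p * F (fst p) v" for p v
  have contPhi: "continuous_on (Q \<times> {0..1}) (\<lambda>p. \<Phi> p v)" for v
    unfolding \<Phi>_def
    by (intro continuous_intros continuous_on_compose2[OF F(1)]
        continuous_on_compose2[OF continuous_on_coord[OF g(1)]]) auto
  have PhiC: "\<Phi> (x, u) \<in> realize K" if "x \<in> C" "0 \<le> u" "u \<le> 1" for x u
  proof -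
    have fx: "f x \<in> realize K" and gx: "g x \<in> realize K" using f g C that by auto
    define \<sigma> where "\<sigma> = {v. f x v \<noteq> 0} \<union> {v. g x v \<noteq> 0}"
    have "\<sigma> \<in> K" using contig[OF that(1)] unfolding \<sigma>_def .
    moreover have fin: "finite \<sigma>"
      using K \<open>\<sigma> \<in> K\<close> unfolding simplicial_complex_def by (meson Sup_upper finite_subset)
    moreover have "sum (\<Phi> (x, u)) \<sigma> = (1 - u) * sum (g x) \<sigma> + u * sum (f x) \<sigma>"
      unfolding \<Phi>_def using F(3)[OF that(1)] by (simp add: sum.distrib sum_distrib_left)
    then have "sum (\<Phi> (x, u)) \<sigma> = 1"
      using realizeD(3)[OF fx fin] realizeD(3)[OF gx fin] unfolding \<sigma>_def by auto
    moreover have "0 \<le> \<Phi> (x, u) v" for v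
      unfolding \<Phi>_def using that F(2) realizeD(1)[OF gx] by auto
    moreover have "\<Phi> (x, u) v = 0" if "v \<notin> \<sigma>" for v
      using that F(3)[OF \<open>x \<in> C\<close>] unfolding \<Phi>_def \<sigma>_def by auto
    ultimately show ?thesis by (intro realizeI[OF _ _ _ K, of \<sigma> _ \<sigma>]) auto
  qed
  \<comment> \<open>the points from which the complex cannot be reached by trimming\<close>
  define B where "B = {p \<in> Q \<times> {0..1}. trimmed_mass K (\<Phi> p) \<le> 0}"
  have "compact (Q \<times> {0..1::real})" using Q by (intro compact_Times) auto
  moreover have "closed B" unfolding B_def
    by (intro continuous_closed_preimage_constant continuous_on_closed_Collect_le
        continuous_on_trimmed(2)[OF K contPhi] continuous_intros compact_imp_closed) fact
  ultimately have "compact B"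
    using compact_Int_closed[of "Q \<times> {0..1}" B] unfolding B_def by (simp add: Int_absorb1 subset_iff)
  then have S: "compact (fst ` B)" by (intro compact_continuous_image continuous_intros)
  have disj: "C \<inter> fst ` B = {}"
    using PhiC retraction_onto_fixes(1)[OF K] unfolding B_def by fastforce
  have "continuous_on (C \<union> fst ` B) (\<lambda>x. if x \<in> C then 1 else (0::real))"
    using disj by (intro continuous_on_cases C compact_imp_closed[OF S] continuous_intros) auto
  then obtain u where u: "continuous_on UNIV u" "\<And>x. x \<in> C \<union> fst ` B \<Longrightarrow> u x = (if x \<in> C then 1 else 0)"
    "\<And>x. x \<in> UNIV \<Longrightarrow> u x \<in> cbox 0 (1::real)"
    by (rule Tietze_closed_interval_1[of _ _ UNIV 0 1])
       (use C compact_imp_closed[OF S] in auto)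
  have u01: "0 \<le> u x" "u x \<le> 1" for x using u(3)[of x] by simp_all
  define h where "h x = retraction_onto K (\<Phi> (x, u x))" for x
  have pos: "trimmed_mass K (\<Phi> (x, u x)) > 0" if "x \<in> Q" for x
  proof (cases "x \<in> fst ` B")
    case True
    then have "u x = 0" using u(2)[of x] disj by auto
    then have "\<Phi> (x, u x) = g x" by (simp add: \<Phi>_def fun_eq_iff)
    moreover have "g x \<in> realize K" using g(2) that by blast
    ultimately show ?thesis using retraction_onto_fixes(1)[OF K] by simp
  next
    case False
    have "(x, u x) \<in> Q \<times> {0..1}" using u01[of x] that by simp
    moreover have "(x, u x) \<notin> B" using False by (metis fst_conv imageI)
    ultimately show ?thesis unfolding B_def by (simp add: not_le)
  qed
  have nonneg: "0 \<le> \<Phi> (x, u x) v" if "x \<in> Q" for x v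
  proof -
    have "g x \<in> realize K" using g(2) that by blast
    then have "0 \<le> g x v" by (rule realizeD(1))
    then have "0 \<le> (1 - u x) * g x v + u x * F x v"
      using mult_nonneg_nonneg[of "1 - u x" "g x v"] mult_nonneg_nonneg[OF u01(1)[of x] F(2)[of x v]]
        u01(2)[of x] by linarith
    then show ?thesis by (simp add: \<Phi>_def)
  qed
  have "h ` Q \<subseteq> realize K"
  proof (rule image_subsetI)
    fix x assume x: "x \<in> Q"
    show "h x \<in> realize K"
      unfolding h_def by (rule retraction_onto_in_realize[OF K nonneg[OF x] pos[OF x]])
  qed
  moreover have "continuous_on Q h"
    unfolding h_def
  proof (rule continuous_on_retraction_onto[where F = "\<lambda>x. \<Phi> (x, u x)", OF K _ pos])
    fix v
    have "continuous_on Q (\<lambda>x. (x, u x))"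
      using u(1) by (auto intro!: continuous_on_Pair continuous_on_id intro: continuous_on_subset)
    then show "continuous_on Q (\<lambda>x. \<Phi> (x, u x) v)"
      by (rule continuous_on_compose2[OF contPhi[of v]]) (simp add: image_subset_iff u01)
  qed
  moreover have "h x = f x" if "x \<in> C" for x
  proof -
    have "u x = 1" using u(2)[of x] that by auto
    then have "\<Phi> (x, u x) = f x" using F(3)[OF that] by (simp add: \<Phi>_def fun_eq_iff)
    moreover have "f x \<in> realize K" using f(2) that by blast
    ultimately show ?thesis unfolding h_def using retraction_onto_fixes(2)[OF K] by simp
  qed
  ultimately show thesis using that by blast
qed

lemma closed_realize:
  assumes K: "simplicial_complex K"
  shows "closed (realize K)"
proof -
  define V where "V = \<Union>K"
  have finV: "finite V" using K by (auto simp: simplicial_complex_def V_def)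
  have eq: "realize K = (\<Union>\<sigma>\<in>K. {x. (\<forall>v. 0 \<le> x v) \<and> (\<forall>v\<in>-\<sigma>. x v = 0) \<and> sum x \<sigma> = 1})" (is "_ = ?R")
  proof
    show "realize K \<subseteq> ?R"
    proof
      fix x assume x: "x \<in> realize K"
      then have "{v. x v \<noteq> 0} \<in> K" "\<forall>v. 0 \<le> x v" "sum x {v. x v \<noteq> 0} = 1"
        by (simp_all add: realize_def)
      then show "x \<in> ?R"
        by (intro UN_I[of "{v. x v \<noteq> 0}"]) (simp_all only: mem_Collect_eq, simp)
    qed
    show "?R \<subseteq> realize K"
    proof
      fix x assume "x \<in> ?R"
      then obtain \<sigma> where \<sigma>: "\<sigma> \<in> K" "\<forall>v. 0 \<le> x v" "\<forall>v\<in>-\<sigma>. x v = 0" "sum x \<sigma> = 1" by blast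
      moreover have "finite \<sigma>" using finV \<sigma>(1) unfolding V_def by (meson Sup_upper finite_subset)
      ultimately show "x \<in> realize K" by (intro realizeI[OF _ _ _ K, of \<sigma> _ \<sigma>]) auto
    qed
  qed
  have "closed {x::'a \<Rightarrow> real. (\<forall>v. 0 \<le> x v) \<and> (\<forall>v\<in>-\<sigma>. x v = 0) \<and> sum x \<sigma> = 1}" for \<sigma>
  proof -
    have c: "continuous_on UNIV (\<lambda>x::'a\<Rightarrow>real. sum x \<sigma>)"
      by (intro continuous_intros continuous_on_product_coordinates)
    have 1: "closed {x::'a \<Rightarrow> real. 0 \<le> x v}" for v
      by (rule closed_Collect_le) (auto intro: continuous_on_product_coordinates)
    have 2: "closed {x::'a \<Rightarrow> real. x v = 0}" for v
      by (rule closed_Collect_eq) (auto intro: continuous_on_product_coordinates)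
    have 3: "closed {x::'a \<Rightarrow> real. sum x \<sigma> = 1}"
      by (rule closed_Collect_eq) (auto intro: c)
    have "{x::'a \<Rightarrow> real. (\<forall>v. 0 \<le> x v) \<and> (\<forall>v\<in>-\<sigma>. x v = 0) \<and> sum x \<sigma> = 1} =
      (\<Inter>v. {x. 0 \<le> x v}) \<inter> (\<Inter>v\<in>-\<sigma>. {x. x v = 0}) \<inter> {x. sum x \<sigma> = 1}" by auto
    moreover have "closed \<dots>"
      using 1 2 3 by (intro closed_Int closed_INT) auto
    ultimately show ?thesis by simp
  qed
  moreover have "finite K" using finV unfolding V_def by (rule finite_UnionD)
  ultimately show ?thesis unfolding eq by (intro closed_UN) auto
qed

section \<open>Bricks and extension of maps\<close>

text \<open>
  Bricks live in one space of sequences, and some of their sides may be degenerate.  So faces of a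
  brick are bricks again, and a statement about all bricks with at most d proper axes can be proved by
  induction on d without changing the ambient type.
\<close>

definition brick :: "(nat \<Rightarrow> real) \<Rightarrow> (nat \<Rightarrow> real) \<Rightarrow> (nat \<Rightarrow> real) set" where
  "brick a b = {x. a \<le> x \<and> x \<le> b}"

definition axes :: "(nat \<Rightarrow> real) \<Rightarrow> (nat \<Rightarrow> real) \<Rightarrow> nat set" where
  "axes a b = {i. a i \<noteq> b i}"

definition rim :: "(nat \<Rightarrow> real) \<Rightarrow> (nat \<Rightarrow> real) \<Rightarrow> (nat \<Rightarrow> real) set" where
  "rim a b = {x \<in> brick a b. \<exists>i\<in>axes a b. x i = a i \<or> x i = b i}"

text \<open>
  This is the notion of d-1-connectedness that the proof works with: every map from a closed subset of
  a brick of dimension at most d extends (such a set is said to be an absolute extensor in dimension d).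
  For the realization of a finite complex it is equivalent to the extension of maps from spheres to balls,
  but it is much better suited to gluing, because the closed subset is arbitrary.
\<close>

definition extensor :: "nat \<Rightarrow> ('a \<Rightarrow> real) set \<Rightarrow> bool" where
  "extensor d T \<longleftrightarrow>
     (\<forall>a b C f. a \<le> b \<and> finite (axes a b) \<and> card (axes a b) \<le> d \<and> closed C \<and> C \<subseteq> brick a b \<and>
        continuous_on C f \<and> f ` C \<subseteq> T \<longrightarrow>
        (\<exists>g. continuous_on (brick a b) g \<and> g ` brick a b \<subseteq> T \<and> (\<forall>x\<in>C. g x = f x)))"

lemma extensorE:
  assumes "extensor d T" "a \<le> b" "finite (axes a b)" "card (axes a b) \<le> d" "closed C" "C \<subseteq> brick a b"
    "continuous_on C f" "f ` C \<subseteq> T"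
  obtains g where "continuous_on (brick a b) g" "g ` brick a b \<subseteq> T" "\<And>x. x \<in> C \<Longrightarrow> g x = f x"
proof -
  have "a \<le> b \<and> finite (axes a b) \<and> card (axes a b) \<le> d \<and> closed C \<and> C \<subseteq> brick a b \<and>
      continuous_on C f \<and> f ` C \<subseteq> T"
    using assms(2-) by (intro conjI)
  then have "\<exists>g. continuous_on (brick a b) g \<and> g ` brick a b \<subseteq> T \<and> (\<forall>x\<in>C. g x = f x)"
    by (rule assms(1)[unfolded extensor_def, THEN spec, THEN spec, THEN spec, THEN spec, THEN mp])
  then show thesis using that by (elim exE conjE) simp
qed

lemma extensorI:
  assumes "\<And>a b C f. a \<le> b \<Longrightarrow> finite (axes a b) \<Longrightarrow> card (axes a b) \<le> d \<Longrightarrow> closed C \<Longrightarrow>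
      C \<subseteq> brick a b \<Longrightarrow> continuous_on C f \<Longrightarrow> f ` C \<subseteq> T \<Longrightarrow>
      \<exists>g. continuous_on (brick a b) g \<and> g ` brick a b \<subseteq> T \<and> (\<forall>x\<in>C. g x = f x)"
  shows "extensor d T"
  unfolding extensor_def by (intro allI impI, elim conjE) (rule assms)

lemma extensor_mono: 
  assumes "extensor d T" "e \<le> d" shows "extensor e T"
proof (rule extensorI)
  fix a b C and f :: "(nat \<Rightarrow> real) \<Rightarrow> 'a \<Rightarrow> real"
  assume *: "a \<le> b" "finite (axes a b)" "card (axes a b) \<le> e" "closed C" "C \<subseteq> brick a b"
    "continuous_on C f" "f ` C \<subseteq> T"
  then have "card (axes a b) \<le> d" using assms(2) by simp
  from extensorE[OF assms(1) *(1,2) this *(4-7)]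
  show "\<exists>g. continuous_on (brick a b) g \<and> g ` brick a b \<subseteq> T \<and> (\<forall>x\<in>C. g x = f x)"
    by metis
qed

lemma compact_brick: "compact (brick a b)"
proof -
  have "compactin (product_topology (\<lambda>i. euclideanreal) UNIV) (PiE UNIV (\<lambda>i. {a i..b i}))"
    by (auto simp: compactin_PiE)
  moreover have "PiE UNIV (\<lambda>i. {a i..b i}) = brick a b"
    by (auto simp: brick_def PiE_def Pi_def le_fun_def extensional_def)
  ultimately show ?thesis
    by (simp add: euclidean_product_topology compactin_euclidean_iff)
qed

lemma mem_brick: "x \<in> brick a b \<longleftrightarrow> (\<forall>i. a i \<le> x i \<and> x i \<le> b i)"
  unfolding brick_def le_fun_def by blast

lemma closed_brick: "closed (brick a b)"
  using compact_brick by (rule compact_imp_closed)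

definition wall :: "(nat \<Rightarrow> real) \<Rightarrow> (nat \<Rightarrow> real) \<Rightarrow> nat \<times> real \<Rightarrow> (nat \<Rightarrow> real) set" where
  "wall a b p = brick (a(fst p := snd p)) (b(fst p := snd p))"

lemma wall_eq:
  assumes "a i \<le> c" "c \<le> b i"
  shows "brick (a(i := c)) (b(i := c)) = {x \<in> brick a b. x i = c}"
proof (rule Set.set_eqI, rule iffI)
  fix x
  assume x: "x \<in> brick (a(i := c)) (b(i := c))"
  have bds: "(a(i := c)) j \<le> x j \<and> x j \<le> (b(i := c)) j" for j
    using x unfolding mem_brick by blast
  have xi: "x i = c" using bds[of i] by simp
  have "a j \<le> x j \<and> x j \<le> b j" for j
    using bds[of j] xi assms by (cases "j = i") simp_all
  then show "x \<in> {x \<in> brick a b. x i = c}" using xi unfolding mem_brick by blast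
next
  fix x assume x: "x \<in> {x \<in> brick a b. x i = c}"
  then have bds: "a j \<le> x j \<and> x j \<le> b j" for j unfolding mem_brick by blast
  have xi: "x i = c" using x by blast
  have "(a(i := c)) j \<le> x j \<and> x j \<le> (b(i := c)) j" for j
    using bds[of j] xi by (cases "j = i") simp_all
  then show "x \<in> brick (a(i := c)) (b(i := c))" unfolding mem_brick by blast
qed

lemma rim_eq:
  assumes "a \<le> b"
  shows "rim a b = (\<Union>i\<in>axes a b. wall a b (i, a i) \<union> wall a b (i, b i))"
proof -
  have le: "a i \<le> b i" for i using assms by (simp add: le_fun_def)
  have "wall a b (i, a i) = {x \<in> brick a b. x i = a i}" "wall a b (i, b i) = {x \<in> brick a b. x i = b i}" for i
    using le[of i] unfolding wall_def fst_conv snd_conv by (intro wall_eq; simp)+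
  then show ?thesis
    unfolding rim_def by blast
qed

lemma closed_rim:
  assumes "a \<le> b" "finite (axes a b)"
  shows "closed (rim a b)"
  unfolding rim_eq[OF assms(1)] using assms(2) by (intro closed_UN closed_Un ballI) (auto simp: wall_def closed_brick)

lemma glue_continuous:
  assumes "closed C" "closed D" "continuous_on C f" "continuous_on D g"
    "\<And>x. x \<in> C \<Longrightarrow> x \<in> D \<Longrightarrow> f x = g x"
  shows "continuous_on (C \<union> D) (\<lambda>x. if x \<in> D then g x else f x)"
  using assms(5) by (subst Un_commute) (intro continuous_on_cases assms, auto)

lemma extend_over_walls:
  assumes T: "extensor d T" and ab: "a \<le> b" "finite (axes a b)" "card (axes a b) \<le> Suc d"
    and C: "closed C" "C \<subseteq> brick a b" and f: "continuous_on C f" "f ` C \<subseteq> T"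
    and W: "finite W" "\<And>i c. (i, c) \<in> W \<Longrightarrow> i \<in> axes a b \<and> a i \<le> c \<and> c \<le> b i"
  shows "\<exists>g. continuous_on (C \<union> (\<Union>p\<in>W. wall a b p)) g \<and>
      g ` (C \<union> (\<Union>p\<in>W. wall a b p)) \<subseteq> T \<and> (\<forall>x\<in>C. g x = f x)"
  using W
proof (induction W rule: finite_induct)
  case empty
  then show ?case using f by (intro exI[of _ f]) auto
next
  case (insert p W)
  obtain i c where p: "p = (i, c)" by (cases p)
  have ic: "i \<in> axes a b" "a i \<le> c" "c \<le> b i" using insert.prems[of i c] p by auto
  define E where "E = C \<union> (\<Union>p\<in>W. wall a b p)"
  define w where "w = brick (a(i := c)) (b(i := c))"
  have "\<And>i c. (i, c) \<in> W \<Longrightarrow> i \<in> axes a b \<and> a i \<le> c \<and> c \<le> b i"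
    using insert.prems by blast
  from insert.IH[OF this] obtain g where g: "continuous_on E g" "g ` E \<subseteq> T" "\<forall>x\<in>C. g x = f x"
    unfolding E_def by blast
  have clE: "closed E"
    unfolding E_def using insert.hyps(1) by (intro closed_Un C(1) closed_UN) (auto simp: wall_def closed_brick)
  have clw: "closed w" unfolding w_def by (rule closed_brick)
  have ax: "axes (a(i := c)) (b(i := c)) = axes a b - {i}" by (auto simp: axes_def)
  have card: "finite (axes a b - {i})" "card (axes a b - {i}) \<le> d"
    using ab(2,3) ic(1) by (simp_all add: card_Diff_singleton)
  have le: "a(i := c) \<le> b(i := c)" using ab(1) by (auto simp: le_fun_def)
  have gw: "continuous_on (E \<inter> w) g" "g ` (E \<inter> w) \<subseteq> T"
    using g by (auto intro: continuous_on_subset)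
  obtain h where h: "continuous_on w h" "h ` w \<subseteq> T" "\<And>x. x \<in> E \<inter> w \<Longrightarrow> h x = g x"
    using extensorE[OF T le card[folded ax] closed_Int[OF clE clw] _ gw] unfolding w_def by blast
  define k where "k x = (if x \<in> w then h x else g x)" for x
  have "continuous_on (E \<union> w) k"
    unfolding k_def by (rule glue_continuous[OF clE clw g(1) h(1)]) (use h(3) in auto)
  moreover have "k ` (E \<union> w) \<subseteq> T" using g(2) h(2) unfolding k_def by auto
  moreover have "\<forall>x\<in>C. k x = f x" using g(3) h(3) unfolding k_def E_def by auto
  moreover have "C \<union> (\<Union>p\<in>insert p W. wall a b p) = E \<union> w"
    unfolding E_def w_def p wall_def by auto
  ultimately show ?case by metis
qed

text \<open>
  The facets of a brick have one axis fewer.  Adding them one by one, each extension problem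
  takes place inside a single facet.
\<close>

lemma extend_over_rim:
  assumes T: "extensor d T" and ab: "a \<le> b" "finite (axes a b)" "card (axes a b) \<le> Suc d"
    and C: "closed C" "C \<subseteq> brick a b" and f: "continuous_on C f" "f ` C \<subseteq> T"
  obtains g where "continuous_on (C \<union> rim a b) g" "g ` (C \<union> rim a b) \<subseteq> T" "\<And>x. x \<in> C \<Longrightarrow> g x = f x"
proof -
  define W where "W = (\<lambda>i. (i, a i)) ` axes a b \<union> (\<lambda>i. (i, b i)) ` axes a b"
  have "a i \<le> b i" for i using ab(1) by (simp add: le_fun_def)
  then have "\<And>i c. (i, c) \<in> W \<Longrightarrow> i \<in> axes a b \<and> a i \<le> c \<and> c \<le> b i" "finite W"
    using ab(2) unfolding W_def by auto
  moreover have "C \<union> (\<Union>p\<in>W. wall a b p) = C \<union> rim a b"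
    unfolding rim_eq[OF ab(1)] W_def by blast
  ultimately show thesis
    using extend_over_walls[OF T ab C f, of W] that by auto
qed

text \<open>
  Repeated halving of the sides makes a brick arbitrarily small after finitely many steps.
\<close>

lemma brick_bisection_induct:
  fixes P :: "(nat \<Rightarrow> real) \<Rightarrow> (nat \<Rightarrow> real) \<Rightarrow> bool"
  assumes I: "finite I" and \<delta>: "\<delta> > 0"
    and small: "\<And>a b. a \<le> b \<Longrightarrow> axes a b = I \<Longrightarrow> (\<And>i. b i - a i \<le> \<delta>) \<Longrightarrow> P a b"
    and split: "\<And>a b i c. a \<le> b \<Longrightarrow> axes a b = I \<Longrightarrow> i \<in> I \<Longrightarrow> a i < c \<Longrightarrow> c < b i \<Longrightarrow>
      P a (b(i := c)) \<Longrightarrow> P (a(i := c)) b \<Longrightarrow> P a b"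
    and ab: "a \<le> b" "axes a b = I"
  shows "P a b"
proof -
  have main: "P a b" if "a \<le> b" "axes a b = I" "\<And>i. i \<in> I \<Longrightarrow> b i - a i \<le> 2 ^ s i * \<delta>" "sum s I = n" for a b s n
    using that
  proof (induction n arbitrary: a b s)
    case 0
    then have "s i = 0" if "i \<in> I" for i using I that by simp
    then have "b i - a i \<le> \<delta>" for i
      using 0(2,3) \<delta> by (cases "i \<in> I") (auto simp: axes_def)
    then show ?case by (rule small[OF 0(1,2)])
  next
    case (Suc n)
    then obtain i where i: "i \<in> I" "s i \<noteq> 0"
      by (metis sum.neutral nat.distinct(1))
    define c where "c = (a i + b i) / 2"
    define s' where "s' = s(i := s i - 1)"
    have "sum s I = s i + sum s (I - {i})" using I i(1) by (simp add: sum.remove)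
    moreover have "sum s' I = (s i - 1) + sum s (I - {i})"
      using I i(1) unfolding s'_def by (subst sum.remove[of _ i]) auto
    ultimately have n: "sum s' I = n" using Suc.prems(4) i(2) by simp
    have lt: "a i < b i" using Suc.prems(1,2) i(1) unfolding axes_def le_fun_def
      by (metis (mono_tags) mem_Collect_eq order_le_less)
    have w: "(b i - a i) / 2 \<le> 2 ^ s' i * \<delta>"
    proof -
      have "(2::real) ^ s i = 2 * 2 ^ s' i" using i(2) unfolding s'_def by (cases "s i") auto
      then show ?thesis using Suc.prems(3)[OF i(1)] by simp
    qed
    have s': "s' j = s j" if "j \<noteq> i" for j using that unfolding s'_def by simp
    have "P a (b(i := c))"
    proof (rule Suc.IH[OF _ _ _ n])
      show "a \<le> b(i := c)" using Suc.prems(1) lt by (auto simp: le_fun_def c_def)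
      show "axes a (b(i := c)) = I" using Suc.prems(2) lt i(1) by (auto simp: axes_def c_def split: if_splits)
      show "(b(i := c)) j - a j \<le> 2 ^ s' j * \<delta>" if "j \<in> I" for j
        using w Suc.prems(3)[OF that] s'[of j] by (cases "j = i") (auto simp: c_def field_simps)
    qed
    moreover have "P (a(i := c)) b"
    proof (rule Suc.IH[OF _ _ _ n])
      show "a(i := c) \<le> b" using Suc.prems(1) lt by (auto simp: le_fun_def c_def)
      show "axes (a(i := c)) b = I" using Suc.prems(2) lt i(1) by (auto simp: axes_def c_def split: if_splits)
      show "b j - (a(i := c)) j \<le> 2 ^ s' j * \<delta>" if "j \<in> I" for j
        using w Suc.prems(3)[OF that] s'[of j] by (cases "j = i") (auto simp: c_def field_simps)
    qed
    ultimately show ?case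
      using split[OF Suc.prems(1,2) i(1), of c] lt unfolding c_def by simp
  qed
  have "\<exists>m. b i - a i \<le> 2 ^ m * \<delta>" for i
  proof -
    obtain m where "(b i - a i) / \<delta> < 2 ^ m" using real_arch_pow[of 2 "(b i - a i) / \<delta>"] by auto
    then show ?thesis using \<delta> by (intro exI[of _ m]) (simp add: field_simps less_imp_le)
  qed
  then obtain s where "\<And>i. b i - a i \<le> 2 ^ s i * \<delta>" by metis
  then show ?thesis using main[OF ab] by blast
qed

text \<open>
  The distance on sequences is a sum of truncated coordinate distances with geometric weights of total
  mass two, so small bricks have small diameter.
\<close>

lemma dist_le_of_coordinates:
  fixes x y :: "nat \<Rightarrow> real"
  assumes "\<And>i. dist (x i) (y i) \<le> \<delta>"
  shows "dist x y \<le> 2 * \<delta>"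
proof -
  have s: "summable (\<lambda>n. (1 / 2) ^ n * \<delta>)" by (intro summable_mult2 summable_geometric) simp
  have le: "(1 / 2) ^ n * min (dist (x (from_nat n)) (y (from_nat n))) 1 \<le> (1 / 2) ^ n * \<delta>" for n
    using assms[of "from_nat n"] by (intro mult_left_mono) auto
  have "summable (\<lambda>n. (1 / 2) ^ n * min (dist (x (from_nat n)) (y (from_nat n))) 1)"
    by (rule summable_comparison_test'[OF s]) (use le in auto)
  then have "dist x y \<le> suminf (\<lambda>n. (1 / 2) ^ n * \<delta>)"
    unfolding dist_fun_def using le s by (intro suminf_le)
  also have "\<dots> = 2 * \<delta>"
    using suminf_mult2[of "\<lambda>n. (1 / 2) ^ n :: real" \<delta>] suminf_geometric[of "1/2::real"]
    by (simp add: summable_geometric)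
  finally show ?thesis .
qed

section \<open>Raising the dimension\<close>

text \<open>
  The classical form of connectedness: spheres, here in the shape of boundaries of bricks, bound.
\<close>

definition fills :: "nat \<Rightarrow> ('a \<Rightarrow> real) set \<Rightarrow> bool" where
  "fills d T \<longleftrightarrow>
     (\<forall>a b f. a \<le> b \<and> finite (axes a b) \<and> card (axes a b) = d \<and>
        continuous_on (rim a b) f \<and> f ` rim a b \<subseteq> T \<longrightarrow>
        (\<exists>g. continuous_on (brick a b) g \<and> g ` brick a b \<subseteq> T \<and> (\<forall>x\<in>rim a b. g x = f x)))"

lemma rim_subset_brick: "rim a b \<subseteq> brick a b"
  unfolding rim_def by blast

lemma extensor_nonempty:
  assumes "extensor d T" shows "T \<noteq> {}"
proof -
  have ax: "axes (\<lambda>_. 0) (\<lambda>_. 0::real) = {}" by (simp add: axes_def)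
  obtain g where "g ` brick (\<lambda>_. 0) (\<lambda>_. 0) \<subseteq> T"
    by (rule extensorE[OF assms, of "\<lambda>_. 0" "\<lambda>_. 0" "{}"]) (simp_all add: ax)
  moreover have "(\<lambda>_. 0) \<in> brick (\<lambda>_. 0) (\<lambda>_. 0::real)" by (simp add: mem_brick)
  ultimately show ?thesis by blast
qed

lemma extensor_0:
  assumes "T \<noteq> {}" shows "extensor 0 T"
proof (rule extensorI)
  fix a b C and f :: "(nat \<Rightarrow> real) \<Rightarrow> 'a \<Rightarrow> real"
  assume *: "finite (axes a b)" "card (axes a b) \<le> 0" "C \<subseteq> brick a b" "f ` C \<subseteq> T"
  then have ab: "a = b" by (auto simp: axes_def)
  have single: "x = a" if "x \<in> brick a b" for x
    using that unfolding mem_brick ab by (auto intro: antisym)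
  obtain t where t: "t \<in> T" using assms by blast
  define y where "y = (if C = {} then t else f a)"
  have fa: "f x = y" if "x \<in> C" for x
    using that single *(3) unfolding y_def by auto
  have "y \<in> T"
  proof (cases "C = {}")
    case False
    then obtain x where "x \<in> C" by blast
    then show ?thesis using fa *(4) by blast
  qed (simp add: y_def t)
  then show "\<exists>g. continuous_on (brick a b) g \<and> g ` brick a b \<subseteq> T \<and> (\<forall>x\<in>C. g x = f x)"
    using fa by (intro exI[of _ "\<lambda>_. y"]) auto
qed

lemma rim_split_subset:
  assumes "a \<le> b" "a i < c" "c < b i" "i \<in> axes a b"
  shows "rim a (b(i := c)) \<subseteq> rim a b \<union> {x \<in> brick a b. x i = c}"
    and "rim (a(i := c)) b \<subseteq> rim a b \<union> {x \<in> brick a b. x i = c}"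
    and "brick a (b(i := c)) = {x \<in> brick a b. x i \<le> c}"
    and "brick (a(i := c)) b = {x \<in> brick a b. c \<le> x i}"
    and "{x \<in> rim a b. x i \<le> c} \<subseteq> rim a (b(i := c))"
    and "{x \<in> rim a b. c \<le> x i} \<subseteq> rim (a(i := c)) b"
    and "{x \<in> brick a b. x i = c} \<subseteq> rim a (b(i := c)) \<inter> rim (a(i := c)) b"
    and "axes a (b(i := c)) = axes a b" "axes (a(i := c)) b = axes a b"
proof -
  show b1: "brick a (b(i := c)) = {x \<in> brick a b. x i \<le> c}"
  proof (intro Set.set_eqI iffI)
    fix x assume "x \<in> brick a (b(i := c))"
    then have bds: "a j \<le> x j \<and> x j \<le> (b(i := c)) j" for j unfolding mem_brick by blast
    have "a j \<le> x j \<and> x j \<le> b j" for j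
      using bds[of j] assms(3) by (cases "j = i") simp_all
    moreover have "x i \<le> c" using bds[of i] by simp
    ultimately show "x \<in> {x \<in> brick a b. x i \<le> c}" unfolding mem_brick by blast
  next
    fix x assume x: "x \<in> {x \<in> brick a b. x i \<le> c}"
    then have bds: "a j \<le> x j \<and> x j \<le> b j" for j unfolding mem_brick by blast
    have "a j \<le> x j \<and> x j \<le> (b(i := c)) j" for j using bds[of j] x by (cases "j = i") simp_all
    then show "x \<in> brick a (b(i := c))" unfolding mem_brick by blast
  qed
  show b2: "brick (a(i := c)) b = {x \<in> brick a b. c \<le> x i}"
  proof (intro Set.set_eqI iffI)
    fix x assume "x \<in> brick (a(i := c)) b"
    then have bds: "(a(i := c)) j \<le> x j \<and> x j \<le> b j" for j unfolding mem_brick by blast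
    have "a j \<le> x j \<and> x j \<le> b j" for j
      using bds[of j] assms(2) by (cases "j = i") simp_all
    moreover have "c \<le> x i" using bds[of i] by simp
    ultimately show "x \<in> {x \<in> brick a b. c \<le> x i}" unfolding mem_brick by blast
  next
    fix x assume x: "x \<in> {x \<in> brick a b. c \<le> x i}"
    then have bds: "a j \<le> x j \<and> x j \<le> b j" for j unfolding mem_brick by blast
    have "(a(i := c)) j \<le> x j \<and> x j \<le> b j" for j using bds[of j] x by (cases "j = i") simp_all
    then show "x \<in> brick (a(i := c)) b" unfolding mem_brick by blast
  qed
  show ax1: "axes a (b(i := c)) = axes a b" and ax2: "axes (a(i := c)) b = axes a b"
    using assms(2-4) by (auto simp: axes_def)
  show "rim a (b(i := c)) \<subseteq> rim a b \<union> {x \<in> brick a b. x i = c}"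
    unfolding rim_def b1 ax1 by (auto simp: fun_upd_def)
  show "rim (a(i := c)) b \<subseteq> rim a b \<union> {x \<in> brick a b. x i = c}"
    unfolding rim_def b2 ax2 by (auto simp: fun_upd_def)
  show "{x \<in> rim a b. x i \<le> c} \<subseteq> rim a (b(i := c))"
  proof
    fix x assume "x \<in> {x \<in> rim a b. x i \<le> c}"
    then obtain j where j: "j \<in> axes a b" "x j = a j \<or> x j = b j" "x \<in> brick a b" "x i \<le> c"
      unfolding rim_def by blast
    have "x j = a j \<or> x j = (b(i := c)) j" using j assms(3) by (cases "j = i") auto
    then show "x \<in> rim a (b(i := c))" using j unfolding rim_def b1 ax1 by blast
  qed
  show "{x \<in> rim a b. c \<le> x i} \<subseteq> rim (a(i := c)) b"
  proof
    fix x assume "x \<in> {x \<in> rim a b. c \<le> x i}"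
    then obtain j where j: "j \<in> axes a b" "x j = a j \<or> x j = b j" "x \<in> brick a b" "c \<le> x i"
      unfolding rim_def by blast
    have "x j = (a(i := c)) j \<or> x j = b j" using j assms(2) by (cases "j = i") auto
    then show "x \<in> rim (a(i := c)) b" using j unfolding rim_def b2 ax2 by blast
  qed
  show "{x \<in> brick a b. x i = c} \<subseteq> rim a (b(i := c)) \<inter> rim (a(i := c)) b"
    unfolding rim_def b1 b2 ax1 ax2 using assms(4) by (auto simp: fun_upd_def)
qed

text \<open>
  Here F is the map on a closed neighbourhood C' of C.  A brick smaller than the gap
  between C and the complement of C' either misses C, and then it is filled from its boundary, or lies in
  C', and then F is used.  A larger brick is bisected: the cutting wall has one axis fewer, so the map extends
  over it, and the two halves are treated separately.
\<close>

lemma extension_from_rim: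
  fixes F :: "(nat \<Rightarrow> real) \<Rightarrow> 'a \<Rightarrow> real"
  assumes ext: "extensor d T" and fil: "fills (Suc d) T"
    and I: "finite I" "card I = Suc d"
    and sep: "\<And>x y. x \<in> C \<Longrightarrow> y \<in> B \<Longrightarrow> dist x y \<le> \<epsilon> \<Longrightarrow> y \<in> C'" and "\<epsilon> > 0" and CC': "C \<subseteq> C'"
    and C': "closed C'" "C' \<subseteq> B" and F: "continuous_on C' F" "F ` C' \<subseteq> T"
    and ab: "a \<le> b" "axes a b = I" "brick a b \<subseteq> B"
    and h: "continuous_on ((C' \<inter> brick a b) \<union> rim a b) h" "h ` ((C' \<inter> brick a b) \<union> rim a b) \<subseteq> T"
      "\<And>x. x \<in> C' \<inter> brick a b \<Longrightarrow> h x = F x"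
  shows "\<exists>g. continuous_on (brick a b) g \<and> g ` brick a b \<subseteq> T \<and> (\<forall>x\<in>(C \<inter> brick a b) \<union> rim a b. g x = h x)"
proof -
  define P where "P a b \<longleftrightarrow> (brick a b \<subseteq> B \<longrightarrow> (\<forall>h. continuous_on ((C' \<inter> brick a b) \<union> rim a b) h \<and>
      h ` ((C' \<inter> brick a b) \<union> rim a b) \<subseteq> T \<and> (\<forall>x\<in>C' \<inter> brick a b. h x = F x) \<longrightarrow>
      (\<exists>g. continuous_on (brick a b) g \<and> g ` brick a b \<subseteq> T \<and> (\<forall>x\<in>(C \<inter> brick a b) \<union> rim a b. g x = h x))))"
    for a b
  have "P a b"
  proof (rule brick_bisection_induct[OF I(1), of "\<epsilon> / 2"])
    show "\<epsilon> / 2 > 0" using \<open>\<epsilon> > 0\<close> by simp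
    show "a \<le> b" "axes a b = I" by fact+
  next
    fix a b :: "nat \<Rightarrow> real"
    assume ab: "a \<le> b" "axes a b = I" and small: "\<And>i. b i - a i \<le> \<epsilon> / 2"
    show "P a b"
      unfolding P_def
    proof (intro impI allI, elim conjE)
      fix h assume B: "brick a b \<subseteq> B" and h: "continuous_on ((C' \<inter> brick a b) \<union> rim a b) h"
        "h ` ((C' \<inter> brick a b) \<union> rim a b) \<subseteq> T" "\<forall>x\<in>C' \<inter> brick a b. h x = F x"
      show "\<exists>g. continuous_on (brick a b) g \<and> g ` brick a b \<subseteq> T \<and> (\<forall>x\<in>(C \<inter> brick a b) \<union> rim a b. g x = h x)"
      proof (cases "C \<inter> brick a b = {}")
        case True
        have "continuous_on (rim a b) h" "h ` rim a b \<subseteq> T"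
          using h(1,2) by (auto intro: continuous_on_subset)
        then have "\<exists>g. continuous_on (brick a b) g \<and> g ` brick a b \<subseteq> T \<and> (\<forall>x\<in>rim a b. g x = h x)"
          using fil[unfolded fills_def, rule_format, of a b h] ab I by simp
        then show ?thesis unfolding True by simp
      next
        case False
        then obtain x where x: "x \<in> C" "x \<in> brick a b" by blast
        have sub: "brick a b \<subseteq> C'"
        proof
          fix y assume y: "y \<in> brick a b"
          have "dist (x i) (y i) \<le> \<epsilon> / 2" for i
          proof -
            have "a i \<le> x i \<and> x i \<le> b i" "a i \<le> y i \<and> y i \<le> b i"
              using x(2) y unfolding mem_brick by blast+
            then show ?thesis using small[of i] unfolding dist_real_def by linarith
          qed
          from dist_le_of_coordinates[OF this] have "dist x y \<le> \<epsilon>" by simp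
          then show "y \<in> C'" using sep x(1) y B by blast
        qed
        have "(C \<inter> brick a b) \<union> rim a b \<subseteq> C' \<inter> brick a b"
          using rim_subset_brick[of a b] sub CC' by blast
        then have "\<forall>x\<in>(C \<inter> brick a b) \<union> rim a b. F x = h x"
          using h(3) by (metis subsetD)
        moreover have "continuous_on (brick a b) F" "F ` brick a b \<subseteq> T"
          using sub F by (auto intro: continuous_on_subset)
        ultimately show ?thesis by blast
      qed
    qed
  next
    fix a b :: "nat \<Rightarrow> real" and i c
    assume ab: "a \<le> b" "axes a b = I" and i: "i \<in> I" and c: "a i < c" "c < b i"
      and P1: "P a (b(i := c))" and P2: "P (a(i := c)) b"
    note sp = rim_split_subset[OF ab(1) c, unfolded ab(2), OF i]
    define w where "w = {x \<in> brick a b. x i = c}"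
    have w_eq: "w = brick (a(i := c)) (b(i := c))"
      unfolding w_def using c by (intro wall_eq[symmetric]) auto
    have clw: "closed w" unfolding w_eq by (rule closed_brick)
    show "P a b"
      unfolding P_def
    proof (intro impI allI, elim conjE)
      fix h assume B: "brick a b \<subseteq> B" and h: "continuous_on ((C' \<inter> brick a b) \<union> rim a b) h"
        "h ` ((C' \<inter> brick a b) \<union> rim a b) \<subseteq> T" "\<forall>x\<in>C' \<inter> brick a b. h x = F x"
      define D where "D = (C' \<inter> brick a b) \<union> rim a b"
      have clD: "closed D"
        unfolding D_def using C'(1) closed_brick closed_rim[OF ab(1)] ab(2) I(1) by auto
      have axw: "axes (a(i := c)) (b(i := c)) = I - {i}" using ab(2) by (auto simp: axes_def)
      have hDw: "continuous_on (D \<inter> w) h" "h ` (D \<inter> w) \<subseteq> T"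
        using h(1,2) unfolding D_def by (auto intro: continuous_on_subset)
      have lew: "a(i := c) \<le> b(i := c)" using ab(1) by (auto simp: le_fun_def)
      have finw: "finite (I - {i})" "card (I - {i}) \<le> d" using I i by simp_all
      obtain k where k: "continuous_on w k" "k ` w \<subseteq> T" "\<And>x. x \<in> D \<inter> w \<Longrightarrow> k x = h x"
        using extensorE[OF ext lew finw[folded axw] closed_Int[OF clD clw] _ hDw] unfolding w_eq by blast
      define h' where "h' x = (if x \<in> w then k x else h x)" for x
      have h'cont: "continuous_on (D \<union> w) h'"
        unfolding h'_def using h(1) k by (intro glue_continuous clD clw) (auto simp: D_def)
      have h'T: "h' ` (D \<union> w) \<subseteq> T" using h(2) k(2) unfolding h'_def D_def by auto
      have h'D: "h' x = h x" if "x \<in> D" for x using k(3) that unfolding h'_def by auto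
      have sub1: "(C' \<inter> brick a (b(i := c))) \<union> rim a (b(i := c)) \<subseteq> D \<union> w"
        using sp(1) unfolding sp(3) D_def w_def by blast
      have sub2: "(C' \<inter> brick (a(i := c)) b) \<union> rim (a(i := c)) b \<subseteq> D \<union> w"
        using sp(2) unfolding sp(4) D_def w_def by blast
      have h'F: "h' x = F x" if "x \<in> C' \<inter> brick a b" for x
        using h'D[of x] h(3) that unfolding D_def by auto
      have "brick a (b(i := c)) \<subseteq> B" "brick (a(i := c)) b \<subseteq> B" using B unfolding sp(3,4) by auto
      moreover have "\<forall>x\<in>C' \<inter> brick a (b(i := c)). h' x = F x" "\<forall>x\<in>C' \<inter> brick (a(i := c)) b. h' x = F x"
        using h'F unfolding sp(3,4) by auto
      ultimately have "\<exists>g. continuous_on (brick a (b(i := c))) g \<and> g ` brick a (b(i := c)) \<subseteq> T \<and>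
           (\<forall>x\<in>(C \<inter> brick a (b(i := c))) \<union> rim a (b(i := c)). g x = h' x)"
        and "\<exists>g. continuous_on (brick (a(i := c)) b) g \<and> g ` brick (a(i := c)) b \<subseteq> T \<and>
           (\<forall>x\<in>(C \<inter> brick (a(i := c)) b) \<union> rim (a(i := c)) b. g x = h' x)"
        using P1[unfolded P_def, rule_format, of h'] P2[unfolded P_def, rule_format, of h']
          continuous_on_subset[OF h'cont sub1] continuous_on_subset[OF h'cont sub2]
          image_mono[OF sub1, of h'] image_mono[OF sub2, of h'] h'T
        by (meson subset_trans)+
      then obtain g1 g2 where g1: "continuous_on (brick a (b(i := c))) g1" "g1 ` brick a (b(i := c)) \<subseteq> T"
           "\<forall>x\<in>(C \<inter> brick a (b(i := c))) \<union> rim a (b(i := c)). g1 x = h' x"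
         and g2: "continuous_on (brick (a(i := c)) b) g2" "g2 ` brick (a(i := c)) b \<subseteq> T"
           "\<forall>x\<in>(C \<inter> brick (a(i := c)) b) \<union> rim (a(i := c)) b. g2 x = h' x"
        by blast
      define g where "g x = (if x \<in> brick (a(i := c)) b then g2 x else g1 x)" for x
      have agree: "g1 x = g2 x" if "x \<in> brick a (b(i := c))" "x \<in> brick (a(i := c)) b" for x
      proof -
        have "x \<in> w" using that unfolding sp(3,4) w_def by auto
        then have "x \<in> rim a (b(i := c))" "x \<in> rim (a(i := c)) b" using sp(7) unfolding w_def by blast+
        then show ?thesis using g1(3) g2(3) by (metis UnI2)
      qed
      have un: "brick a (b(i := c)) \<union> brick (a(i := c)) b = brick a b" unfolding sp(3,4) by auto
      have "continuous_on (brick a b) g"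
        unfolding g_def un[symmetric]
        by (intro glue_continuous closed_brick g1(1) g2(1) agree)
      moreover have "g ` brick a b \<subseteq> T" using g1(2) g2(2) unfolding g_def un[symmetric] by auto
      moreover have "\<forall>x\<in>(C \<inter> brick a b) \<union> rim a b. g x = h x"
      proof
        fix x assume x: "x \<in> (C \<inter> brick a b) \<union> rim a b"
        then have "x \<in> D" using CC' unfolding D_def by auto
        have xb: "x \<in> brick a b" using x rim_subset_brick by blast
        have "g x = h' x"
        proof (cases "c \<le> x i")
          case True
          then have "x \<in> brick (a(i := c)) b" "x \<in> (C \<inter> brick (a(i := c)) b) \<union> rim (a(i := c)) b"
            using x xb sp(6) True unfolding sp(4) by blast+
          then show ?thesis using g2(3) unfolding g_def by metis
        next
          case False
          then have "x \<notin> brick (a(i := c)) b" "x \<in> (C \<inter> brick a (b(i := c))) \<union> rim a (b(i := c))"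
            using x xb sp(5) False unfolding sp(3,4) by (blast, auto)
          then show ?thesis using g1(3) unfolding g_def by metis
        qed
        then show "g x = h x" using h'D[OF \<open>x \<in> D\<close>] by simp
      qed
      ultimately show "\<exists>g. continuous_on (brick a b) g \<and> g ` brick a b \<subseteq> T \<and>
          (\<forall>x\<in>(C \<inter> brick a b) \<union> rim a b. g x = h x)" by blast
    qed
  qed
  moreover have "continuous_on ((C' \<inter> brick a b) \<union> rim a b) h \<and>
      h ` ((C' \<inter> brick a b) \<union> rim a b) \<subseteq> T \<and> (\<forall>x\<in>C' \<inter> brick a b. h x = F x)"
    using h by (intro conjI ballI)
  ultimately show ?thesis
    unfolding P_def using ab(3) by (elim impE allE[of _ h])
qed

lemma compact_closed_gap:
  fixes C B :: "'x::metric_space set"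
  assumes "compact C" "closed B" "C \<inter> B = {}"
  obtains e where "e > 0" "\<And>x y. x \<in> C \<Longrightarrow> y \<in> B \<Longrightarrow> e \<le> dist x y"
proof (cases "C = {} \<or> B = {}")
  case True
  then show thesis using that[of 1] by auto
next
  case False
  have "continuous_on C (\<lambda>x. infdist x B)" by (intro continuous_intros)
  then obtain x0 where x0: "x0 \<in> C" "\<And>x. x \<in> C \<Longrightarrow> infdist x0 B \<le> infdist x B"
    using continuous_attains_inf[OF assms(1)] False by metis
  show thesis
  proof (rule that[of "infdist x0 B"])
    show "0 < infdist x0 B" using infdist_pos_not_in_closed[OF assms(2)] False x0(1) assms(3) by blast
    show "infdist x0 B \<le> dist x y" if "x \<in> C" "y \<in> B" for x y
      using x0(2)[OF that(1)] infdist_le[OF that(2), of x] by linarith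
  qed
qed

text \<open>
  Kuratowski's theorem that filling spheres suffices for extending from arbitrary closed sets.
  A map into a complex extends to a neighbourhood, and away from C the brick is cut into small pieces.
\<close>

lemma extensor_Suc:
  fixes K :: "'a set set"
  assumes K: "simplicial_complex K" and ext: "extensor d (realize K)" and fil: "fills (Suc d) (realize K)"
  shows "extensor (Suc d) (realize K)"
proof -
  define T where "T = realize K"
  note ext = ext[folded T_def] and fil = fil[folded T_def]
  have main: "\<exists>g. continuous_on (brick a b) g \<and> g ` brick a b \<subseteq> T \<and> (\<forall>x\<in>C. g x = f x)"
    if ab: "a \<le> b" "finite (axes a b)" "card (axes a b) = Suc d" and C: "closed C" "C \<subseteq> brick a b" "C \<noteq> {}"
      and f: "continuous_on C f" "f ` C \<subseteq> T" for a b C and f :: "(nat \<Rightarrow> real) \<Rightarrow> 'a \<Rightarrow> real"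
  proof -
    obtain U F where U: "open U" "C \<subseteq> U" and F: "continuous_on U F" "F ` U \<subseteq> T" "\<And>x. x \<in> C \<Longrightarrow> F x = f x"
      using neighbourhood_extension[OF K C(1) f(1) f(2)[unfolded T_def]] unfolding T_def by metis
    have cC: "compact C" using C compact_brick by (metis compact_Int_closed inf.absorb_iff2 inf_commute)
    have "closed (brick a b - U)" using closed_brick U(1) by (rule closed_Diff)
    moreover have "C \<inter> (brick a b - U) = {}" using U(2) by blast
    ultimately obtain e where e: "e > 0" "\<And>x y. x \<in> C \<Longrightarrow> y \<in> brick a b - U \<Longrightarrow> e \<le> dist x y"
      using compact_closed_gap[OF cC] by metis
    \<comment> \<open>half of the gap e: points outside of U are at distance at least e from C\<close>
    define C' where "C' = brick a b \<inter> {x. infdist x C \<le> e / 2}"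
    have clC': "closed C'" unfolding C'_def
      by (intro closed_Int closed_brick closed_Collect_le continuous_intros)
    have sep: "y \<in> C'" if "x \<in> C" "y \<in> brick a b" "dist x y \<le> e / 2" for x y
    proof -
      have "infdist y C \<le> dist y x" using that(1) by (rule infdist_le)
      then show ?thesis using that unfolding C'_def by (simp add: dist_commute)
    qed
    have CC': "C \<subseteq> C'" using sep[of x x for x] C(2) e(1) by auto
    have C'U: "C' \<subseteq> U"
    proof
      fix y assume y: "y \<in> C'"
      show "y \<in> U"
      proof (rule ccontr)
        assume "y \<notin> U"
        then have "e \<le> dist y x" if "x \<in> C" for x
          using e(2)[OF that, of y] y unfolding C'_def by (simp add: dist_commute)
        then have "e \<le> infdist y C"
          unfolding infdist_def using C(3) by (auto intro: cINF_greatest)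
        then show False using y e(1) unfolding C'_def by auto
      qed
    qed
    have F': "continuous_on C' F" "F ` C' \<subseteq> T" using F C'U by (auto intro: continuous_on_subset)
    have C'b: "C' \<subseteq> brick a b" unfolding C'_def by blast
    obtain h where h: "continuous_on (C' \<union> rim a b) h" "h ` (C' \<union> rim a b) \<subseteq> T" "\<And>x. x \<in> C' \<Longrightarrow> h x = F x"
      using extend_over_rim[OF ext ab(1,2) eq_refl[OF ab(3)] clC' C'b F'] by metis
    have "C' \<inter> brick a b = C'" using C'b by blast
    then have "\<exists>g. continuous_on (brick a b) g \<and> g ` brick a b \<subseteq> T \<and> (\<forall>x\<in>(C \<inter> brick a b) \<union> rim a b. g x = h x)"
      using h e(1)
      by (intro extension_from_rim[where \<epsilon> = "e / 2", OF ext fil ab(2,3) sep _ CC' clC' C'b F' ab(1) refl subset_refl]) auto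
    then obtain g where g: "continuous_on (brick a b) g" "g ` brick a b \<subseteq> T"
      "\<forall>x\<in>(C \<inter> brick a b) \<union> rim a b. g x = h x" by blast
    have "g x = f x" if "x \<in> C" for x
    proof -
      have "x \<in> C'" "x \<in> (C \<inter> brick a b) \<union> rim a b" using that CC' C(2) by blast+
      then show ?thesis using g(3) h(3) F(3)[OF that] by metis
    qed
    then show ?thesis using g(1,2) by blast
  qed
  have "extensor (Suc d) T"
  proof (rule extensorI)
    fix a b C and f :: "(nat \<Rightarrow> real) \<Rightarrow> 'a \<Rightarrow> real"
    assume ab: "a \<le> b" "finite (axes a b)" "card (axes a b) \<le> Suc d" and C: "closed C" "C \<subseteq> brick a b"
      and f: "continuous_on C f" "f ` C \<subseteq> T"
    consider "card (axes a b) \<le> d" | "card (axes a b) = Suc d" "C \<noteq> {}" | "card (axes a b) = Suc d" "C = {}"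
      using ab(3) by linarith
    then show "\<exists>g. continuous_on (brick a b) g \<and> g ` brick a b \<subseteq> T \<and> (\<forall>x\<in>C. g x = f x)"
    proof cases
      case 1
      then show ?thesis using extensorE[OF ext ab(1,2) 1 C f] by metis
    next
      case 2
      then show ?thesis by (intro main ab C f)
    next
      case 3
      obtain t where t: "t \<in> T" using extensor_nonempty[OF ext] by blast
      have "a \<in> brick a b" using ab(1) by (simp add: brick_def)
      then have "\<exists>g. continuous_on (brick a b) g \<and> g ` brick a b \<subseteq> T \<and> (\<forall>x\<in>{a}. g x = t)"
        using t by (intro main ab 3) auto
      then show ?thesis using 3 by blast
    qed
  qed
  then show ?thesis unfolding T_def .
qed

section \<open>Excision, cones and suspensions\<close>

lemma extensor_retract:
  assumes T': "extensor d T'" and i: "continuous_on T i" "i ` T \<subseteq> T'"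
    and p: "continuous_on T' p" "p ` T' \<subseteq> T" "\<And>x. x \<in> T \<Longrightarrow> p (i x) = x"
  shows "extensor d T"
proof (rule extensorI)
  fix a b C and f :: "(nat \<Rightarrow> real) \<Rightarrow> 'b \<Rightarrow> real"
  assume ab: "a \<le> b" "finite (axes a b)" "card (axes a b) \<le> d" and C: "closed C" "C \<subseteq> brick a b"
    and f: "continuous_on C f" "f ` C \<subseteq> T"
  have "continuous_on C (\<lambda>x. i (f x))" using i(1) f by (rule continuous_on_compose2)
  moreover have "(\<lambda>x. i (f x)) ` C \<subseteq> T'" using i(2) f(2) by blast
  ultimately obtain g where g: "continuous_on (brick a b) g" "g ` brick a b \<subseteq> T'" "\<And>x. x \<in> C \<Longrightarrow> g x = i (f x)"
    using extensorE[OF T' ab C] by metis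
  have "continuous_on (brick a b) (\<lambda>x. p (g x))" using p(1) g(1,2) by (rule continuous_on_compose2)
  moreover have "(\<lambda>x. p (g x)) ` brick a b \<subseteq> T" using p(2) g(2) by blast
  moreover have "p (g x) = f x" if "x \<in> C" for x
    unfolding g(3)[OF that] using f(2) that by (intro p(3)) blast
  ultimately show "\<exists>g. continuous_on (brick a b) g \<and> g ` brick a b \<subseteq> T \<and> (\<forall>x\<in>C. g x = f x)"
    by blast
qed

text \<open>
  A Mayer-Vietoris argument: extend the map into the union, and on the part of the brick that lands
  in the second complex replace it by an extension into the intersection.
\<close>

lemma extensor_excision:
  assumes K: "simplicial_complex K" and B: "simplicial_complex B"
    and un: "extensor d (realize (K \<union> B))" and int: "extensor d (realize (K \<inter> B))"
  shows "extensor d (realize K)"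
proof (rule extensorI)
  fix a b C and f :: "(nat \<Rightarrow> real) \<Rightarrow> 'a \<Rightarrow> real"
  assume ab: "a \<le> b" "finite (axes a b)" "card (axes a b) \<le> d" and C: "closed C" "C \<subseteq> brick a b"
    and f: "continuous_on C f" "f ` C \<subseteq> realize K"
  have "f ` C \<subseteq> realize (K \<union> B)" using f(2) unfolding realize_Un by blast
  then obtain g where g: "continuous_on (brick a b) g" "g ` brick a b \<subseteq> realize (K \<union> B)"
    "\<And>x. x \<in> C \<Longrightarrow> g x = f x"
    using extensorE[OF un ab C f(1)] by metis
  define DK where "DK = brick a b \<inter> g -` realize K"
  define DB where "DB = brick a b \<inter> g -` realize B"
  have clK: "closed DK" and clB: "closed DB"
    unfolding DK_def DB_def
    using continuous_closed_preimage[OF g(1) closed_brick] closed_realize[OF K] closed_realize[OF B] by auto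
  have cov: "DK \<union> DB = brick a b" using g(2) unfolding DK_def DB_def realize_Un by blast
  have "continuous_on (DK \<inter> DB) g" using g(1) by (rule continuous_on_subset) (auto simp: DK_def)
  moreover have "g ` (DK \<inter> DB) \<subseteq> realize (K \<inter> B)" unfolding DK_def DB_def realize_Int by blast
  moreover have "DK \<inter> DB \<subseteq> brick a b" using cov by blast
  ultimately obtain h where h: "continuous_on (brick a b) h" "h ` brick a b \<subseteq> realize (K \<inter> B)"
    "\<And>x. x \<in> DK \<inter> DB \<Longrightarrow> h x = g x"
    using extensorE[OF int ab closed_Int[OF clK clB]] by metis
  define k where "k x = (if x \<in> DB then h x else g x)" for x
  have "continuous_on (DK \<union> DB) k"
    unfolding k_def
  proof (rule glue_continuous[OF clK clB])
    show "continuous_on DK g" using g(1) by (rule continuous_on_subset) (use cov in blast)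
    show "continuous_on DB h" using h(1) by (rule continuous_on_subset) (use cov in blast)
    show "g x = h x" if "x \<in> DK" "x \<in> DB" for x using h(3) that by simp
  qed
  then have "continuous_on (brick a b) k" unfolding cov .
  moreover have "k ` brick a b \<subseteq> realize K"
  proof (rule image_subsetI)
    fix x assume x: "x \<in> brick a b"
    show "k x \<in> realize K"
    proof (cases "x \<in> DB")
      case True
      then show ?thesis using h(2) x unfolding k_def realize_Int by auto
    next
      case False
      then have "x \<in> DK" using cov x by blast
      then show ?thesis using False unfolding k_def DK_def by auto
    qed
  qed
  moreover have "k x = f x" if "x \<in> C" for x
  proof -
    have "x \<in> DK" using that g(3)[OF that] C(2) f(2) unfolding DK_def by auto
    then show ?thesis using h(3)[of x] g(3)[OF that] unfolding k_def by auto
  qed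
  ultimately show "\<exists>g. continuous_on (brick a b) g \<and> g ` brick a b \<subseteq> realize K \<and> (\<forall>x\<in>C. g x = f x)"
    by blast
qed

text \<open>
  Every map is contiguous to the constant map at the apex.
\<close>

lemma extensor_cone:
  assumes K: "simplicial_complex K" and v: "{v} \<in> K" "\<And>\<sigma>. \<sigma> \<in> K \<Longrightarrow> insert v \<sigma> \<in> K"
  shows "extensor d (realize K)"
proof (rule extensorI)
  fix a b C and f :: "(nat \<Rightarrow> real) \<Rightarrow> 'a \<Rightarrow> real"
  assume C: "closed C" "C \<subseteq> brick a b" and f: "continuous_on C f" "f ` C \<subseteq> realize K"
  let ?g = "\<lambda>_::nat \<Rightarrow> real. \<lambda>u. if u = v then 1 else (0::real)"
  have contig: "{u. f x u \<noteq> 0} \<union> {u. ?g x u \<noteq> 0} \<in> K" if "x \<in> C" for x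
  proof -
    have "f x \<in> realize K" using f(2) that by blast
    then have "insert v {u. f x u \<noteq> 0} \<in> K" by (intro v(2) realizeD(2))
    moreover have "{u. f x u \<noteq> 0} \<union> {u. ?g x u \<noteq> 0} = insert v {u. f x u \<noteq> 0}" by auto
    ultimately show ?thesis by simp
  qed
  have g1: "continuous_on (brick a b) ?g" by (rule continuous_on_const)
  have g2: "?g ` brick a b \<subseteq> realize K"
    using vertex_in_realize[OF v(1)] by auto
  show "\<exists>g. continuous_on (brick a b) g \<and> g ` brick a b \<subseteq> realize K \<and> (\<forall>x\<in>C. g x = f x)"
    by (rule extension_of_contiguous[OF K compact_brick C f g1 g2 contig]) blast+
qed

definition simplicial_cone :: "'a \<Rightarrow> 'a set set \<Rightarrow> 'a set set" where
  "simplicial_cone v L = {\<sigma>. \<sigma> - {v} \<in> L}"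

definition edge_join :: "'a \<Rightarrow> 'a \<Rightarrow> 'a set set \<Rightarrow> 'a set set" where
  "edge_join v w L = {\<sigma>. \<sigma> - {v, w} \<in> L}"

definition suspension :: "'a \<Rightarrow> 'a \<Rightarrow> 'a set set \<Rightarrow> 'a set set" where
  "suspension v w L = {\<sigma>. \<sigma> - {v, w} \<in> L \<and> \<not> {v, w} \<subseteq> \<sigma>}"

lemma simplicial_complex_edge_join:
  assumes "simplicial_complex L" shows "simplicial_complex (edge_join v w L)"
  unfolding simplicial_complex_def
proof (intro conjI ballI allI impI)
  have "\<Union>(edge_join v w L) \<subseteq> insert v (insert w (\<Union>L))" unfolding edge_join_def by blast
  moreover have "finite (insert v (insert w (\<Union>L)))"
    using assms unfolding simplicial_complex_def by simp
  ultimately show "finite (\<Union>(edge_join v w L))" by (rule finite_subset)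
  fix \<sigma> \<tau> assume "\<sigma> \<in> edge_join v w L" "\<tau> \<subseteq> \<sigma>"
  then have "\<sigma> - {v, w} \<in> L" "\<tau> - {v, w} \<subseteq> \<sigma> - {v, w}" unfolding edge_join_def by blast+
  then have "\<tau> - {v, w} \<in> L" by (rule simplicial_complexD[OF assms])
  then show "\<tau> \<in> edge_join v w L" unfolding edge_join_def by blast
qed

lemma simplicial_complex_cone:
  assumes "simplicial_complex L" shows "simplicial_complex (simplicial_cone v L)"
  using simplicial_complex_edge_join[OF assms, of v v] unfolding simplicial_cone_def edge_join_def by simp

lemma simplicial_complex_suspension:
  assumes "simplicial_complex L" shows "simplicial_complex (suspension v w L)"
proof -
  have sub: "suspension v w L \<subseteq> edge_join v w L" unfolding suspension_def edge_join_def by blast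
  have E: "simplicial_complex (edge_join v w L)" using assms by (rule simplicial_complex_edge_join)
  have "\<Union>(suspension v w L) \<subseteq> \<Union>(edge_join v w L)" using sub by blast
  moreover have "finite (\<Union>(edge_join v w L))" using E unfolding simplicial_complex_def by blast
  ultimately have "finite (\<Union>(suspension v w L))" by (rule finite_subset)
  moreover have "\<tau> \<in> suspension v w L" if "\<sigma> \<in> suspension v w L" "\<tau> \<subseteq> \<sigma>" for \<sigma> \<tau>
  proof -
    have "\<sigma> \<in> edge_join v w L" using that(1) sub by blast
    then have "\<tau> \<in> edge_join v w L" using that(2) by (rule simplicial_complexD[OF E])
    moreover have "\<not> {v, w} \<subseteq> \<tau>" using that unfolding suspension_def by blast
    ultimately show ?thesis unfolding suspension_def edge_join_def by blast
  qed
  ultimately show ?thesis unfolding simplicial_complex_def by blast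
qed

text \<open>
  Suspending raises connectivity by one.  For a map to the suspension the difference of the two pole
  coordinates is a latitude.  Near the equator the map projects to L, and this projection extends over
  the whole boundary of the brick, which has one dimension less.  Off the equator only one pole matters, so the map
  is contiguous to one which is a suspension coordinate joined with the extended projection; this one is
  contiguous to the extended projection followed by a cone.
\<close>

lemma fills_suspension:
  assumes L: "simplicial_complex L" and vw: "v \<noteq> w" "v \<notin> \<Union>L" "w \<notin> \<Union>L"
    and ext: "extensor d (realize L)"
  shows "fills (Suc d) (realize (suspension v w L))"
  unfolding fills_def
proof (intro allI impI, elim conjE)
  fix a b and f :: "(nat \<Rightarrow> real) \<Rightarrow> 'a \<Rightarrow> real"
  let ?S = "suspension v w L"
  assume ab: "a \<le> b" "finite (axes a b)" "card (axes a b) = Suc d"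
    and f: "continuous_on (rim a b) f" "f ` rim a b \<subseteq> realize ?S"
  have S: "simplicial_complex ?S" using L by (rule simplicial_complex_suspension)
  have clr: "closed (rim a b)" using ab(1,2) by (rule closed_rim)
  have fr: "f x \<in> realize ?S" if "x \<in> rim a b" for x using f(2) that by blast
  \<comment> \<open>the latitude, between -1 at w and 1 at v\<close>
  define t where "t x = f x v - f x w" for x
  define \<sigma> where "\<sigma> x = {u. f x u \<noteq> 0} - {v, w}" for x
  have \<sigma>L: "\<sigma> x \<in> L" and notboth: "f x v = 0 \<or> f x w = 0" if "x \<in> rim a b" for x
    using realizeD(2)[OF fr[OF that]] unfolding suspension_def \<sigma>_def by auto
  have nn: "0 \<le> f x u" if "x \<in> rim a b" for x u using realizeD(1)[OF fr[OF that]] .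
  have abst: "\<bar>t x\<bar> = f x v + f x w" if "x \<in> rim a b" for x
    using notboth[OF that] nn[OF that, of v] nn[OF that, of w] unfolding t_def by auto
  have fin\<sigma>: "finite (\<sigma> x)" if "x \<in> rim a b" for x
    using \<sigma>L[OF that] L unfolding simplicial_complex_def by (meson Sup_upper finite_subset)
  have sum\<sigma>: "sum (f x) (\<sigma> x) = 1 - \<bar>t x\<bar>" if "x \<in> rim a b" for x
  proof -
    have "sum (f x) (insert v (insert w (\<sigma> x))) = 1"
      by (rule realizeD(3)[OF fr[OF that]]) (use fin\<sigma>[OF that] in \<open>auto simp: \<sigma>_def\<close>)
    moreover have "sum (f x) (insert v (insert w (\<sigma> x))) = f x v + (f x w + sum (f x) (\<sigma> x))"
      using fin\<sigma>[OF that] vw(1) by (subst sum.insert; simp add: \<sigma>_def)+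
    ultimately show ?thesis using abst[OF that] by simp
  qed
  have contf: "continuous_on (rim a b) (\<lambda>x. f x u)" for u using f(1) by (rule continuous_on_coord)
  have contt: "continuous_on (rim a b) t" unfolding t_def by (intro continuous_intros contf)
  \<comment> \<open>on this band the coordinates in L have total mass at least one half, so that the projection l is defined\<close>
  define C where "C = rim a b \<inter> t -` {-1/2..1/2}"
  have clC: "closed C" unfolding C_def
    using continuous_closed_preimage[OF contt clr, of "{-1/2..1/2}"] by simp
  have Cr: "C \<subseteq> rim a b" and Cb: "C \<subseteq> brick a b" using rim_subset_brick unfolding C_def by blast+
  have tC: "\<bar>t x\<bar> \<le> 1/2" if "x \<in> C" for x using that unfolding C_def by auto
  define l where "l x u = (if u \<in> {v, w} then 0 else f x u / (1 - \<bar>t x\<bar>))" for x u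
  have suppl: "{u. l x u \<noteq> 0} = \<sigma> x" if "x \<in> C" for x
    using tC[OF that] unfolding l_def \<sigma>_def by auto
  have "continuous_on C l"
  proof (rule continuous_on_coordinatewise_then_product)
    fix u
    have "1 - \<bar>t x\<bar> \<noteq> 0" if "x \<in> C" for x using tC[OF that] by auto
    then show "continuous_on C (\<lambda>x. l x u)"
      unfolding l_def
      using continuous_on_subset[OF contf[of u] Cr] continuous_on_subset[OF contt Cr]
      by (cases "u \<in> {v, w}") (auto intro!: continuous_intros)
  qed
  moreover have "l ` C \<subseteq> realize L"
  proof (rule image_subsetI)
    fix x assume x: "x \<in> C"
    then have xr: "x \<in> rim a b" using Cr by blast
    have "sum (l x) (\<sigma> x) = sum (\<lambda>u. f x u / (1 - \<bar>t x\<bar>)) (\<sigma> x)"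
      by (rule sum.cong) (auto simp: l_def \<sigma>_def)
    also have "\<dots> = 1" using sum\<sigma>[OF xr] tC[OF x] by (simp flip: sum_divide_distrib)
    finally have "sum (l x) (\<sigma> x) = 1" .
    moreover have "0 \<le> l x u" for u using nn[OF xr, of u] tC[OF x] unfolding l_def by auto
    ultimately show "l x \<in> realize L"
      using suppl[OF x] by (intro realizeI[OF fin\<sigma>[OF xr] _ \<sigma>L[OF xr] L]) auto
  qed
  ultimately obtain l' where l': "continuous_on (C \<union> rim a b) l'" "l' ` (C \<union> rim a b) \<subseteq> realize L"
    "\<And>x. x \<in> C \<Longrightarrow> l' x = l x"
    using extend_over_rim[OF ext ab(1,2) eq_refl[OF ab(3)] clC Cb] by metis
  have CUr: "C \<union> rim a b = rim a b" using Cr by blast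
  note l' = l'[unfolded CUr]
  have l'L: "l' x \<in> realize L" if "x \<in> rim a b" for x using l'(2) that by blast
  have l'0: "l' x v = 0" "l' x w = 0" if "x \<in> rim a b" for x
    using realize_vertices[OF l'L[OF that]] vw by blast+
  \<comment> \<open>the latitude stretched so that it is a pole outside of the band, where l' is not related to f\<close>
  define \<tau> where "\<tau> x = max (-1) (min 1 (2 * t x))" for x
  define f' where "f' x u = (if u = v then max 0 (\<tau> x) else if u = w then max 0 (- \<tau> x) else (1 - \<bar>\<tau> x\<bar>) * l' x u)" for x u
  have contl': "continuous_on (rim a b) (\<lambda>x. l' x u)" for u using l'(1) by (rule continuous_on_coord)
  have cont\<tau>: "continuous_on (rim a b) \<tau>" unfolding \<tau>_def by (intro continuous_intros contt)
  have \<tau>1: "\<bar>\<tau> x\<bar> \<le> 1" for x unfolding \<tau>_def by (auto simp: max_def min_def)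
  have f'cont: "continuous_on (rim a b) f'"
  proof (rule continuous_on_coordinatewise_then_product)
    fix u
    show "continuous_on (rim a b) (\<lambda>x. f' x u)"
    proof (cases "u = v")
      case True
      then show ?thesis unfolding f'_def by (simp) (intro continuous_intros cont\<tau>)
    next
      case F1: False
      show ?thesis
      proof (cases "u = w")
        case True
        then show ?thesis unfolding f'_def using F1 by (simp) (intro continuous_intros cont\<tau>)
      next
        case False
        then show ?thesis unfolding f'_def using F1 by (simp) (intro continuous_intros cont\<tau> contl')
      qed
    qed
  qed
  have LS: "insert v \<rho> \<in> ?S" "insert w \<rho> \<in> ?S" "\<rho> \<in> ?S" if "\<rho> \<in> L" for \<rho>
  proof -
    have "v \<notin> \<rho>" "w \<notin> \<rho>" using that vw by blast+
    then have "insert v \<rho> - {v, w} = \<rho>" "insert w \<rho> - {v, w} = \<rho>" "\<rho> - {v, w} = \<rho>" by blast+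
    then show "insert v \<rho> \<in> ?S" "insert w \<rho> \<in> ?S" "\<rho> \<in> ?S"
      using that vw(1) \<open>v \<notin> \<rho>\<close> \<open>w \<notin> \<rho>\<close> unfolding suspension_def by auto
  qed
  define \<rho> where "\<rho> x = {u. l' x u \<noteq> 0}" for x
  have \<rho>L: "\<rho> x \<in> L" if "x \<in> rim a b" for x using realizeD(2)[OF l'L[OF that]] unfolding \<rho>_def .
  have supp': "{u. f' x u \<noteq> 0} \<subseteq> (if 0 < \<tau> x then {v} else if \<tau> x < 0 then {w} else {}) \<union> (if \<bar>\<tau> x\<bar> = 1 then {} else \<rho> x)"
    if "x \<in> rim a b" for x
    unfolding f'_def \<rho>_def by (auto simp: max_def split: if_splits)
  have f'S: "f' ` rim a b \<subseteq> realize ?S"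
  proof (rule image_subsetI)
    fix x assume x: "x \<in> rim a b"
    have vw\<rho>: "v \<notin> \<rho> x" "w \<notin> \<rho> x" using l'0[OF x] unfolding \<rho>_def by auto
    have fin: "finite (\<rho> x)" using \<rho>L[OF x] L unfolding simplicial_complex_def by (meson Sup_upper finite_subset)
    have "sum (f' x) (\<rho> x) = (\<Sum>u\<in>\<rho> x. (1 - \<bar>\<tau> x\<bar>) * l' x u)"
      by (rule sum.cong) (use vw\<rho> in \<open>auto simp: f'_def\<close>)
    also have "\<dots> = 1 - \<bar>\<tau> x\<bar>"
      using realizeD(3)[OF l'L[OF x] fin] unfolding \<rho>_def by (simp flip: sum_distrib_left)
    finally have "sum (f' x) (\<rho> x) = 1 - \<bar>\<tau> x\<bar>" .
    moreover have "sum (f' x) (insert v (insert w (\<rho> x))) = f' x v + (f' x w + sum (f' x) (\<rho> x))"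
      using fin vw(1) vw\<rho> by (subst sum.insert; simp)+
    moreover have "f' x v + f' x w = \<bar>\<tau> x\<bar>" using vw(1) unfolding f'_def by auto
    ultimately have sum1: "sum (f' x) (insert v (insert w (\<rho> x))) = 1" by simp
    have nonneg: "0 \<le> f' x u" for u
      using \<tau>1[of x] realizeD(1)[OF l'L[OF x]] unfolding f'_def by auto
    show "f' x \<in> realize ?S"
    proof (rule realizeI[OF _ nonneg _ S _ _ sum1])
      show "finite (insert v (insert w (\<rho> x)))" using fin by simp
      show "(if 0 < \<tau> x then {v} else if \<tau> x < 0 then {w} else {}) \<union> \<rho> x \<in> ?S"
        using LS[OF \<rho>L[OF x]] by auto
      show "u \<in> (if 0 < \<tau> x then {v} else if \<tau> x < 0 then {w} else {}) \<union> \<rho> x" if "f' x u \<noteq> 0" for u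
        using supp'[OF x] that by (auto split: if_splits)
      show "f' x u = 0" if "u \<notin> insert v (insert w (\<rho> x))" for u
        using that unfolding f'_def \<rho>_def by auto
    qed
  qed
  have contig1: "{u. l' x u \<noteq> 0} \<union> {u. (if u = v then 1 else (0::real)) \<noteq> 0} \<in> ?S" if "x \<in> rim a b" for x
  proof -
    have "{u. l' x u \<noteq> 0} \<union> {u. (if u = v then 1 else (0::real)) \<noteq> 0} = insert v (\<rho> x)"
      unfolding \<rho>_def by auto
    then show ?thesis using LS(1)[OF \<rho>L[OF that]] by simp
  qed
  have "{} \<in> L" using extensor_nonempty[OF ext] L unfolding realize_def simplicial_complex_def by blast
  then have vS: "{v} \<in> ?S" using LS(1) by blast
  have l'S: "l' ` rim a b \<subseteq> realize ?S"
    using l'(2) realize_mono[of L ?S] LS(3) by blast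
  have c1: "continuous_on (brick a b) (\<lambda>_. \<lambda>u. if u = v then 1 else (0::real))" by (rule continuous_on_const)
  have c2: "(\<lambda>_. \<lambda>u. if u = v then 1 else (0::real)) ` brick a b \<subseteq> realize ?S"
    using vertex_in_realize[OF vS] by auto
  obtain g1 where g1: "continuous_on (brick a b) g1" "g1 ` brick a b \<subseteq> realize ?S"
    "\<And>x. x \<in> rim a b \<Longrightarrow> g1 x = l' x"
    using extension_of_contiguous[OF S compact_brick clr rim_subset_brick l'(1) l'S c1 c2 contig1] by blast
  have contig2: "{u. f' x u \<noteq> 0} \<union> {u. g1 x u \<noteq> 0} \<in> ?S" if "x \<in> rim a b" for x
  proof -
    have "{u. f' x u \<noteq> 0} \<union> {u. g1 x u \<noteq> 0} \<subseteq> (if 0 < \<tau> x then {v} else if \<tau> x < 0 then {w} else {}) \<union> \<rho> x"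
      using supp'[OF that] unfolding g1(3)[OF that] \<rho>_def by (auto split: if_splits)
    moreover have "(if 0 < \<tau> x then {v} else if \<tau> x < 0 then {w} else {}) \<union> \<rho> x \<in> ?S"
      using LS[OF \<rho>L[OF that]] by auto
    ultimately show ?thesis using simplicial_complexD[OF S] by blast
  qed
  obtain g2 where g2: "continuous_on (brick a b) g2" "g2 ` brick a b \<subseteq> realize ?S"
    "\<And>x. x \<in> rim a b \<Longrightarrow> g2 x = f' x"
    using extension_of_contiguous[OF S compact_brick clr rim_subset_brick f'cont f'S g1(1,2) contig2] by blast
  have contig3: "{u. f x u \<noteq> 0} \<union> {u. g2 x u \<noteq> 0} \<in> ?S" if x: "x \<in> rim a b" for x
  proof -
    define A where "A = (if 0 < t x then {v} else if t x < 0 then {w} else {})"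
    have "A \<union> \<sigma> x \<in> ?S" using LS[OF \<sigma>L[OF x]] unfolding A_def by auto
    moreover have "{u. f x u \<noteq> 0} \<subseteq> A \<union> \<sigma> x"
      using notboth[OF x] nn[OF x, of v] nn[OF x, of w] unfolding A_def \<sigma>_def t_def by auto
    moreover have "{u. f' x u \<noteq> 0} \<subseteq> A \<union> \<sigma> x"
    proof -
      have sg: "0 < \<tau> x \<longleftrightarrow> 0 < t x" "\<tau> x < 0 \<longleftrightarrow> t x < 0" unfolding \<tau>_def by (auto simp: max_def min_def)
      show ?thesis
      proof (cases "x \<in> C")
        case True
        then have "\<rho> x = \<sigma> x" using suppl[OF True] l'(3)[OF True] unfolding \<rho>_def by simp
        then show ?thesis using supp'[OF x] unfolding sg A_def by (auto split: if_splits)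
      next
        case False
        then have "\<bar>t x\<bar> > 1/2" using x unfolding C_def by auto
        then have "\<bar>\<tau> x\<bar> = 1" unfolding \<tau>_def by (auto simp: max_def min_def)
        then show ?thesis using supp'[OF x] unfolding sg A_def by auto
      qed
    qed
    ultimately show ?thesis using simplicial_complexD[OF S] unfolding g2(3)[OF x] by (meson Un_least)
  qed
  obtain g where "continuous_on (brick a b) g" "g ` brick a b \<subseteq> realize ?S"
    "\<And>x. x \<in> rim a b \<Longrightarrow> g x = f x"
    using extension_of_contiguous[OF S compact_brick clr rim_subset_brick f g2(1,2) contig3] by blast
  then show "\<exists>g. continuous_on (brick a b) g \<and> g ` brick a b \<subseteq> realize ?S \<and> (\<forall>x\<in>rim a b. g x = f x)"
    by blast
qed

section \<open>Connectivity under attaching joins and cones\<close>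

text \<open>
  The homotopical connectivity shifted by two, as in the work of Aharoni, Berger and Meshulam: no
  condition for 0, nonempty for 1, connected for 2.  The shift makes the values additive under joins.
\<close>

primrec eta_ge :: "nat \<Rightarrow> ('a \<Rightarrow> real) set \<Rightarrow> bool" where
  "eta_ge 0 T = True"
| "eta_ge (Suc d) T = extensor d T"

lemma eta_ge_mono:
  assumes "eta_ge k T" "j \<le> k" shows "eta_ge j T"
  using assms by (cases j; cases k) (auto intro: extensor_mono)

lemma extensor_suspension:
  assumes L: "simplicial_complex L" "{} \<in> L" and vw: "v \<noteq> w" "v \<notin> \<Union>L" "w \<notin> \<Union>L"
    and ext: "eta_ge k (realize L)"
  shows "extensor k (realize (suspension v w L))"
  using ext
proof (induction k)
  case 0
  have "{v} \<in> suspension v w L" using L(2) vw(1) unfolding suspension_def by auto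
  then have "realize (suspension v w L) \<noteq> {}" using vertex_in_realize[of v] by blast
  then show ?case by (rule extensor_0)
next
  case (Suc d)
  have "extensor d (realize (suspension v w L))"
    by (rule Suc.IH) (rule eta_ge_mono[OF Suc.prems], simp)
  then show ?case
    using Suc.prems
    by (intro extensor_Suc simplicial_complex_suspension L(1) fills_suspension vw) simp_all
qed

text \<open>
  Meshulam's edge removal in the language of complexes.  Adding the edge vw to the independent sets
  attaches its join with the link L; the intersection of the two parts is the suspension of L, so excision
  applies.
\<close>

lemma edge_removal:
  assumes K: "simplicial_complex K" and L: "simplicial_complex L" "{} \<in> L"
    and vw: "v \<noteq> w" "v \<notin> \<Union>L" "w \<notin> \<Union>L"
    and sub: "suspension v w L \<subseteq> K" and nonedge: "{v, w} \<notin> K"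
    and un: "eta_ge (Suc k) (realize (K \<union> edge_join v w L))" and lk: "eta_ge k (realize L)"
  shows "eta_ge (Suc k) (realize K)"
proof -
  have "K \<inter> edge_join v w L = suspension v w L"
  proof
    show "K \<inter> edge_join v w L \<subseteq> suspension v w L"
    proof
      fix \<sigma> assume \<sigma>: "\<sigma> \<in> K \<inter> edge_join v w L"
      then have "\<not> {v, w} \<subseteq> \<sigma>" using simplicial_complexD[OF K, of \<sigma> "{v, w}"] nonedge by blast
      then show "\<sigma> \<in> suspension v w L" using \<sigma> unfolding suspension_def edge_join_def by blast
    qed
    show "suspension v w L \<subseteq> K \<inter> edge_join v w L"
      using sub unfolding suspension_def edge_join_def by blast
  qed
  then have "extensor k (realize (K \<inter> edge_join v w L))"
    using extensor_suspension[OF L vw lk] by simp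
  then show ?thesis
    using extensor_excision[OF K simplicial_complex_edge_join[OF L(1)]] un by simp
qed

lemma realize_Some_iff:
  shows "\<And>x. x \<in> realize K \<Longrightarrow> (\<lambda>w. case w of None \<Rightarrow> 0 | Some v \<Rightarrow> x v) \<in> realize ((`) Some ` K)"
    and "\<And>y. y \<in> realize ((`) Some ` K) \<Longrightarrow> (\<lambda>v. y (Some v)) \<in> realize K"
proof -
  fix x assume x: "x \<in> realize K"
  let ?i = "\<lambda>w. case w of None \<Rightarrow> 0 | Some v \<Rightarrow> x v"
  have supp: "{u. ?i u \<noteq> 0} = Some ` {v. x v \<noteq> 0}"
    by (auto split: option.splits)
  have "sum ?i (Some ` {v. x v \<noteq> 0}) = sum x {v. x v \<noteq> 0}"
    by (subst sum.reindex) auto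
  then show "?i \<in> realize ((`) Some ` K)"
    using x unfolding realize_def mem_Collect_eq supp by (auto split: option.splits)
next
  fix y :: "'a option \<Rightarrow> real" assume y: "y \<in> realize ((`) Some ` K)"
  obtain \<sigma> where \<sigma>: "\<sigma> \<in> K" "{u. y u \<noteq> 0} = Some ` \<sigma>" using realizeD(2)[OF y] by blast
  have supp: "{v. y (Some v) \<noteq> 0} = \<sigma>" using \<sigma>(2) by blast
  have "sum y (Some ` \<sigma>) = 1" using y unfolding realize_def mem_Collect_eq \<sigma>(2) by blast
  moreover have "sum y (Some ` \<sigma>) = (\<Sum>v\<in>\<sigma>. y (Some v))" by (subst sum.reindex) auto
  ultimately show "(\<lambda>v. y (Some v)) \<in> realize K"
    using realizeD(1)[OF y] \<sigma>(1) unfolding realize_def mem_Collect_eq supp by auto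
qed

text \<open>
  Renaming the vertices makes room for one more vertex, None.
\<close>

lemma extensor_Some:
  fixes K :: "'a set set"
  shows "extensor d (realize ((`) Some ` K)) \<longleftrightarrow> extensor d (realize K)"
proof -
  define i where "i x = (\<lambda>w. case w of None \<Rightarrow> 0 | Some v \<Rightarrow> x v)" for x :: "'a \<Rightarrow> real"
  define p where "p y = (\<lambda>v. y (Some v))" for y :: "'a option \<Rightarrow> real"
  have i: "continuous_on (realize K) i"
  proof (rule continuous_on_coordinatewise_then_product)
    fix u
    have "continuous_on (realize K) (\<lambda>x. x v)" for v
      by (rule continuous_on_subset[OF continuous_on_product_coordinates]) simp
    then show "continuous_on (realize K) (\<lambda>x. i x u)"
      unfolding i_def by (cases u) (auto intro: continuous_on_const)
  qed
  have p: "continuous_on (realize ((`) Some ` K)) p"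
    unfolding p_def
    by (rule continuous_on_coordinatewise_then_product)
       (rule continuous_on_subset[OF continuous_on_product_coordinates], simp)
  have iT: "i ` realize K \<subseteq> realize ((`) Some ` K)" and pT: "p ` realize ((`) Some ` K) \<subseteq> realize K"
    unfolding i_def p_def using realize_Some_iff by blast+
  have pi: "p (i x) = x" for x unfolding p_def i_def by simp
  have ip: "i (p y) = y" if "y \<in> realize ((`) Some ` K)" for y
  proof
    fix u
    have "None \<notin> \<Union>((`) Some ` K)" by blast
    then have "y None = 0" using realize_vertices[OF that] by blast
    then show "i (p y) u = y u" unfolding i_def p_def by (cases u) simp_all
  qed
  show ?thesis
  proof
    assume "extensor d (realize ((`) Some ` K))"
    then show "extensor d (realize K)" by (rule extensor_retract[OF _ i iT p pT pi])
  next
    assume "extensor d (realize K)"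
    then show "extensor d (realize ((`) Some ` K))" by (rule extensor_retract[OF _ p pT i iT ip])
  qed
qed

lemma eta_ge_Some: "eta_ge k (realize ((`) Some ` K)) \<longleftrightarrow> eta_ge k (realize K)"
  by (cases k) (simp_all add: extensor_Some)

lemma simplicial_complex_Some:
  assumes "simplicial_complex K" shows "simplicial_complex ((`) Some ` K)"
  unfolding simplicial_complex_def
proof (intro conjI ballI allI impI)
  have "\<Union>((`) Some ` K) = Some ` \<Union>K" by blast
  then show "finite (\<Union>((`) Some ` K))" using assms unfolding simplicial_complex_def by simp
  fix \<sigma> \<tau> assume "\<sigma> \<in> (`) Some ` K" "\<tau> \<subseteq> \<sigma>"
  then obtain \<rho> where \<rho>: "\<rho> \<in> K" "\<tau> \<subseteq> Some ` \<rho>" by blast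
  then obtain \<rho>' where "\<rho>' \<subseteq> \<rho>" "\<tau> = Some ` \<rho>'" by (meson subset_image_iff)
  moreover have "\<rho>' \<in> K" using simplicial_complexD[OF assms \<rho>(1)] calculation(1) .
  ultimately show "\<tau> \<in> (`) Some ` K" by blast
qed

lemma cone_attachment_fresh:
  assumes A: "simplicial_complex A" and L: "simplicial_complex L" "{} \<in> L" "L \<subseteq> A"
    and vw: "v \<noteq> w" "v \<notin> \<Union>A" "w \<notin> \<Union>A"
    and extA: "eta_ge (Suc k) (realize A)" and lk: "eta_ge k (realize L)"
  shows "eta_ge (Suc k) (realize (A \<union> simplicial_cone v L))"
proof -
  have vL: "v \<notin> \<Union>L" "w \<notin> \<Union>L" using vw L(3) by blast+
  have notin: "v \<notin> \<sigma>" "w \<notin> \<sigma>" if "\<sigma> \<in> A" for \<sigma> using that vw by blast+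
  define Kp where "Kp = simplicial_cone w A \<union> simplicial_cone v L"
  have cA: "simplicial_complex (simplicial_cone w A)" and cL: "simplicial_complex (simplicial_cone v L)"
    by (rule simplicial_complex_cone[OF A], rule simplicial_complex_cone[OF L(1)])
  have Kp: "simplicial_complex Kp" unfolding Kp_def using cA cL by (rule simplicial_complex_Un)
  have "eta_ge (Suc k) (realize Kp)"
  proof (rule edge_removal[OF Kp L(1,2) vw(1) vL _ _ _ lk])
    show "suspension v w L \<subseteq> Kp"
    proof
      fix \<sigma> assume \<sigma>: "\<sigma> \<in> suspension v w L"
      then have L': "\<sigma> - {v, w} \<in> L" and "v \<notin> \<sigma> \<or> w \<notin> \<sigma>" unfolding suspension_def by blast+
      then consider "w \<notin> \<sigma>" | "v \<notin> \<sigma>" by blast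
      then show "\<sigma> \<in> Kp"
      proof cases
        case 1
        then have "\<sigma> - {v, w} = \<sigma> - {v}" by blast
        then show ?thesis using L' unfolding Kp_def simplicial_cone_def by simp
      next
        case 2
        then have "\<sigma> - {v, w} = \<sigma> - {w}" by blast
        then show ?thesis using L' L(3) unfolding Kp_def simplicial_cone_def by auto
      qed
    qed
    show "{v, w} \<notin> Kp"
    proof
      assume "{v, w} \<in> Kp"
      then have "{v, w} - {w} \<in> A \<or> {v, w} - {v} \<in> L" unfolding Kp_def simplicial_cone_def by blast
      then show False using notin(1)[of "{v, w} - {w}"] notin(2)[of "{v, w} - {v}"] L(3) vw(1) by blast
    qed
    have J: "simplicial_complex (Kp \<union> edge_join v w L)"
      using Kp simplicial_complex_edge_join[OF L(1)] by (rule simplicial_complex_Un)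
    have "extensor k (realize (Kp \<union> edge_join v w L))"
    proof (rule extensor_cone[OF J])
      show "{w} \<in> Kp \<union> edge_join v w L" using L(2,3) unfolding Kp_def simplicial_cone_def by auto
      fix \<sigma> assume "\<sigma> \<in> Kp \<union> edge_join v w L"
      then consider "\<sigma> - {w} \<in> A" | "\<sigma> - {v} \<in> L" | "\<sigma> - {v, w} \<in> L"
        unfolding Kp_def simplicial_cone_def edge_join_def by blast
      then show "insert w \<sigma> \<in> Kp \<union> edge_join v w L"
      proof cases
        case 1
        moreover have "insert w \<sigma> - {w} = \<sigma> - {w}" by blast
        ultimately show ?thesis unfolding Kp_def simplicial_cone_def by auto
      next
        case 2
        have "\<sigma> - {v, w} \<in> L" by (rule simplicial_complexD[OF L(1) 2]) blast
        moreover have "insert w \<sigma> - {v, w} = \<sigma> - {v, w}" by blast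
        ultimately show ?thesis unfolding edge_join_def by auto
      next
        case 3
        moreover have "insert w \<sigma> - {v, w} = \<sigma> - {v, w}" by blast
        ultimately show ?thesis unfolding edge_join_def by auto
      qed
    qed
    then show "eta_ge (Suc k) (realize (Kp \<union> edge_join v w L))" by simp
  qed
  moreover have "(A \<union> simplicial_cone v L) \<union> simplicial_cone w A = Kp"
  proof -
    have "A \<subseteq> simplicial_cone w A"
    proof
      fix \<sigma> assume "\<sigma> \<in> A"
      moreover have "\<sigma> - {w} = \<sigma>" using notin(2)[OF \<open>\<sigma> \<in> A\<close>] by blast
      ultimately show "\<sigma> \<in> simplicial_cone w A" unfolding simplicial_cone_def by simp
    qed
    then show ?thesis unfolding Kp_def by blast
  qed
  moreover have "(A \<union> simplicial_cone v L) \<inter> simplicial_cone w A = A"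
  proof
    show "(A \<union> simplicial_cone v L) \<inter> simplicial_cone w A \<subseteq> A"
    proof
      fix \<sigma> assume \<sigma>: "\<sigma> \<in> (A \<union> simplicial_cone v L) \<inter> simplicial_cone w A"
      show "\<sigma> \<in> A"
      proof (cases "\<sigma> \<in> A")
        case False
        then have 1: "\<sigma> - {v} \<in> L" "\<sigma> - {w} \<in> A" using \<sigma> unfolding simplicial_cone_def by blast+
        then have "v \<notin> \<sigma>" using notin(1)[of "\<sigma> - {w}"] vw(1) by blast
        then have "\<sigma> - {v} = \<sigma>" by blast
        then show ?thesis using 1 L(3) by auto
      qed
    qed
    show "A \<subseteq> (A \<union> simplicial_cone v L) \<inter> simplicial_cone w A"
    proof
      fix \<sigma> assume "\<sigma> \<in> A"
      moreover have "\<sigma> - {w} = \<sigma>" using notin(2)[OF \<open>\<sigma> \<in> A\<close>] by blast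
      ultimately show "\<sigma> \<in> (A \<union> simplicial_cone v L) \<inter> simplicial_cone w A" unfolding simplicial_cone_def by simp
    qed
  qed
  ultimately show ?thesis
    using extensor_excision[OF simplicial_complex_Un[OF A cL] cA, of k] extA by simp
qed

text \<open>
  Attaching a cone over a subcomplex.  Cone off all of A from a second, fresh apex w: by edge removal
  for v and w the result is highly connected, because with the edge vw it would become a cone
  with apex w.  Excision then removes the cone over A.  The option type only supplies the fresh apex.
\<close>

lemma cone_attachment:
  fixes A :: "'a set set"
  assumes A: "simplicial_complex A" and L: "simplicial_complex L" "{} \<in> L" "L \<subseteq> A"
    and v: "v \<notin> \<Union>A" and extA: "eta_ge (Suc k) (realize A)" and lk: "eta_ge k (realize L)"
  shows "eta_ge (Suc k) (realize (A \<union> simplicial_cone v L))"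
proof -
  let ?S = "(`) (Some :: 'a \<Rightarrow> 'a option)"
  have "eta_ge (Suc k) (realize (?S ` A \<union> simplicial_cone (Some v) (?S ` L)))"
  proof (rule cone_attachment_fresh[where w = None])
    show "simplicial_complex (?S ` A)" "simplicial_complex (?S ` L)"
      by (rule simplicial_complex_Some[OF A], rule simplicial_complex_Some[OF L(1)])
    show "{} \<in> ?S ` L" "?S ` L \<subseteq> ?S ` A" using L by blast+
    show "Some v \<notin> \<Union>(?S ` A)" using v by blast
    show "eta_ge (Suc k) (realize (?S ` A))" "eta_ge k (realize (?S ` L))"
      unfolding eta_ge_Some by (rule extA, rule lk)
  qed auto
  moreover have "?S ` A \<union> simplicial_cone (Some v) (?S ` L) = ?S ` (A \<union> simplicial_cone v L)"
  proof -
    have "simplicial_cone (Some v) (?S ` L) = ?S ` simplicial_cone v L"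
    proof
      show "?S ` simplicial_cone v L \<subseteq> simplicial_cone (Some v) (?S ` L)"
      proof
        fix \<tau> assume "\<tau> \<in> ?S ` simplicial_cone v L"
        then obtain \<sigma> where \<sigma>: "\<tau> = Some ` \<sigma>" "\<sigma> - {v} \<in> L" unfolding simplicial_cone_def by blast
        have "\<tau> - {Some v} = Some ` (\<sigma> - {v})" unfolding \<sigma>(1) by blast
        then show "\<tau> \<in> simplicial_cone (Some v) (?S ` L)" using \<sigma>(2) unfolding simplicial_cone_def by blast
      qed
      show "simplicial_cone (Some v) (?S ` L) \<subseteq> ?S ` simplicial_cone v L"
      proof
        fix \<tau> assume "\<tau> \<in> simplicial_cone (Some v) (?S ` L)"
        then obtain \<rho> where \<rho>: "\<rho> \<in> L" "\<tau> - {Some v} = Some ` \<rho>" unfolding simplicial_cone_def by blast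
        define \<sigma> where "\<sigma> = {u. Some u \<in> \<tau>}"
        have "None \<notin> \<tau>" using \<rho>(2) by blast
        then have "\<tau> = Some ` \<sigma>" unfolding \<sigma>_def by (auto simp: image_iff) (metis not_None_eq)
        moreover have "\<sigma> - {v} = \<rho>" using \<rho>(2) unfolding \<sigma>_def by blast
        ultimately show "\<tau> \<in> ?S ` simplicial_cone v L" using \<rho>(1) unfolding simplicial_cone_def by blast
      qed
    qed
    then show ?thesis by (simp only: image_Un)
  qed
  ultimately show ?thesis using eta_ge_Some[of "Suc k" "A \<union> simplicial_cone v L"] by simp
qed

section \<open>Connectivity of matching complexes\<close>

text \<open>
  A bipartite multigraph is encoded by its edges and two maps giving the ends of an edge on either
  side.  Vertices are natural numbers so that a fresh vertex always exists; the two sides are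
  never compared, so an edge may have the same number at both ends.
\<close>

definition matchings :: "'e set \<Rightarrow> ('e \<Rightarrow> nat) \<Rightarrow> ('e \<Rightarrow> nat) \<Rightarrow> 'e set set" where
  "matchings E a b = {I. I \<subseteq> E \<and> inj_on a I \<and> inj_on b I}"

definition nu :: "'e set \<Rightarrow> ('e \<Rightarrow> nat) \<Rightarrow> ('e \<Rightarrow> nat) \<Rightarrow> nat" where
  "nu E a b = Max (card ` matchings E a b)"

definition avoid :: "'e set \<Rightarrow> ('e \<Rightarrow> nat) \<Rightarrow> ('e \<Rightarrow> nat) \<Rightarrow> nat set \<Rightarrow> nat set \<Rightarrow> 'e set" where
  "avoid E a b A B = {f \<in> E. a f \<notin> A \<and> b f \<notin> B}"

definition eta_at_least :: "nat \<Rightarrow> 'e set \<Rightarrow> ('e \<Rightarrow> nat) \<Rightarrow> ('e \<Rightarrow> nat) \<Rightarrow> bool" where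
  "eta_at_least k E a b \<longleftrightarrow> eta_ge k (realize (matchings E a b))"

lemma matchings_swap: "matchings E b a = matchings E a b"
  unfolding matchings_def by blast

lemma nu_swap: "nu E b a = nu E a b"
  unfolding nu_def matchings_swap[of E b a] ..

lemma eta_at_least_swap: "eta_at_least k E b a = eta_at_least k E a b"
  unfolding eta_at_least_def matchings_swap[of E b a] ..

lemma avoid_swap: "avoid E b a B A = avoid E a b A B"
  unfolding avoid_def by blast

lemma avoid_subset: "avoid E a b A B \<subseteq> E"
  unfolding avoid_def by blast

lemma matchingsD:
  assumes "I \<in> matchings E a b"
  shows "I \<subseteq> E" "inj_on a I" "inj_on b I"
  using assms unfolding matchings_def by blast+

lemma matchingsI: "I \<subseteq> E \<Longrightarrow> inj_on a I \<Longrightarrow> inj_on b I \<Longrightarrow> I \<in> matchings E a b"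
  unfolding matchings_def by blast

lemma matchings_subset: "I \<in> matchings E a b \<Longrightarrow> J \<subseteq> I \<Longrightarrow> J \<in> matchings E a b"
  unfolding matchings_def by (auto intro: inj_on_subset)

lemma matchings_insert_iff:
  assumes "e \<notin> I"
  shows "insert e I \<in> matchings E a b \<longleftrightarrow> e \<in> E \<and> I \<in> matchings (avoid E a b {a e} {b e}) a b"
  using assms unfolding matchings_def avoid_def by (auto simp: inj_on_def)

lemma simplicial_complex_matchings:
  assumes "finite E" shows "simplicial_complex (matchings E a b)"
  unfolding simplicial_complex_def
proof (intro conjI ballI allI impI)
  have "\<Union>(matchings E a b) \<subseteq> E" unfolding matchings_def by blast
  then show "finite (\<Union>(matchings E a b))" using assms by (rule finite_subset)
  fix \<sigma> \<tau> assume "\<sigma> \<in> matchings E a b" "\<tau> \<subseteq> \<sigma>"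
  then show "\<tau> \<in> matchings E a b" by (rule matchings_subset)
qed

lemma empty_matching: "{} \<in> matchings E a b"
  unfolding matchings_def by simp

lemma finite_matchings: "finite E \<Longrightarrow> finite (matchings E a b)"
  unfolding matchings_def by simp

lemma matchings_mono: "E \<subseteq> F \<Longrightarrow> matchings E a b \<subseteq> matchings F a b"
  unfolding matchings_def by blast

lemma card_le_nu: "finite E \<Longrightarrow> I \<in> matchings E a b \<Longrightarrow> card I \<le> nu E a b"
  unfolding nu_def using finite_matchings[of E a b] by (intro Max_ge) auto

lemma nu_attained:
  assumes "finite E"
  obtains I where "I \<in> matchings E a b" "card I = nu E a b"
proof -
  have "nu E a b \<in> card ` matchings E a b"
    unfolding nu_def using finite_matchings[OF assms, of a b] empty_matching[of E a b]
    by (intro Max_in) auto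
  then show thesis by (rule imageE) (rule that, simp_all)
qed

lemma nu_le:
  assumes "finite E" "\<And>I. I \<in> matchings E a b \<Longrightarrow> card I \<le> n"
  shows "nu E a b \<le> n"
proof -
  obtain I where "I \<in> matchings E a b" "card I = nu E a b" using nu_attained[OF assms(1)] .
  then show ?thesis using assms(2)[of I] by simp
qed

lemma nu_mono:
  assumes "finite F" "E \<subseteq> F" shows "nu E a b \<le> nu F a b"
proof (rule nu_le)
  show "finite E" using assms(2,1) by (rule finite_subset)
  show "card I \<le> nu F a b" if "I \<in> matchings E a b" for I
    using matchings_mono[OF assms(2), of a b] that by (intro card_le_nu[OF assms(1)]) blast
qed

lemma nu_avoid_ge:
  assumes E: "finite E" and I: "I \<in> matchings E a b"
    and touched: "card {f \<in> I. a f \<in> A \<or> b f \<in> B} \<le> t"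
  shows "card I \<le> nu (avoid E a b A B) a b + t"
proof -
  have fin: "finite I" using finite_subset[OF matchingsD(1)[OF I] E] .
  let ?J = "{f \<in> I. \<not> (a f \<in> A \<or> b f \<in> B)}"
  have "?J \<in> matchings (avoid E a b A B) a b"
    using matchingsD[OF I] unfolding matchings_def avoid_def by (auto intro: inj_on_subset)
  moreover have "finite (avoid E a b A B)" using E avoid_subset by (rule finite_subset[rotated])
  ultimately have "card ?J \<le> nu (avoid E a b A B) a b" by (rule card_le_nu[rotated])
  moreover have "card I = card {f \<in> I. a f \<in> A \<or> b f \<in> B} + card ?J"
    using fin by (subst card_Un_disjoint[symmetric]) (auto intro: arg_cong[where f = card])
  ultimately show ?thesis using touched by linarith
qed

lemma card_touching_le:
  assumes "inj_on a I" "inj_on b I" "finite A" "finite B" "finite I"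
  shows "card {f \<in> I. a f \<in> A \<or> b f \<in> B} \<le> card A + card B"
proof -
  have "card {f \<in> I. a f \<in> A} \<le> card A"
    using assms by (intro card_inj_on_le[of a]) (auto intro: inj_on_subset)
  moreover have "card {f \<in> I. b f \<in> B} \<le> card B"
    using assms by (intro card_inj_on_le[of b]) (auto intro: inj_on_subset)
  moreover have "{f \<in> I. a f \<in> A \<or> b f \<in> B} = {f \<in> I. a f \<in> A} \<union> {f \<in> I. b f \<in> B}" by blast
  ultimately show ?thesis by (metis (no_types, lifting) add_mono card_Un_le order_trans)
qed

lemma nu_delete_vertices:
  assumes "finite E" "finite A" "finite B"
  shows "nu E a b \<le> nu (avoid E a b A B) a b + (card A + card B)"
proof -
  obtain I where I: "I \<in> matchings E a b" "card I = nu E a b" using nu_attained[OF assms(1)] .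
  have "finite I" using finite_subset[OF matchingsD(1)[OF I(1)] assms(1)] .
  then show ?thesis
    using nu_avoid_ge[OF assms(1) I(1) card_touching_le[OF matchingsD(2,3)[OF I(1)] assms(2,3)]] I(2) by simp
qed

text \<open>
  The matchings containing e form a cone with apex e over the matchings avoiding both ends of e.
\<close>

lemma eta_delete_edge:
  assumes E: "finite E" and e: "e \<in> E"
    and del: "eta_at_least (Suc k) (E - {e}) a b"
    and lk: "eta_at_least k (avoid E a b {a e} {b e}) a b"
  shows "eta_at_least (Suc k) E a b"
proof -
  let ?A = "matchings (E - {e}) a b" and ?L = "matchings (avoid E a b {a e} {b e}) a b"
  have sub: "avoid E a b {a e} {b e} \<subseteq> E - {e}" unfolding avoid_def by auto
  have "matchings E a b = ?A \<union> simplicial_cone e ?L"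
  proof (intro Set.set_eqI iffI)
    fix I assume I: "I \<in> matchings E a b"
    show "I \<in> ?A \<union> simplicial_cone e ?L"
    proof (cases "e \<in> I")
      case True
      then have "insert e (I - {e}) \<in> matchings E a b" using I by (simp add: insert_absorb)
      then show ?thesis unfolding simplicial_cone_def by (subst (asm) matchings_insert_iff) auto
    next
      case False
      then show ?thesis using I unfolding matchings_def by blast
    qed
  next
    fix I assume "I \<in> ?A \<union> simplicial_cone e ?L"
    then consider "I \<in> ?A" | "e \<notin> I" "I \<in> ?L" | "e \<in> I" "I - {e} \<in> ?L"
      unfolding simplicial_cone_def by (cases "e \<in> I") auto
    then show "I \<in> matchings E a b"
    proof cases
      case 1
      then show ?thesis using matchings_mono[of "E - {e}" E] by blast
    next
      case 2
      then show ?thesis using matchings_mono[OF avoid_subset] by blast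
    next
      case 3
      then have "insert e (I - {e}) \<in> matchings E a b"
        using e by (subst matchings_insert_iff) auto
      then show ?thesis using 3 by (simp add: insert_absorb)
    qed
  qed
  moreover have "eta_ge (Suc k) (realize (?A \<union> simplicial_cone e ?L))"
  proof (rule cone_attachment)
    show "simplicial_complex ?A" using E by (intro simplicial_complex_matchings) simp
    show "simplicial_complex ?L" using finite_subset[OF avoid_subset E] by (rule simplicial_complex_matchings)
    show "?L \<subseteq> ?A" using sub by (rule matchings_mono)
    show "e \<notin> \<Union>?A" unfolding matchings_def by blast
  qed (use del lk empty_matching in \<open>unfold eta_at_least_def, blast+\<close>)
  ultimately show ?thesis unfolding eta_at_least_def by simp
qed

text \<open>
  The complex is a cone: e can be added to every matching.
\<close>

lemma eta_isolated_edge: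
  assumes E: "finite E" and e: "e \<in> E" and iso: "\<And>f. f \<in> E \<Longrightarrow> f \<noteq> e \<Longrightarrow> a f \<noteq> a e \<and> b f \<noteq> b e"
  shows "eta_at_least k E a b"
proof (cases k)
  case (Suc d)
  have "extensor d (realize (matchings E a b))"
  proof (rule extensor_cone[OF simplicial_complex_matchings[OF E]])
    show "{e} \<in> matchings E a b" using e unfolding matchings_def by simp
    fix I assume "I \<in> matchings E a b"
    then show "insert e I \<in> matchings E a b"
      using e iso unfolding matchings_def by (auto simp: inj_on_def; metis subsetD)
  qed
  then show ?thesis unfolding eta_at_least_def Suc by simp
qed (simp add: eta_at_least_def)

text \<open>
  Splitting r into r and r' allows an edge of S and another edge at r to be used
  together.  In the line graph this deletes the adjacencies between the two parts of the star of r.  They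
  are deleted one at a time, and each step is an instance of edge removal, whose link is
  the matching complex of the graph without r and the other ends of the two edges.
\<close>

lemma eta_split_vertex:
  assumes E: "finite E" and S: "S \<subseteq> {e \<in> E. b e = r}" and r': "\<And>e. e \<in> E \<Longrightarrow> b e \<noteq> r'"
    and split: "eta_at_least (Suc k) E a (\<lambda>e. if e \<in> S then r' else b e)"
    and lk: "\<And>e f. e \<in> S \<Longrightarrow> f \<in> E \<Longrightarrow> b f = r \<Longrightarrow> f \<notin> S \<Longrightarrow> a e \<noteq> a f \<Longrightarrow>
      eta_at_least k (avoid E a b {a e, a f} {r}) a b"
  shows "eta_at_least (Suc k) E a b"
proof -
  define b' where "b' e = (if e \<in> S then r' else b e)" for e
  have split: "eta_at_least (Suc k) E a b'" using split unfolding b'_def .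
  define S2 where "S2 = {e \<in> E. b e = r} - S"
  define full where "full = S \<times> S2"
  \<comment> \<open>the intermediate complexes: the pairs in X have been allowed so far\<close>
  define K where "K X = {I. I \<subseteq> E \<and> inj_on a I \<and>
      (\<forall>e\<in>I. \<forall>f\<in>I. e \<noteq> f \<longrightarrow> b e = b f \<longrightarrow> (e, f) \<in> X \<or> (f, e) \<in> X)}" for X
  have KD: "I \<subseteq> E" "inj_on a I" "\<And>x y. x \<in> I \<Longrightarrow> y \<in> I \<Longrightarrow> x \<noteq> y \<Longrightarrow> b x = b y \<Longrightarrow> (x, y) \<in> X \<or> (y, x) \<in> X"
    if "I \<in> K X" for I X
    using that unfolding K_def mem_Collect_eq by simp_all
  have KI: "I \<in> K X" if "I \<subseteq> E" "inj_on a I"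
    "\<And>x y. x \<in> I \<Longrightarrow> y \<in> I \<Longrightarrow> x \<noteq> y \<Longrightarrow> b x = b y \<Longrightarrow> (x, y) \<in> X \<or> (y, x) \<in> X" for I X
    unfolding K_def mem_Collect_eq using that by (intro conjI ballI impI)
  have SE: "S \<subseteq> E" "\<And>e. e \<in> S \<Longrightarrow> b e = r" and S2E: "S2 \<subseteq> E" "\<And>e. e \<in> S2 \<Longrightarrow> b e = r"
    "\<And>e. e \<in> S2 \<Longrightarrow> e \<notin> S"
    using S unfolding S2_def by auto
  have finfull: "finite full"
    unfolding full_def using finite_subset[OF SE(1) E] finite_subset[OF S2E(1) E] by simp
  have scK: "simplicial_complex (K X)" for X
    unfolding simplicial_complex_def
  proof (intro conjI ballI allI impI)
    have "\<Union>(K X) \<subseteq> E" unfolding K_def by blast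
    then show "finite (\<Union>(K X))" using E by (rule finite_subset)
    fix \<sigma> \<tau> assume "\<sigma> \<in> K X" "\<tau> \<subseteq> \<sigma>"
    then show "\<tau> \<in> K X"
      using KD[of \<sigma> X] by (intro KI) (blast intro: inj_on_subset)+
  qed
  have "eta_ge (Suc k) (realize (K X))" if "X \<subseteq> full" for X
    using that
  proof (induction "card (full - X)" arbitrary: X)
    case 0
    have "finite (full - X)" using finfull by simp
    then have "full - X = {}" using 0(1) by (metis card_0_eq)
    then have Xf: "X = full" using 0(2) by blast
    have Kf: "K full = matchings E a b'"
    proof -
      have key: "b' e = b' f \<longleftrightarrow> b e = b f \<and> (e, f) \<notin> full \<and> (f, e) \<notin> full" if "e \<in> E" "f \<in> E" for e f
        using r'[OF that(1)] r'[OF that(2)] SE(2)[of e] SE(2)[of f] that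
        unfolding b'_def full_def S2_def by (cases "e \<in> S"; cases "f \<in> S") auto
      have "inj_on b' I \<longleftrightarrow> (\<forall>e\<in>I. \<forall>f\<in>I. e \<noteq> f \<longrightarrow> b e = b f \<longrightarrow> (e, f) \<in> full \<or> (f, e) \<in> full)"
        if "I \<subseteq> E" for I
      proof -
        have "inj_on b' I \<longleftrightarrow> (\<forall>e\<in>I. \<forall>f\<in>I. b' e = b' f \<longrightarrow> e = f)" unfolding inj_on_def ..
        also have "\<dots> \<longleftrightarrow> (\<forall>e\<in>I. \<forall>f\<in>I. b e = b f \<and> (e, f) \<notin> full \<and> (f, e) \<notin> full \<longrightarrow> e = f)"
          using key that by (meson subsetD)
        finally show ?thesis by blast
      qed
      then have "I \<in> K full \<longleftrightarrow> I \<in> matchings E a b'" for I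
        unfolding K_def matchings_def mem_Collect_eq by metis
      then show ?thesis by (rule Set.set_eqI)
    qed
    show ?case unfolding Xf Kf using split unfolding eta_at_least_def .
  next
    case (Suc n)
    have "full - X \<noteq> {}"
    proof
      assume "full - X = {}"
      then show False using Suc.hyps(2) by (simp only: card.empty nat.distinct)
    qed
    then obtain p where "p \<in> full - X" by blast
    then obtain e f where ef: "(e, f) \<in> full" "(e, f) \<notin> X" by (cases p) blast
    have eS: "e \<in> S" and fS2: "f \<in> S2" using ef(1) unfolding full_def by simp_all
    have e: "e \<in> S" "e \<in> E" "b e = r" by (fact eS, use eS SE(1) in blast, rule SE(2)[OF eS])
    have f: "f \<in> S2" "f \<in> E" "b f = r" "f \<notin> S"
      by (fact fS2, use fS2 S2E(1) in blast, rule S2E(2)[OF fS2], rule S2E(3)[OF fS2])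
    have "e \<noteq> f" using e(1) f(4) by blast
    have "full - insert (e, f) X = (full - X) - {(e, f)}" by blast
    then have "card (full - insert (e, f) X) = n"
      using Suc.hyps(2) ef finfull by simp
    then have IH: "eta_ge (Suc k) (realize (K (insert (e, f) X)))"
      using Suc.hyps(1)[of "insert (e, f) X"] Suc.prems ef(1) by blast
    show ?case
    proof (cases "a e = a f")
      case True
      have "K (insert (e, f) X) = K X"
      proof
        show "K (insert (e, f) X) \<subseteq> K X"
        proof
          fix I assume I: "I \<in> K (insert (e, f) X)"
          then have "\<not> (e \<in> I \<and> f \<in> I)"
            using True \<open>e \<noteq> f\<close> KD(2)[OF I] unfolding inj_on_def by blast
          then show "I \<in> K X" using KD[OF I] by (intro KI) blast+
        qed
        show "K X \<subseteq> K (insert (e, f) X)"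
        proof
          fix I assume I: "I \<in> K X"
          show "I \<in> K (insert (e, f) X)" using KD[OF I] by (intro KI) blast+
        qed
      qed
      then show ?thesis using IH by (simp only:)
    next
      case False
      define L where "L = matchings (avoid E a b {a e, a f} {r}) a b"
      have LE: "\<tau> \<subseteq> E" "inj_on a \<tau>" "inj_on b \<tau>" "\<And>x. x \<in> \<tau> \<Longrightarrow> a x \<noteq> a e \<and> a x \<noteq> a f \<and> b x \<noteq> r"
        if "\<tau> \<in> L" for \<tau>
      proof -
        note m = matchingsD[OF that[unfolded L_def]]
        show "\<tau> \<subseteq> E" using m(1) avoid_subset by (rule subset_trans)
        show "inj_on a \<tau>" "inj_on b \<tau>" by (fact m(2), fact m(3))
        fix x assume "x \<in> \<tau>"
        then have "x \<in> avoid E a b {a e, a f} {r}" using m(1) by (rule subsetD[rotated])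
        then show "a x \<noteq> a e \<and> a x \<noteq> a f \<and> b x \<noteq> r" unfolding avoid_def by simp
      qed
      have scL: "simplicial_complex L"
        unfolding L_def using finite_subset[OF avoid_subset E] by (rule simplicial_complex_matchings)
      have X: "\<And>x y. (x, y) \<in> X \<Longrightarrow> x \<in> S \<and> y \<in> S2" using Suc.prems unfolding full_def by auto
      have decomp: "\<sigma> \<in> K (insert (e, f) X)" if "\<sigma> - {e, f} \<in> L" for \<sigma>
      proof -
        define \<tau> where "\<tau> = \<sigma> - {e, f}"
        note \<tau> = LE[OF that[folded \<tau>_def]]
        have sub: "\<sigma> \<subseteq> insert e (insert f \<tau>)" unfolding \<tau>_def by blast
        have "inj_on a (insert e (insert f \<tau>))"
          using \<tau>(2,4) False by (auto simp: inj_on_def; metis)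
        then have 1: "inj_on a \<sigma>" using sub by (rule inj_on_subset)
        have 2: "(x, y) \<in> insert (e, f) X \<or> (y, x) \<in> insert (e, f) X"
          if xy: "x \<in> \<sigma>" "y \<in> \<sigma>" "x \<noteq> y" "b x = b y" for x y
        proof -
          have r: "b z \<noteq> r" if "z \<in> \<sigma>" "z \<noteq> e" "z \<noteq> f" for z
            using \<tau>(4)[of z] that unfolding \<tau>_def by simp
          have "b x = r"
          proof (rule ccontr)
            assume "b x \<noteq> r"
            then have "x \<in> \<tau>" "y \<in> \<tau>" using xy e(3) f(3) unfolding \<tau>_def by auto
            then show False using inj_onD[OF \<tau>(3) xy(4)] xy(3) by blast
          qed
          then have "x \<in> {e, f}" "y \<in> {e, f}" using r[of x] r[of y] xy by auto
          then show ?thesis using xy(3) by blast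
        qed
        show ?thesis using 1 2 sub \<tau>(1) e(2) f(2) by (intro KI) blast+
      qed
      show ?thesis
      proof (rule edge_removal[OF scK scL])
        show "{} \<in> L" unfolding L_def by (rule empty_matching)
        show "e \<noteq> f" by fact
        show "e \<notin> \<Union>L" "f \<notin> \<Union>L" using LE(4) e(3) f(3) by blast+
        show "suspension e f L \<subseteq> K X"
        proof
          fix \<sigma> assume \<sigma>: "\<sigma> \<in> suspension e f L"
          then have "\<sigma> \<in> K (insert (e, f) X)" using decomp unfolding suspension_def by blast
          note \<sigma>' = KD[OF this]
          have "\<not> {e, f} \<subseteq> \<sigma>" using \<sigma> unfolding suspension_def by blast
          show "\<sigma> \<in> K X"
          proof (rule KI[OF \<sigma>'(1,2)])
            fix x y assume xy: "x \<in> \<sigma>" "y \<in> \<sigma>" "x \<noteq> y" "b x = b y"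
            show "(x, y) \<in> X \<or> (y, x) \<in> X"
              using \<sigma>'(3)[OF xy] \<open>\<not> {e, f} \<subseteq> \<sigma>\<close> xy(1,2) by auto
          qed
        qed
        show "{e, f} \<notin> K X"
        proof
          assume "{e, f} \<in> K X"
          from KD(3)[OF this, of e f] have "(e, f) \<in> X \<or> (f, e) \<in> X"
            using e(3) f(3) \<open>e \<noteq> f\<close> by simp
          then show False using ef(2) X[of f e] f(4) by blast
        qed
        show "eta_ge k (realize L)"
          using lk[OF e(1) f(2,3,4) False] unfolding eta_at_least_def L_def .
        have "K X \<union> edge_join e f L = K (insert (e, f) X)"
        proof
          show "K X \<union> edge_join e f L \<subseteq> K (insert (e, f) X)"
          proof
            fix \<sigma> assume "\<sigma> \<in> K X \<union> edge_join e f L"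
            then consider (K) "\<sigma> \<in> K X" | (L) "\<sigma> - {e, f} \<in> L" unfolding edge_join_def by blast
            then show "\<sigma> \<in> K (insert (e, f) X)"
            proof cases
              case K
              show ?thesis using KD[OF K] by (intro KI) blast+
            qed (rule decomp)
          qed
          show "K (insert (e, f) X) \<subseteq> K X \<union> edge_join e f L"
          proof
            fix \<sigma> assume \<sigma>: "\<sigma> \<in> K (insert (e, f) X)"
            show "\<sigma> \<in> K X \<union> edge_join e f L"
            proof (cases "{e, f} \<subseteq> \<sigma>")
              case False
              have "\<sigma> \<in> K X"
              proof (rule KI[OF KD(1,2)[OF \<sigma>]])
                fix x y assume xy: "x \<in> \<sigma>" "y \<in> \<sigma>" "x \<noteq> y" "b x = b y"
                show "(x, y) \<in> X \<or> (y, x) \<in> X" using KD(3)[OF \<sigma> xy] False xy(1,2) by auto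
              qed
              then show ?thesis by blast
            next
              case True
              note inj = KD(2)[OF \<sigma>] and sE = KD(1)[OF \<sigma>] and pr = KD(3)[OF \<sigma>]
              have memb: "x \<in> S \<and> y \<in> S2 \<or> y \<in> S \<and> x \<in> S2" if "x \<in> \<sigma>" "y \<in> \<sigma>" "x \<noteq> y" "b x = b y" for x y
                using pr[OF that] X e(1) f(1) by blast
              have br: "b x \<noteq> r" if x: "x \<in> \<sigma> - {e, f}" for x
              proof
                assume bx: "b x = r"
                have "x \<in> S2" using memb[of x e] x True bx e S2E(3) by auto
                moreover have "x \<in> S" using memb[of x f] x True bx f by auto
                ultimately show False using S2E(3) by blast
              qed
              have ax: "a x \<noteq> a e \<and> a x \<noteq> a f" if "x \<in> \<sigma> - {e, f}" for x
                using inj that True unfolding inj_on_def by blast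
              have "inj_on b (\<sigma> - {e, f})"
              proof (rule inj_onI, rule ccontr)
                fix x y assume xy: "x \<in> \<sigma> - {e, f}" "y \<in> \<sigma> - {e, f}" "b x = b y" "x \<noteq> y"
                then have "x \<in> S \<or> x \<in> S2" using memb[of x y] by blast
                then show False using br[OF xy(1)] SE(2) S2E(2) by blast
              qed
              then have "\<sigma> - {e, f} \<in> L"
                unfolding L_def matchings_def avoid_def using br ax sE inj_on_subset[OF inj, of "\<sigma> - {e, f}"] by auto
              then show ?thesis unfolding edge_join_def by blast
            qed
          qed
        qed
        then show "eta_ge (Suc k) (realize (K X \<union> edge_join e f L))" using IH by simp
      qed
    qed
  qed
  from this[of "{}"] have "eta_ge (Suc k) (realize (K {}))" by simp
  moreover have "I \<in> K {} \<longleftrightarrow> I \<in> matchings E a b" for I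
  proof
    assume I: "I \<in> K {}"
    show "I \<in> matchings E a b"
      by (rule matchingsI[OF KD(1,2)[OF I] inj_onI]) (use KD(3)[OF I] in blast)
  next
    assume I: "I \<in> matchings E a b"
    show "I \<in> K {}"
      by (rule KI[OF matchingsD(1,2)[OF I]]) (use inj_onD[OF matchingsD(3)[OF I]] in blast)
  qed
  then have "K {} = matchings E a b" by (rule Set.set_eqI)
  ultimately show ?thesis unfolding eta_at_least_def by simp
qed

text \<open>
  The general lower bound half of nu.  Edges outside of a fixed maximum matching are deleted one by one; removing
  the ends of an edge costs at most two in nu, so the link condition holds by induction.  What finally remains
  is a matching, whose complex is a simplex.
\<close>

theorem eta_ge_half_nu:
  assumes "finite E" "2 * k \<le> nu E a b + 1"
  shows "eta_at_least k E a b"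
  using assms
proof (induction "card E" arbitrary: E k rule: less_induct)
  case less
  note E = less.prems(1)
  show ?case
  proof (cases k)
    case (Suc j)
    obtain I where I: "I \<in> matchings E a b" "card I = nu E a b" using nu_attained[OF E] .
    have "card I \<noteq> 0" using less.prems(2) I(2) Suc by simp
    then have "I \<noteq> {}" by auto
    show ?thesis
    proof (cases "I = E")
      case True
      obtain e where e: "e \<in> E" using \<open>I \<noteq> {}\<close> True by blast
      have "a f \<noteq> a e \<and> b f \<noteq> b e" if "f \<in> E" "f \<noteq> e" for f
        using matchingsD(2,3)[OF I(1)] that e unfolding True inj_on_def by blast
      then show ?thesis by (rule eta_isolated_edge[OF E e])
    next
      case False
      then obtain e where e: "e \<in> E" "e \<notin> I" using matchingsD(1)[OF I(1)] by blast
      have lt: "card (E - {e}) < card E" using e(1) E by (rule card_Diff1_less[rotated])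
      have "I \<in> matchings (E - {e}) a b" using I(1) e(2) unfolding matchings_def by blast
      then have "nu E a b \<le> nu (E - {e}) a b" using card_le_nu[of "E - {e}" I] E I(2) by simp
      then have 1: "eta_at_least (Suc j) (E - {e}) a b"
        using less.hyps[OF lt] E less.prems(2) Suc by simp
      have finA: "finite (avoid E a b {a e} {b e})" using finite_subset[OF avoid_subset E] .
      have "avoid E a b {a e} {b e} \<subset> E" using e(1) unfolding avoid_def by auto
      then have "card (avoid E a b {a e} {b e}) < card E" by (rule psubset_card_mono[OF E])
      moreover have "nu E a b \<le> nu (avoid E a b {a e} {b e}) a b + 2"
        using nu_delete_vertices[OF E, of "{a e}" "{b e}" a b] by simp
      ultimately have 2: "eta_at_least j (avoid E a b {a e} {b e}) a b"
        using less.prems(2) Suc by (intro less.hyps finA) simp_all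
      show ?thesis unfolding Suc by (rule eta_delete_edge[OF E e(1) 1 2])
    qed
  qed (simp add: eta_at_least_def)
qed

section \<open>Hall's theorem and vertex covers\<close>

text \<open>
  Rado's argument: as long as some neighbourhood has two elements, one of them can be deleted without
  violating Hall's condition.
\<close>

theorem hall_transversal:
  fixes N :: "'x \<Rightarrow> 'y set"
  assumes "finite A" "\<And>x. x \<in> A \<Longrightarrow> finite (N x)"
    "\<And>X. X \<subseteq> A \<Longrightarrow> card X \<le> card (\<Union>(N ` X))"
  shows "\<exists>f. inj_on f A \<and> (\<forall>x\<in>A. f x \<in> N x)"
  using assms(2,3)
proof (induction "\<Sum>x\<in>A. card (N x)" arbitrary: N rule: less_induct)
  case less
  note finN = less.prems(1) and hall = less.prems(2)
  show ?case
  proof (cases "\<exists>x\<in>A. \<exists>y z. y \<in> N x \<and> z \<in> N x \<and> y \<noteq> z")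
    case False
    have "N x \<noteq> {}" if "x \<in> A" for x using hall[of "{x}"] that by auto
    define f where "f x = (SOME y. y \<in> N x)" for x
    have f: "f x \<in> N x" if "x \<in> A" for x
      unfolding f_def using \<open>\<And>x. x \<in> A \<Longrightarrow> N x \<noteq> {}\<close>[OF that] by (simp add: some_in_eq)
    have Nf: "N x = {f x}" if "x \<in> A" for x
    proof -
      have "y = f x" if "y \<in> N x" for y using False \<open>x \<in> A\<close> f[OF \<open>x \<in> A\<close>] that by metis
      then show ?thesis using f[OF that] by blast
    qed
    have "inj_on f A"
    proof (rule inj_onI, rule ccontr)
      fix x y assume xy: "x \<in> A" "y \<in> A" "f x = f y" "x \<noteq> y"
      have "card {x, y} \<le> card (\<Union>(N ` {x, y}))" using xy by (intro hall) simp
      moreover have "\<Union>(N ` {x, y}) = {f x}" using Nf xy by simp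
      ultimately show False using xy(4) by simp
    qed
    then show ?thesis using f by blast
  next
    case True
    then obtain x y1 y2 where x: "x \<in> A" "y1 \<in> N x" "y2 \<in> N x" "y1 \<noteq> y2" by blast
    define M where "M y = N(x := N x - {y})" for y
    have Mx: "M y x = N x - {y}" and Mo: "z \<noteq> x \<Longrightarrow> M y z = N z" for y z unfolding M_def by auto
    have finM: "finite (M y z)" if "z \<in> A" for y z using finN[OF that] finN[OF x(1)] unfolding M_def by simp
    have smaller: "(\<Sum>z\<in>A. card (M y z)) < (\<Sum>z\<in>A. card (N z))" if "y \<in> N x" for y
    proof (rule sum_strict_mono_ex1[OF assms(1)])
      show "\<forall>z\<in>A. card (M y z) \<le> card (N z)" using finN unfolding M_def by (simp add: card_mono)
      show "\<exists>z\<in>A. card (M y z) < card (N z)"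
      proof
        show "card (M y x) < card (N x)"
          unfolding Mx by (rule card_Diff1_less[OF finN[OF x(1)] that])
      qed (fact x(1))
    qed
    have sub: "M y z \<subseteq> N z" for y z unfolding M_def by auto
    show ?thesis
    proof (cases "\<exists>y\<in>N x. \<forall>X\<subseteq>A. card X \<le> card (\<Union>(M y ` X))")
      case True
      then obtain y where y: "y \<in> N x" "\<And>X. X \<subseteq> A \<Longrightarrow> card X \<le> card (\<Union>(M y ` X))" by blast
      obtain f where "inj_on f A" "\<forall>z\<in>A. f z \<in> M y z"
        using less.hyps[OF smaller[OF y(1)] finM y(2)] by blast
      then show ?thesis using sub by blast
    next
      case False
      obtain X1 where X1: "X1 \<subseteq> A" "card (\<Union>(M y1 ` X1)) < card X1"
        using False x(2) by (meson not_le)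
      obtain X2 where X2: "X2 \<subseteq> A" "card (\<Union>(M y2 ` X2)) < card X2"
        using False x(3) by (meson not_le)
      have xin: "x \<in> X" if "X \<subseteq> A" "card (\<Union>(M y ` X)) < card X" for X y
      proof (rule ccontr)
        assume "x \<notin> X"
        then have "M y ` X = N ` X" using Mo by (metis (no_types, lifting) image_cong)
        then show False using hall[OF that(1)] that(2) by simp
      qed
      have fX: "finite X1" "finite X2" by (rule finite_subset[OF X1(1) assms(1)], rule finite_subset[OF X2(1) assms(1)])
      define U1 where "U1 = \<Union>(M y1 ` X1)"
      define U2 where "U2 = \<Union>(M y2 ` X2)"
      have finU: "finite U1" "finite U2"
      proof -
        have "finite (M y z)" if "z \<in> X1 \<union> X2" for y z using finM X1(1) X2(1) that by blast
        then show "finite U1" "finite U2" unfolding U1_def U2_def using fX by simp_all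
      qed
      have "\<Union>(N ` (X1 \<union> X2)) \<subseteq> U1 \<union> U2"
      proof
        fix w assume "w \<in> \<Union>(N ` (X1 \<union> X2))"
        then obtain z where z: "z \<in> X1 \<union> X2" "w \<in> N z" by blast
        show "w \<in> U1 \<union> U2"
        proof (cases "z = x")
          case True
          then have "w \<in> M y1 x \<or> w \<in> M y2 x" using z(2) x(4) Mx by auto
          then show ?thesis using xin[OF X1] xin[OF X2] unfolding U1_def U2_def by blast
        next
          case False
          then show ?thesis using z Mo[OF False] unfolding U1_def U2_def by auto
        qed
      qed
      then have "card (\<Union>(N ` (X1 \<union> X2))) \<le> card (U1 \<union> U2)" using finU by (intro card_mono) simp_all
      moreover have "card (X1 \<union> X2) \<le> card (\<Union>(N ` (X1 \<union> X2)))"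
        using X1(1) X2(1) by (intro hall) simp
      moreover have "card (X1 \<inter> X2 - {x}) \<le> card (\<Union>(N ` (X1 \<inter> X2 - {x})))"
        using X1(1) by (intro hall) blast
      moreover have "\<Union>(N ` (X1 \<inter> X2 - {x})) \<subseteq> U1 \<inter> U2"
        unfolding U1_def U2_def using Mo by auto
      then have "card (\<Union>(N ` (X1 \<inter> X2 - {x}))) \<le> card (U1 \<inter> U2)" using finU by (intro card_mono) simp_all
      moreover have "card (X1 \<inter> X2 - {x}) = card (X1 \<inter> X2) - 1"
        using xin[OF X1] xin[OF X2] by simp
      moreover have "card (U1 \<union> U2) + card (U1 \<inter> U2) = card U1 + card U2"
        using finU card_Un_Int by metis
      moreover have "card (X1 \<union> X2) + card (X1 \<inter> X2) = card X1 + card X2"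
        using fX card_Un_Int by metis
      ultimately show ?thesis using X1(2) X2(2) unfolding U1_def[symmetric] U2_def[symmetric] by linarith
    qed
  qed
qed

definition nbrs :: "'e set \<Rightarrow> ('e \<Rightarrow> nat) \<Rightarrow> ('e \<Rightarrow> nat) \<Rightarrow> nat set \<Rightarrow> nat set" where
  "nbrs E a b X = b ` {e \<in> E. a e \<in> X}"

lemma mem_nbrs: "r \<in> nbrs E a b X \<longleftrightarrow> (\<exists>e\<in>E. a e \<in> X \<and> b e = r)"
  unfolding nbrs_def by blast

lemma finite_nbrs: "finite E \<Longrightarrow> finite (nbrs E a b X)"
  unfolding nbrs_def by simp

lemma hall_matching:
  assumes E: "finite E" and P: "finite P" and hall: "\<And>X. X \<subseteq> P \<Longrightarrow> card X \<le> card (nbrs E a b X)"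
  obtains I where "I \<in> matchings E a b" "a ` I = P" "card I = card P"
proof -
  have "\<Union>((\<lambda>p. nbrs E a b {p}) ` X) = nbrs E a b X" for X unfolding nbrs_def by blast
  then obtain f where f: "inj_on f P" "\<forall>p\<in>P. f p \<in> nbrs E a b {p}"
    using hall_transversal[of P "\<lambda>p. nbrs E a b {p}"] P hall finite_nbrs[OF E] by auto
  then have "\<forall>p\<in>P. \<exists>e. e \<in> E \<and> a e = p \<and> b e = f p" unfolding mem_nbrs by blast
  then obtain g where g: "\<And>p. p \<in> P \<Longrightarrow> g p \<in> E \<and> a (g p) = p \<and> b (g p) = f p" by metis
  have "inj_on g P" using g by (metis inj_onI)
  show thesis
  proof (rule that)
    show "g ` P \<in> matchings E a b"
    proof (rule matchingsI)
      show "g ` P \<subseteq> E" using g by blast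
      show "inj_on a (g ` P)" using g by (auto simp: inj_on_def)
      show "inj_on b (g ` P)" using g f(1) by (auto simp: inj_on_def)
    qed
    show "a ` g ` P = P" using g by force
    show "card (g ` P) = card P" using \<open>inj_on g P\<close> by (rule card_image)
  qed
qed

definition covers :: "'e set \<Rightarrow> ('e \<Rightarrow> nat) \<Rightarrow> ('e \<Rightarrow> nat) \<Rightarrow> nat set \<Rightarrow> nat set \<Rightarrow> bool" where
  "covers E a b A B \<longleftrightarrow> (\<forall>e\<in>E. a e \<in> A \<or> b e \<in> B)"

text \<open>
  The easy half of Koenig's theorem with its equality case: if a matching is as large as a cover, each of
  its edges meets the cover exactly once and every vertex of the cover is used.
\<close>

lemma matching_meets_cover:
  assumes E: "finite E" and I: "I \<in> matchings E a b" and C: "covers E a b A B" and fin: "finite A" "finite B"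
  shows "card I \<le> card A + card B"
    and "card A + card B \<le> card I \<Longrightarrow> c \<in> A \<Longrightarrow> \<exists>e\<in>I. a e = c \<and> b e \<notin> B"
    and "card A + card B \<le> card I \<Longrightarrow> d \<in> B \<Longrightarrow> \<exists>e\<in>I. b e = d \<and> a e \<notin> A"
proof -
  define IA where "IA = {e \<in> I. a e \<in> A}"
  define IB where "IB = {e \<in> I. b e \<in> B}"
  note m = matchingsD[OF I]
  have finI: "finite I" using m(1) E by (rule finite_subset)
  then have finAB: "finite IA" "finite IB" unfolding IA_def IB_def by simp_all
  have "I = IA \<union> IB" using C m(1) unfolding covers_def IA_def IB_def by blast
  then have sum: "card I + card (IA \<inter> IB) = card IA + card IB" using card_Un_Int[OF finAB] by simp
  have injA: "inj_on a IA" and injB: "inj_on b IB"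
    using m(2,3) unfolding IA_def IB_def by (auto intro: inj_on_subset)
  have subA: "a ` IA \<subseteq> A" and subB: "b ` IB \<subseteq> B" unfolding IA_def IB_def by blast+
  have leA: "card IA \<le> card A" and leB: "card IB \<le> card B"
    using card_inj_on_le[OF injA subA fin(1)] card_inj_on_le[OF injB subB fin(2)] by blast+
  show "card I \<le> card A + card B" using sum leA leB by linarith
  assume tight: "card A + card B \<le> card I"
  then have eq: "card IA = card A" "card IB = card B" "card (IA \<inter> IB) = 0" using sum leA leB by linarith+
  have dis: "IA \<inter> IB = {}" using eq(3) finAB by simp
  have imA: "a ` IA = A" using card_subset_eq[OF fin(1) subA] card_image[OF injA] eq(1) by simp
  have imB: "b ` IB = B" using card_subset_eq[OF fin(2) subB] card_image[OF injB] eq(2) by simp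
  show "\<exists>e\<in>I. a e = c \<and> b e \<notin> B" if "c \<in> A"
  proof -
    have "c \<in> a ` IA" unfolding imA by (rule that)
    then obtain e where "c = a e" "e \<in> IA" by (rule imageE)
    then show ?thesis using dis unfolding IA_def IB_def by blast
  qed
  show "\<exists>e\<in>I. b e = d \<and> a e \<notin> A" if "d \<in> B"
  proof -
    have "d \<in> b ` IB" unfolding imB by (rule that)
    then obtain e where "d = b e" "e \<in> IB" by (rule imageE)
    then show ?thesis using dis unfolding IA_def IB_def by blast
  qed
qed

section \<open>Decompositions into four-cycles and paths\<close>

text \<open>
  D is the set of middle edges of the paths and Q the set of vertex sets of the cycles, split into the
  two sides.  The outer edges of the paths are not recorded: a matching of the right size supplies them,
  disjointly from everything else.
\<close>

definition disjoint_pieces :: "'e set \<Rightarrow> ('e \<Rightarrow> nat) \<Rightarrow> ('e \<Rightarrow> nat) \<Rightarrow> 'e set \<Rightarrow> (nat set \<times> nat set) set \<Rightarrow> bool" where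
  "disjoint_pieces E a b D Q \<longleftrightarrow>
     D \<in> matchings E a b \<and> finite Q \<and>
     (\<forall>q\<in>Q. card (fst q) = 2 \<and> card (snd q) = 2 \<and>
        (\<forall>p\<in>fst q. \<forall>r\<in>snd q. \<exists>e\<in>E. a e = p \<and> b e = r) \<and>
        fst q \<inter> a ` D = {} \<and> snd q \<inter> b ` D = {}) \<and>
     (\<forall>q\<in>Q. \<forall>q'\<in>Q. q \<noteq> q' \<longrightarrow> fst q \<inter> fst q' = {} \<and> snd q \<inter> snd q' = {})"

definition absorbed :: "('e \<Rightarrow> nat) \<Rightarrow> ('e \<Rightarrow> nat) \<Rightarrow> 'e set \<Rightarrow> (nat set \<times> nat set) set \<Rightarrow> 'e \<Rightarrow> bool" where
  "absorbed a b D Q e \<longleftrightarrow> a e \<in> a ` D \<or> b e \<in> b ` D \<or> (\<exists>q\<in>Q. a e \<in> fst q \<and> b e \<in> snd q)"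

definition decomposition :: "'e set \<Rightarrow> ('e \<Rightarrow> nat) \<Rightarrow> ('e \<Rightarrow> nat) \<Rightarrow> 'e set \<Rightarrow> (nat set \<times> nat set) set \<Rightarrow> bool" where
  "decomposition E a b D Q \<longleftrightarrow> disjoint_pieces E a b D Q \<and> (\<forall>e\<in>E. absorbed a b D Q e)"

definition decomposable :: "nat \<Rightarrow> 'e set \<Rightarrow> ('e \<Rightarrow> nat) \<Rightarrow> ('e \<Rightarrow> nat) \<Rightarrow> bool" where
  "decomposable n E a b \<longleftrightarrow> (\<exists>D Q. decomposition E a b D Q \<and> card D + card Q = n \<and> 2 * n \<le> nu E a b)"

lemma disjoint_piecesD:
  assumes "disjoint_pieces E a b D Q"
  shows "D \<in> matchings E a b" "finite Q"
    and "\<And>q. q \<in> Q \<Longrightarrow> card (fst q) = 2" "\<And>q. q \<in> Q \<Longrightarrow> card (snd q) = 2"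
    and "\<And>q p r. q \<in> Q \<Longrightarrow> p \<in> fst q \<Longrightarrow> r \<in> snd q \<Longrightarrow> \<exists>e\<in>E. a e = p \<and> b e = r"
    and "\<And>q. q \<in> Q \<Longrightarrow> fst q \<inter> a ` D = {}" "\<And>q. q \<in> Q \<Longrightarrow> snd q \<inter> b ` D = {}"
    and "\<And>q q'. q \<in> Q \<Longrightarrow> q' \<in> Q \<Longrightarrow> q \<noteq> q' \<Longrightarrow> fst q \<inter> fst q' = {}"
    and "\<And>q q'. q \<in> Q \<Longrightarrow> q' \<in> Q \<Longrightarrow> q \<noteq> q' \<Longrightarrow> snd q \<inter> snd q' = {}"
  using assms unfolding disjoint_pieces_def by simp_all

lemma disjoint_piecesI:
  assumes "D \<in> matchings E a b" "finite Q"
    and "\<And>q. q \<in> Q \<Longrightarrow> card (fst q) = 2" "\<And>q. q \<in> Q \<Longrightarrow> card (snd q) = 2"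
    and "\<And>q p r. q \<in> Q \<Longrightarrow> p \<in> fst q \<Longrightarrow> r \<in> snd q \<Longrightarrow> \<exists>e\<in>E. a e = p \<and> b e = r"
    and "\<And>q. q \<in> Q \<Longrightarrow> fst q \<inter> a ` D = {}" "\<And>q. q \<in> Q \<Longrightarrow> snd q \<inter> b ` D = {}"
    and "\<And>q q'. q \<in> Q \<Longrightarrow> q' \<in> Q \<Longrightarrow> q \<noteq> q' \<Longrightarrow> fst q \<inter> fst q' = {}"
    and "\<And>q q'. q \<in> Q \<Longrightarrow> q' \<in> Q \<Longrightarrow> q \<noteq> q' \<Longrightarrow> snd q \<inter> snd q' = {}"
  shows "disjoint_pieces E a b D Q"
  unfolding disjoint_pieces_def using assms by simp

lemma pieces_nonempty:
  assumes "disjoint_pieces E a b D Q" "q \<in> Q"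
  shows "fst q \<noteq> {}" "snd q \<noteq> {}" "finite (fst q)" "finite (snd q)"
  using disjoint_piecesD(3,4)[OF assms] by (auto intro: card_ge_0_finite)

lemma disjoint_pieces_swap:
  assumes d: "disjoint_pieces E a b D Q"
  shows "disjoint_pieces E b a D (prod.swap ` Q)"
proof (rule disjoint_piecesI)
  note p = disjoint_piecesD[OF d]
  have mem: "prod.swap q \<in> Q" if "q \<in> prod.swap ` Q" for q using that by auto
  show "D \<in> matchings E b a" using p(1) unfolding matchings_swap[of E b a] .
  show "finite (prod.swap ` Q)" using p(2) by simp
  show "card (fst q) = 2" "card (snd q) = 2" "fst q \<inter> b ` D = {}" "snd q \<inter> a ` D = {}"
    if "q \<in> prod.swap ` Q" for q
    using p(4,3,7,6)[OF mem[OF that]] by simp_all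
  show "\<exists>e\<in>E. b e = s \<and> a e = r" if "q \<in> prod.swap ` Q" "s \<in> fst q" "r \<in> snd q" for q s r
    using p(5)[OF mem[OF that(1)], of r s] that(2,3) by auto
  show "fst q \<inter> fst q' = {}" "snd q \<inter> snd q' = {}"
    if "q \<in> prod.swap ` Q" "q' \<in> prod.swap ` Q" "q \<noteq> q'" for q q'
  proof -
    have "prod.swap q \<noteq> prod.swap q'" using that(3) by (metis prod.swap_def prod.collapse prod.inject)
    then show "fst q \<inter> fst q' = {}" "snd q \<inter> snd q' = {}"
      using p(9,8)[OF mem[OF that(1)] mem[OF that(2)]] by simp_all
  qed
qed

lemma absorbed_swap: "absorbed b a D (prod.swap ` Q) e \<longleftrightarrow> absorbed a b D Q e"
  unfolding absorbed_def by auto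

lemma decomposition_swap:
  "decomposition E a b D Q \<Longrightarrow> decomposition E b a D (prod.swap ` Q)"
  unfolding decomposition_def absorbed_swap using disjoint_pieces_swap by blast

lemma decomposable_swap:
  assumes "decomposable n E a b" shows "decomposable n E b a"
proof -
  obtain D Q where "decomposition E a b D Q" "card D + card Q = n" "2 * n \<le> nu E a b"
    using assms unfolding decomposable_def by blast
  moreover have "card (prod.swap ` Q) = card Q" by (rule card_image) simp
  ultimately show ?thesis unfolding decomposable_def using decomposition_swap nu_swap by metis
qed

text \<open>
  Both ends of every middle edge together with one side of every four-cycle cover all edges.  The choice of the
  sides is free, and much of what follows compares two choices.
\<close>

lemma decomposition_cover:
  assumes d: "decomposition E a b D Q" and E: "finite E" and Q1: "Q1 \<subseteq> Q"
  defines "A \<equiv> a ` D \<union> \<Union>(fst ` Q1)" and "B \<equiv> b ` D \<union> \<Union>(snd ` (Q - Q1))"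
  shows "covers E a b A B" "finite A" "finite B" "card A + card B = 2 * (card D + card Q)"
proof -
  have dp: "disjoint_pieces E a b D Q" using d unfolding decomposition_def by blast
  note p = disjoint_piecesD[OF dp]
  note m = matchingsD[OF p(1)]
  have finD: "finite D" using m(1) E by (rule finite_subset)
  have finQ1: "finite Q1" using Q1 p(2) by (rule finite_subset)
  show "covers E a b A B"
    unfolding covers_def
  proof
    fix e assume "e \<in> E"
    then have "absorbed a b D Q e" using d unfolding decomposition_def by blast
    then show "a e \<in> A \<or> b e \<in> B" unfolding absorbed_def A_def B_def by blast
  qed
  have fins: "finite (fst q)" "finite (snd q)" if "q \<in> Q" for q using pieces_nonempty[OF dp that] by blast+
  have finU: "finite (\<Union>(fst ` Q1))" "finite (\<Union>(snd ` (Q - Q1)))"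
    using fins finQ1 p(2) Q1 by (auto intro!: finite_UN_I)
  then show "finite A" "finite B" unfolding A_def B_def using finD by simp_all
  have "card (\<Union>(fst ` Q1)) = (\<Sum>q\<in>Q1. card (fst q))"
    using finQ1 Q1 fins p(8) by (intro card_UN_disjoint) blast+
  also have "\<dots> = (\<Sum>q\<in>Q1. 2)" using p(3) Q1 by (intro sum.cong) auto
  finally have 1: "card (\<Union>(fst ` Q1)) = 2 * card Q1" by simp
  have "card (\<Union>(snd ` (Q - Q1))) = (\<Sum>q\<in>Q - Q1. card (snd q))"
    using p(2) fins p(9) by (intro card_UN_disjoint) blast+
  also have "\<dots> = (\<Sum>q\<in>Q - Q1. 2)" using p(4) by (intro sum.cong) auto
  finally have 2: "card (\<Union>(snd ` (Q - Q1))) = 2 * card (Q - Q1)" by simp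
  have "a ` D \<inter> \<Union>(fst ` Q1) = {}" "b ` D \<inter> \<Union>(snd ` (Q - Q1)) = {}" using p(6,7) Q1 by blast+
  then have "card A = card D + 2 * card Q1" "card B = card D + 2 * card (Q - Q1)"
    unfolding A_def B_def using finD finU 1 2 card_image[OF m(2)] card_image[OF m(3)]
    by (simp_all add: card_Un_disjoint)
  moreover have "card Q = card Q1 + card (Q - Q1)"
    using finQ1 p(2) Q1 by (metis card_Diff_subset card_mono le_add_diff_inverse)
  ultimately show "card A + card B = 2 * (card D + card Q)" by simp
qed

text \<open>
  A vertex of a minimum cover lies on every maximum matching.  So a missed vertex lies in no
  cover of the above form, whatever the choice of sides.
\<close>

lemma missed_vertex:
  assumes d: "decomposition E a b D Q" and E: "finite E" and I: "I \<in> matchings E a b"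
    and big: "2 * (card D + card Q) \<le> card I" and r: "r \<notin> b ` I"
  shows "r \<notin> b ` D" "\<And>q. q \<in> Q \<Longrightarrow> r \<notin> snd q" "\<And>e. e \<in> E \<Longrightarrow> b e = r \<Longrightarrow> a e \<in> a ` D"
proof -
  note c = decomposition_cover[OF d E empty_subsetI]
  have "r \<notin> b ` D \<union> \<Union>(snd ` (Q - {}))"
  proof
    assume "r \<in> b ` D \<union> \<Union>(snd ` (Q - {}))"
    from matching_meets_cover(3)[OF E I c(1-3) _ this] have "\<exists>e\<in>I. b e = r \<and> a e \<notin> a ` D \<union> \<Union>(fst ` {})"
      unfolding c(4) using big by blast
    then show False using r by blast
  qed
  then show 1: "r \<notin> b ` D" and 2: "\<And>q. q \<in> Q \<Longrightarrow> r \<notin> snd q" by simp_all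
  show "a e \<in> a ` D" if "e \<in> E" "b e = r" for e
  proof -
    have "absorbed a b D Q e" using d that(1) unfolding decomposition_def by blast
    then show ?thesis using 1 2 that(2) unfolding absorbed_def by blast
  qed
qed

text \<open>
  A vertex of a four-cycle has two neighbours, so a leaf can only be absorbed by a path.
\<close>

lemma leaf_neighbour:
  assumes d: "decomposition E a b D Q" and e: "e \<in> E" and leaf: "\<And>f. f \<in> E \<Longrightarrow> a f = a e \<Longrightarrow> f = e"
  shows "b e \<in> b ` D"
proof -
  have dp: "disjoint_pieces E a b D Q" using d unfolding decomposition_def by blast
  note p = disjoint_piecesD[OF dp]
  have "absorbed a b D Q e" using d e unfolding decomposition_def by blast
  then consider "a e \<in> a ` D" | "b e \<in> b ` D" | q where "q \<in> Q" "a e \<in> fst q" "b e \<in> snd q"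
    unfolding absorbed_def by blast
  then show ?thesis
  proof cases
    case 1
    then obtain d where "d \<in> D" "a d = a e" by force
    then have "d = e" using leaf matchingsD(1)[OF p(1)] by blast
    then show ?thesis using \<open>d \<in> D\<close> by blast
  next
    case (3 q)
    obtain r r' where "snd q = {r, r'}" "r \<noteq> r'" using p(4)[OF 3(1)] by (meson card_2_iff)
    moreover obtain f f' where "f \<in> E" "a f = a e" "b f = r" "f' \<in> E" "a f' = a e" "b f' = r'"
      using p(5)[OF 3(1,2)] calculation by (metis insertCI)
    ultimately show ?thesis using leaf by metis
  qed
qed

lemma decomposition_superset:
  assumes d: "decomposition F a b D Q" and F: "F \<subseteq> E" and "\<And>e. e \<in> E - F \<Longrightarrow> absorbed a b D Q e"
  shows "decomposition E a b D Q"
  unfolding decomposition_def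
proof
  have dp: "disjoint_pieces F a b D Q" using d unfolding decomposition_def by blast
  note p = disjoint_piecesD[OF dp]
  show "disjoint_pieces E a b D Q"
  proof (rule disjoint_piecesI)
    show "D \<in> matchings E a b" using p(1) matchings_mono[OF F] by blast
    show "\<exists>e\<in>E. a e = s \<and> b e = r" if "q \<in> Q" "s \<in> fst q" "r \<in> snd q" for q s r
      using p(5)[OF that] F by blast
  qed (fact p)+
  show "\<forall>e\<in>E. absorbed a b D Q e" using d assms(3) unfolding decomposition_def by blast
qed

lemma decomposition_insert_centre:
  assumes d: "decomposition F a b D Q" and E: "finite E" and e: "e \<in> E" and F: "F \<subseteq> avoid E a b {a e} {b e}"
    and cov: "\<And>f. f \<in> E - F \<Longrightarrow> absorbed a b (insert e D) Q f"
  shows "decomposition E a b (insert e D) Q" "card (insert e D) = Suc (card D)"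
proof -
  have dp: "disjoint_pieces F a b D Q" using d unfolding decomposition_def by blast
  note p = disjoint_piecesD[OF dp]
  note m = matchingsD[OF p(1)]
  have FE: "F \<subseteq> E" and Fe: "\<And>f. f \<in> F \<Longrightarrow> a f \<noteq> a e \<and> b f \<noteq> b e"
    using F unfolding avoid_def by auto
  have "e \<notin> D" using m(1) Fe by blast
  moreover have "finite D" using m(1) FE E by (meson finite_subset)
  ultimately show "card (insert e D) = Suc (card D)" by simp
  show "decomposition E a b (insert e D) Q"
    unfolding decomposition_def
  proof
    show "disjoint_pieces E a b (insert e D) Q"
    proof (rule disjoint_piecesI)
      have "D \<in> matchings (avoid E a b {a e} {b e}) a b" using p(1) matchings_mono[OF F] by blast
      then show "insert e D \<in> matchings E a b"
        unfolding matchings_insert_iff[OF \<open>e \<notin> D\<close>] using e by blast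
      show "\<exists>e\<in>E. a e = s \<and> b e = r" if "q \<in> Q" "s \<in> fst q" "r \<in> snd q" for q s r
        using p(5)[OF that] FE by blast
      show "fst q \<inter> a ` insert e D = {}" "snd q \<inter> b ` insert e D = {}" if q: "q \<in> Q" for q
      proof -
        obtain s r where sr: "s \<in> fst q" "r \<in> snd q" using pieces_nonempty(1,2)[OF dp q] by blast
        have "a e \<notin> fst q" using p(5)[OF q _ sr(2)] Fe by blast
        then show "fst q \<inter> a ` insert e D = {}" using p(6)[OF q] by simp
        have "b e \<notin> snd q" using p(5)[OF q sr(1)] Fe by blast
        then show "snd q \<inter> b ` insert e D = {}" using p(7)[OF q] by simp
      qed
    qed (fact p)+
    have "absorbed a b (insert e D) Q f" if "f \<in> F" for f
      using d that unfolding decomposition_def absorbed_def by blast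
    then show "\<forall>f\<in>E. absorbed a b (insert e D) Q f" using cov by blast
  qed
qed

section \<open>Tight sets and decompositions\<close>

lemma nbrs_mono: "X \<subseteq> Y \<Longrightarrow> nbrs E a b X \<subseteq> nbrs E a b Y"
  unfolding nbrs_def by blast

lemma nbrs_edge_mono: "E \<subseteq> F \<Longrightarrow> nbrs E a b X \<subseteq> nbrs F a b X"
  unfolding nbrs_def by blast

lemma nbrsI: "e \<in> E \<Longrightarrow> a e \<in> X \<Longrightarrow> b e \<in> nbrs E a b X"
  unfolding nbrs_def by blast

lemma nbrsE:
  assumes "r \<in> nbrs E a b X"
  obtains e where "e \<in> E" "a e \<in> X" "b e = r"
  using assms unfolding nbrs_def by blast

lemma nbrs_delete:
  assumes "a e \<notin> X" shows "nbrs (E - {e}) a b X = nbrs E a b X"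
  using assms unfolding nbrs_def by blast

lemma nbrs_subset_insert: "nbrs E a b X \<subseteq> insert (b e) (nbrs (E - {e}) a b X)"
  unfolding nbrs_def by blast

text \<open>
  If P has no neighbours outside of R, then J can replace the edges at R without losing in size, and
  the edges at P that remain lie in J.
\<close>

lemma swap_in_matching:
  assumes E: "finite E" and M: "M \<in> matchings E a b" and J: "J \<in> matchings E a b"
    and JP: "a ` J \<subseteq> P" and JR: "b ` J = R" and R: "nbrs E a b P \<subseteq> R"
  defines "M' \<equiv> {e \<in> M. b e \<notin> R} \<union> J"
  shows "M' \<in> matchings E a b" "card M \<le> card M'"
    "\<And>e. e \<in> M' \<Longrightarrow> b e \<in> R \<Longrightarrow> e \<in> J" "\<And>e. e \<in> M' \<Longrightarrow> a e \<in> P \<Longrightarrow> e \<in> J"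
proof -
  note m = matchingsD[OF M] and j = matchingsD[OF J]
  have finM: "finite M" and finJ: "finite J"
    by (rule finite_subset[OF m(1) E], rule finite_subset[OF j(1) E])
  have out: "a e \<notin> P" if "e \<in> M" "b e \<notin> R" for e
    using nbrsI[of e E a P b] that m(1) R by blast
  show 1: "\<And>e. e \<in> M' \<Longrightarrow> b e \<in> R \<Longrightarrow> e \<in> J" unfolding M'_def by blast
  show 2: "\<And>e. e \<in> M' \<Longrightarrow> a e \<in> P \<Longrightarrow> e \<in> J" unfolding M'_def using out by blast
  show "M' \<in> matchings E a b"
  proof (rule matchingsI)
    show "M' \<subseteq> E" unfolding M'_def using m(1) j(1) by blast
    show "inj_on a M'"
    proof (rule inj_onI)
      fix x y assume xy: "x \<in> M'" "y \<in> M'" "a x = a y"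
      show "x = y"
      proof (cases "a x \<in> P")
        case True
        then have "x \<in> J" "y \<in> J" using 2 xy by simp_all
        then show ?thesis using inj_onD[OF j(2) xy(3)] by blast
      next
        case False
        then have "a x \<notin> a ` J" "a y \<notin> a ` J" using JP xy(3) by auto
        then have "x \<notin> J" "y \<notin> J" by blast+
        then have "x \<in> M" "y \<in> M" using xy(1,2) unfolding M'_def by blast+
        then show ?thesis using inj_onD[OF m(2) xy(3)] by blast
      qed
    qed
    show "inj_on b M'"
    proof (rule inj_onI)
      fix x y assume xy: "x \<in> M'" "y \<in> M'" "b x = b y"
      show "x = y"
      proof (cases "b x \<in> R")
        case True
        then have "x \<in> J" "y \<in> J" using 1 xy by simp_all
        then show ?thesis using inj_onD[OF j(3) xy(3)] by blast
      next
        case False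
        then have "b x \<notin> b ` J" "b y \<notin> b ` J" unfolding JR using xy(3) by simp_all
        then have "x \<notin> J" "y \<notin> J" by blast+
        then have "x \<in> M" "y \<in> M" using xy(1,2) unfolding M'_def by blast+
        then show ?thesis using inj_onD[OF m(3) xy(3)] by blast
      qed
    qed
  qed
  have "card M = card {e \<in> M. b e \<notin> R} + card {e \<in> M. b e \<in> R}"
    using finM by (subst card_Un_disjoint[symmetric]) (auto intro: arg_cong[where f = card])
  moreover have "card {e \<in> M. b e \<in> R} \<le> card R"
  proof (rule card_inj_on_le[of b])
    show "inj_on b {e \<in> M. b e \<in> R}" using m(3) by (rule inj_on_subset) blast
    show "finite R" using finJ JR by blast
  qed blast
  moreover have "card R = card J" using card_image[OF j(3)] JR by simp
  moreover have "card M' = card {e \<in> M. b e \<notin> R} + card J"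
    unfolding M'_def using finM finJ JR by (intro card_Un_disjoint) auto
  ultimately show "card M \<le> card M'" by linarith
qed

text \<open>
  The part T of P outside of A forces its neighbours into B.  The edges of I at these neighbours lead back
  to T, so T has no surplus and is empty or all of P.
\<close>

lemma source_set_dichotomy:
  assumes E: "finite E" and I: "I \<in> matchings E a b" and P: "finite P"
    and surplus: "\<And>X. X \<subseteq> P \<Longrightarrow> X \<noteq> {} \<Longrightarrow> X \<noteq> P \<Longrightarrow> card X < card (nbrs E a b X)"
    and IP: "\<And>e. e \<in> I \<Longrightarrow> b e \<in> nbrs E a b P \<Longrightarrow> a e \<in> P"
    and C: "covers E a b A B" "finite A" "finite B" "card A + card B \<le> card I"
  shows "P \<inter> A = {} \<or> P \<subseteq> A"
proof (rule ccontr)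
  assume neg: "\<not> ?thesis"
  define T where "T = P - A"
  have T: "T \<subseteq> P" "T \<noteq> {}" "T \<noteq> P" using neg unfolding T_def by blast+
  define J where "J = {e \<in> I. b e \<in> B \<and> b e \<in> nbrs E a b P}"
  note m = matchingsD[OF I]
  have finI: "finite I" using m(1) E by (rule finite_subset)
  have finT: "finite T" using T(1) P by (rule finite_subset)
  have "nbrs E a b T \<subseteq> b ` J"
  proof
    fix r assume "r \<in> nbrs E a b T"
    then obtain e where e: "e \<in> E" "a e \<in> T" "b e = r" by (rule nbrsE)
    have "a e \<in> A \<or> b e \<in> B" using C(1) e(1) unfolding covers_def by blast
    then have rB: "r \<in> B" using e(2,3) unfolding T_def by blast
    obtain f where f: "f \<in> I" "b f = r" using matching_meets_cover(3)[OF E I C rB] by blast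
    have "r \<in> nbrs E a b P" using nbrsI[of e E a P b] e T(1) by blast
    then show "r \<in> b ` J" using f rB unfolding J_def by blast
  qed
  moreover have "finite J" unfolding J_def using finI by simp
  ultimately have "card (nbrs E a b T) \<le> card J" by (meson card_image_le card_mono finite_imageI order_trans)
  also have "card J \<le> card T"
  proof (rule card_inj_on_le[of a])
    show "inj_on a J" using m(2) by (rule inj_on_subset) (auto simp: J_def)
    show "a ` J \<subseteq> T"
    proof (rule image_subsetI)
      fix e assume e: "e \<in> J"
      then have eI: "e \<in> I" "b e \<in> B" "b e \<in> nbrs E a b P" unfolding J_def by blast+
      obtain f where f: "f \<in> I" "b f = b e" "a f \<notin> A" using matching_meets_cover(3)[OF E I C eI(2)] by blast
      then have "f = e" using inj_onD[OF m(3) f(2)] eI(1) by blast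
      then show "a e \<in> T" using f(3) IP[OF eI(1,3)] unfolding T_def by blast
    qed
  qed (fact finT)
  finally show False using surplus[OF T] by simp
qed

text \<open>
  A tight set with strict surplus below is met by every cover of a decomposition either completely or not
  at all.  Comparing the covers for two choices of sides leaves two possibilities:
  all neighbours are ends of middle edges, or the set is one side of a four-cycle.
\<close>

lemma source_set:
  assumes d: "decomposition E a b D Q" and E: "finite E" and I: "I \<in> matchings E a b"
    and big: "2 * (card D + card Q) \<le> card I"
    and P: "finite P" "P \<noteq> {}" and R: "card (nbrs E a b P) \<le> card P"
    and surplus: "\<And>X. X \<subseteq> P \<Longrightarrow> X \<noteq> {} \<Longrightarrow> X \<noteq> P \<Longrightarrow> card X < card (nbrs E a b X)"
    and IP: "\<And>e. e \<in> I \<Longrightarrow> b e \<in> nbrs E a b P \<Longrightarrow> a e \<in> P"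
  shows "nbrs E a b P \<subseteq> b ` D \<or> (P, nbrs E a b P) \<in> Q"
proof -
  have dp: "disjoint_pieces E a b D Q" using d unfolding decomposition_def by blast
  note p = disjoint_piecesD[OF dp]
  let ?R = "nbrs E a b P"
  have dich: "P \<inter> A = {} \<or> P \<subseteq> A"
    if "covers E a b A B" "finite A" "finite B" "card A + card B \<le> card I" for A B
    by (rule source_set_dichotomy[OF E I P(1) _ _ that]) (fact surplus, fact IP)
  note c0 = decomposition_cover[OF d E empty_subsetI]
  let ?A0 = "a ` D \<union> \<Union>(fst ` ({} :: (nat set \<times> nat set) set))" and ?B0 = "b ` D \<union> \<Union>(snd ` (Q - {}))"
  have c04: "card ?A0 + card ?B0 \<le> card I" unfolding c0(4) by (rule big)
  have D0: "P \<inter> ?A0 = {} \<or> P \<subseteq> ?A0" by (rule dich[OF c0(1-3) c04])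
  have notsub: "\<not> P \<subseteq> a ` D"
  proof
    assume PD: "P \<subseteq> a ` D"
    obtain s where "s \<in> P" using P(2) by blast
    then obtain x where x: "x \<in> D" "a x \<in> P" using PD by blast
    have "x \<in> E" using x(1) matchingsD(1)[OF p(1)] by blast
    then have bR: "b x \<in> ?R" using x(2) by (intro nbrsI)
    have "b x \<in> ?B0" using x(1) by blast
    from matching_meets_cover(3)[OF E I c0(1-3) c04 this]
    obtain e where e: "e \<in> I" "b e = b x" "a e \<notin> ?A0" by blast
    have "a e \<in> P" using IP[OF e(1)] e(2) bR by simp
    then show False using PD e(3) by blast
  qed
  then have PD: "P \<inter> a ` D = {}" using D0 by simp
  show ?thesis
  proof (cases "?R \<subseteq> b ` D")
    case False
    then obtain r where r: "r \<in> ?R" "r \<notin> b ` D" by blast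
    obtain f where f: "f \<in> E" "a f \<in> P" "b f = r" using r(1) by (rule nbrsE)
    have "absorbed a b D Q f" using d f(1) unfolding decomposition_def by blast
    then obtain q where q: "q \<in> Q" "r \<in> snd q"
      using PD f(2,3) r(2) unfolding absorbed_def by blast
    have qs: "{q} \<subseteq> Q" using q(1) by simp
    note c1 = decomposition_cover[OF d E qs]
    let ?A1 = "a ` D \<union> \<Union>(fst ` {q})" and ?B1 = "b ` D \<union> \<Union>(snd ` (Q - {q}))"
    have c14: "card ?A1 + card ?B1 \<le> card I" unfolding c1(4) by (rule big)
    have D1: "P \<inter> ?A1 = {} \<or> P \<subseteq> ?A1" by (rule dich[OF c1(1-3) c14])
    have "r \<notin> \<Union>(snd ` (Q - {q}))" using p(9)[OF _ q(1)] q(2) by blast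
    then have "r \<notin> ?B1" using r(2) by blast
    then have "a f \<in> ?A1" using c1(1) f(1,3) unfolding covers_def by blast
    then have "P \<subseteq> ?A1" using D1 f(2) by blast
    then have Pq: "P \<subseteq> fst q" using PD by auto
    obtain s where s: "s \<in> P" using P(2) by blast
    have qR: "snd q \<subseteq> ?R"
    proof
      fix t assume "t \<in> snd q"
      from p(5)[OF q(1) subsetD[OF Pq s] this]
      obtain e where e: "e \<in> E" "a e = s \<and> b e = t" by (rule bexE)
      then show "t \<in> ?R" using s nbrsI[of e E a P b] by simp
    qed
    have fq: "finite (fst q)" using pieces_nonempty(3)[OF dp q(1)] .
    have cP: "card P \<le> 2" using card_mono[OF fq Pq] p(3)[OF q(1)] by simp
    have cR: "2 \<le> card ?R" using card_mono[OF finite_nbrs[OF E] qR] p(4)[OF q(1)] by simp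
    have "card P = 2" "card ?R = 2" using cP cR R by linarith+
    then have "P = fst q" "snd q = ?R"
      using card_subset_eq[OF fq Pq] card_subset_eq[OF finite_nbrs[OF E] qR] p(3,4)[OF q(1)] by simp_all
    then have "(P, ?R) = q" by (metis prod.collapse)
    then show ?thesis using q(1) by simp
  qed simp
qed

text \<open>
  A decomposition of the split graph survives identifying r' with r.  If both were in use, a cover of the
  split graph with 2n vertices would lose one under the identification, although some matching of the
  merged graph has 2n edges.
\<close>

lemma decomposable_merge:
  assumes E: "finite E" and S: "S \<subseteq> {e \<in> E. b e = r}" and r': "\<And>e. e \<in> E \<Longrightarrow> b e \<noteq> r'"
    and d: "decomposable n E a (\<lambda>e. if e \<in> S then r' else b e)" and big: "2 * n \<le> nu E a b"
  shows "decomposable n E a b"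
proof -
  define b' where "b' e = (if e \<in> S then r' else b e)" for e
  obtain D Q where D: "decomposition E a b' D Q" and n: "card D + card Q = n"
    using d unfolding decomposable_def b'_def[symmetric] by blast
  define \<phi> where "\<phi> s = (if s = r' then r else s)" for s
  have b\<phi>: "b e = \<phi> (b' e)" if "e \<in> E" for e
    using S r'[OF that] unfolding b'_def \<phi>_def by auto
  have dp: "disjoint_pieces E a b' D Q" using D unfolding decomposition_def by blast
  note p = disjoint_piecesD[OF dp]
  have DE: "D \<subseteq> E" using matchingsD(1)[OF p(1)] .
  note c = decomposition_cover[OF D E empty_subsetI]
  define A where "A = a ` D \<union> \<Union>(fst ` ({} :: (nat set \<times> nat set) set))"
  define B where "B = b' ` D \<union> \<Union>(snd ` (Q - {}))"
  note c = c[folded A_def B_def]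
  have notboth: "\<not> (r \<in> B \<and> r' \<in> B \<and> r \<noteq> r')"
  proof
    assume rr: "r \<in> B \<and> r' \<in> B \<and> r \<noteq> r'"
    have "covers E a b A (\<phi> ` B)"
      using c(1) b\<phi> unfolding covers_def by auto
    moreover have "finite (\<phi> ` B)" using c(3) by simp
    ultimately have le: "nu E a b \<le> card A + card (\<phi> ` B)"
      using matching_meets_cover(1)[OF E _ _ c(2)] by (intro nu_le E) blast
    have "\<phi> ` B \<subseteq> B - {r'}" using rr unfolding \<phi>_def by auto
    then have "card (\<phi> ` B) \<le> card (B - {r'})" using c(3) by (intro card_mono) simp_all
    also have "card (B - {r'}) < card B" using c(3) rr by (intro card_Diff1_less) simp_all
    finally have "nu E a b < card A + card B" using le by (simp only: add_strict_left_mono le_less_trans)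
    also have "\<dots> = 2 * n" unfolding c(4) n ..
    finally show False using big by (simp only: not_less)
  qed
  have inj: "inj_on \<phi> B"
  proof (rule inj_onI)
    fix s t assume "s \<in> B" "t \<in> B" "\<phi> s = \<phi> t"
    then show "s = t" using notboth unfolding \<phi>_def by (cases "s = r'"; cases "t = r'") auto
  qed
  have DB: "b' ` D \<subseteq> B" and QB: "\<And>q. q \<in> Q \<Longrightarrow> snd q \<subseteq> B" unfolding B_def by auto
  have bD: "b ` D = \<phi> ` (b' ` D)" unfolding image_image using b\<phi> DE by (intro image_cong refl) blast
  define h where "h q = (fst q, \<phi> ` snd q)" for q :: "nat set \<times> nat set"
  have h: "fst (h q) = fst q" "snd (h q) = \<phi> ` snd q" for q unfolding h_def by simp_all
  have injh: "inj_on h Q"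
  proof (rule inj_onI, rule ccontr)
    fix q q' assume q: "q \<in> Q" "q' \<in> Q" "h q = h q'" "q \<noteq> q'"
    have "fst q = fst q'" using q(3) h(1) by metis
    then have "fst q = {}" using p(8)[OF q(1,2,4)] by simp
    then show False using pieces_nonempty(1)[OF dp q(1)] by simp
  qed
  have "decomposition E a b D (h ` Q)"
    unfolding decomposition_def
  proof
    show "disjoint_pieces E a b D (h ` Q)"
    proof (rule disjoint_piecesI)
      show "D \<in> matchings E a b"
      proof (rule matchingsI)
        show "D \<subseteq> E" by fact
        show "inj_on a D" using matchingsD(2)[OF p(1)] .
        have "inj_on (\<phi> \<circ> b') D"
          using matchingsD(3)[OF p(1)] inj_on_subset[OF inj DB] by (rule comp_inj_on)
        then show "inj_on b D" using b\<phi> DE by (subst inj_on_cong[of D b "\<phi> \<circ> b'"]) auto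
      qed
      show "finite (h ` Q)" using p(2) by simp
      show "card (fst q) = 2" "fst q \<inter> a ` D = {}" if qh: "q \<in> h ` Q" for q
      proof -
        obtain u where u: "q = h u" "u \<in> Q" using qh by (rule imageE)
        show "card (fst q) = 2" "fst q \<inter> a ` D = {}" unfolding u(1) h using p(3,6)[OF u(2)] by simp_all
      qed
      show "card (snd q) = 2" if qh: "q \<in> h ` Q" for q
      proof -
        obtain u where u: "q = h u" "u \<in> Q" using qh by (rule imageE)
        have "card (\<phi> ` snd u) = card (snd u)" using inj_on_subset[OF inj QB[OF u(2)]] by (rule card_image)
        then show ?thesis using p(4)[OF u(2)] u(1) h(2) by simp
      qed
      show "snd q \<inter> b ` D = {}" if qh: "q \<in> h ` Q" for q
      proof -
        obtain u where u: "q = h u" "u \<in> Q" using qh by (rule imageE)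
        show ?thesis unfolding u(1) h(2) bD
          using inj_on_image_Int[OF inj QB[OF u(2)] DB] p(7)[OF u(2)] by simp
      qed
      show "\<exists>e\<in>E. a e = s \<and> b e = t" if qst: "q \<in> h ` Q" "s \<in> fst q" "t \<in> snd q" for q s t
      proof -
        obtain u where u: "q = h u" "u \<in> Q" using qst(1) by (rule imageE)
        obtain t' where t': "t = \<phi> t'" "t' \<in> snd u" using qst(3) unfolding u(1) h(2) by (rule imageE)
        have "s \<in> fst u" using qst(2) unfolding u(1) h .
        from p(5)[OF u(2) this t'(2)] obtain e where "e \<in> E" "a e = s \<and> b' e = t'" by (rule bexE)
        then show ?thesis using b\<phi>[of e] t'(1) by auto
      qed
      show "fst q \<inter> fst q' = {}" "snd q \<inter> snd q' = {}"
        if qq: "q \<in> h ` Q" "q' \<in> h ` Q" "q \<noteq> q'" for q q'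
      proof -
        obtain u where u: "q = h u" "u \<in> Q" using qq(1) by (rule imageE)
        obtain v where v: "q' = h v" "v \<in> Q" using qq(2) by (rule imageE)
        have "u \<noteq> v" using qq(3) u v by blast
        then show "fst q \<inter> fst q' = {}" "snd q \<inter> snd q' = {}"
          unfolding u(1) v(1) h using p(8)[OF u(2) v(2)] p(9)[OF u(2) v(2)]
            inj_on_image_Int[OF inj QB[OF u(2)] QB[OF v(2)]] by simp_all
      qed
    qed
    show "\<forall>e\<in>E. absorbed a b D (h ` Q) e"
    proof
      fix e assume e: "e \<in> E"
      then consider "a e \<in> a ` D" | "b' e \<in> b' ` D" | q where "q \<in> Q" "a e \<in> fst q" "b' e \<in> snd q"
        using D unfolding decomposition_def absorbed_def by blast
      then show "absorbed a b D (h ` Q) e"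
      proof cases
        case 2
        then show ?thesis unfolding absorbed_def bD b\<phi>[OF e] by blast
      next
        case (3 q)
        then have "a e \<in> fst (h q)" "b e \<in> snd (h q)" unfolding h b\<phi>[OF e] by blast+
        then show ?thesis unfolding absorbed_def using 3(1) by blast
      qed (simp add: absorbed_def)
    qed
  qed
  moreover have "card (h ` Q) = card Q" using injh by (rule card_image)
  ultimately show ?thesis unfolding decomposable_def using n big by metis
qed

text \<open>
  A set T is critical for e if deleting e destroys the surplus of T.  A smallest critical set is a single
  vertex: otherwise it contains, next to the end of e, an end of another edge whose critical set, by
  submodularity of the number of neighbours, meets it in a smaller critical set.  A critical singleton
  has exactly two neighbours.
\<close>

lemma degree_two_vertex:
  assumes E: "finite E" and P: "finite P" "P \<noteq> {}"
    and inc: "P \<subseteq> a ` E"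
    and deg: "\<And>p. p \<in> P \<Longrightarrow> 2 \<le> card (nbrs E a b {p})"
    and surplus: "\<And>X. X \<subseteq> P \<Longrightarrow> X \<noteq> {} \<Longrightarrow> X \<noteq> P \<Longrightarrow> card X < card (nbrs E a b X)"
    and tot: "card P \<le> card (nbrs E a b P)"
    and crit: "\<And>e. e \<in> E \<Longrightarrow> a e \<in> P \<Longrightarrow>
      \<exists>T\<subseteq>P. a e \<in> T \<and> card (nbrs (E - {e}) a b T) \<le> card T \<and> card T < card (nbrs E a b T)"
  obtains p where "p \<in> P" "card (nbrs E a b {p}) = 2"
proof -
  define critical where "critical e T \<longleftrightarrow> e \<in> E \<and> T \<subseteq> P \<and> a e \<in> T \<and>
      card (nbrs (E - {e}) a b T) \<le> card T \<and> card T < card (nbrs E a b T)" for e T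
  have fin: "finite (nbrs F a b X)" if "F \<subseteq> E" for F X
    using finite_nbrs finite_subset[OF that E] by blast
  have fin1: "finite (nbrs (E - {e}) a b X)" for e X by (rule fin) blast
  have finT: "finite T" if "T \<subseteq> P" for T using that P(1) by (rule finite_subset)
  obtain s where "s \<in> P" using P(2) by blast
  then obtain g where g: "g \<in> E" "a g \<in> P" using inc by blast
  then have ex: "\<exists>m e T. critical e T \<and> card T = m" using crit[OF g] unfolding critical_def by blast
  define m where "m = (LEAST m. \<exists>e T. critical e T \<and> card T = m)"
  obtain e0 T where T: "critical e0 T" "card T = m"
    using LeastI_ex[OF ex] unfolding m_def by blast
  have least: "m \<le> card U" if "critical e U" for e U
    unfolding m_def by (rule Least_le) (use that in blast)
  have e0: "e0 \<in> E" "T \<subseteq> P" "a e0 \<in> T" "card (nbrs (E - {e0}) a b T) \<le> card T" "card T < card (nbrs E a b T)"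
    using T(1) unfolding critical_def by blast+
  have sub_insert: "card (nbrs E a b X) \<le> Suc (card (nbrs (E - {e}) a b X))" for e X
  proof -
    have "card (nbrs E a b X) \<le> card (insert (b e) (nbrs (E - {e}) a b X))"
      using fin1 by (intro card_mono nbrs_subset_insert) simp
    also have "\<dots> \<le> Suc (card (nbrs (E - {e}) a b X))" by (rule card_insert_le_m1) simp_all
    finally show ?thesis .
  qed
  have notin: "b e \<notin> nbrs (E - {e}) a b X"
    if "card (nbrs (E - {e}) a b X) < card (nbrs E a b X)" for e X
  proof
    assume "b e \<in> nbrs (E - {e}) a b X"
    then have "nbrs E a b X \<subseteq> nbrs (E - {e}) a b X" using nbrs_subset_insert[of E a b X e] by blast
    then show False using card_mono[OF fin1] that by (metis not_le)
  qed
  define p0 where "p0 = a e0"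
  define r0 where "r0 = b e0"
  define X1 where "X1 = nbrs (E - {e0}) a b T"
  have p0: "p0 \<in> T" "p0 \<in> P" using e0(2,3) unfolding p0_def by blast+
  have cX1: "card X1 = card T" "card (nbrs E a b T) = Suc (card T)"
    using e0(4,5) sub_insert[of T e0] unfolding X1_def by linarith+
  have r0X1: "r0 \<notin> X1" unfolding r0_def X1_def by (rule notin) (use e0(4,5) in linarith)
  show thesis
  proof (cases "T = {p0}")
    case True
    then have "card (nbrs E a b {p0}) = 2" using cX1(2) by simp
    then show thesis using that p0(2) by blast
  next
    case False
    then have ne: "T - {p0} \<noteq> {}" using p0(1) by blast
    have "T - {p0} \<noteq> P" "T - {p0} \<subseteq> P" using p0 e0(2) by blast+
    then have "card (T - {p0}) < card (nbrs E a b (T - {p0}))" using ne by (intro surplus)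
    then have "card X1 \<le> card (nbrs E a b (T - {p0}))"
      using p0(1) finT[OF e0(2)] cX1(1) by simp
    moreover have sub1: "nbrs E a b (T - {p0}) \<subseteq> X1"
    proof -
      have "nbrs E a b (T - {p0}) = nbrs (E - {e0}) a b (T - {p0})"
        by (rule nbrs_delete[symmetric]) (simp add: p0_def)
      also have "\<dots> \<subseteq> X1" unfolding X1_def by (rule nbrs_mono) blast
      finally show ?thesis .
    qed
    ultimately have X1eq: "nbrs E a b (T - {p0}) = X1"
      using card_seteq[of X1 "nbrs E a b (T - {p0})"] fin1 unfolding X1_def by blast
    have "\<not> nbrs E a b {p0} \<subseteq> {r0}"
      using deg[OF p0(2)] card_mono[of "{r0}" "nbrs E a b {p0}"] by auto
    then obtain r1 where r1: "r1 \<in> nbrs E a b {p0}" "r1 \<noteq> r0" by blast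
    obtain e1 where e1: "e1 \<in> E" "a e1 \<in> {p0}" "b e1 = r1" using r1(1) by (rule nbrsE)
    have "e1 \<noteq> e0" using e1(3) r1(2) unfolding r0_def by blast
    then have "r1 \<in> X1" unfolding X1_def using e1 p0(1) nbrsI[of e1 "E - {e0}" a T b] by simp
    then have "r1 \<in> nbrs E a b (T - {p0})" unfolding X1eq .
    then obtain e' where e': "e' \<in> E" "a e' \<in> T - {p0}" "b e' = r1" by (rule nbrsE)
    define x where "x = a e'"
    have "a e' \<in> P" using e'(2) e0(2) by blast
    then obtain T' where T': "T' \<subseteq> P" "a e' \<in> T'" "card (nbrs (E - {e'}) a b T') \<le> card T'"
      "card T' < card (nbrs E a b T')" using crit[OF e'(1)] by blast
    define X2 where "X2 = nbrs (E - {e'}) a b T'"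
    have r1X2: "r1 \<notin> X2" unfolding X2_def e'(3)[symmetric] by (rule notin) (use T'(3,4) in linarith)
    have p0T': "p0 \<notin> T'"
    proof
      assume "p0 \<in> T'"
      have "e1 \<noteq> e'" using e1(2) e'(2) by auto
      then have "r1 \<in> X2" unfolding X2_def using \<open>p0 \<in> T'\<close> e1 nbrsI[of e1 "E - {e'}" a T' b] by simp
      then show False using r1X2 by blast
    qed
    define U where "U = T \<inter> T'"
    have U: "U \<subseteq> P" "a e' \<in> U" "p0 \<notin> U" using e0(2) e'(2) T'(2) p0T' unfolding U_def by blast+
    have UX: "nbrs (E - {e'}) a b U \<subseteq> X1 \<inter> X2"
    proof
      fix r assume "r \<in> nbrs (E - {e'}) a b U"
      then obtain f where f: "f \<in> E - {e'}" "a f \<in> U" "b f = r" by (rule nbrsE)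
      have "f \<noteq> e0" using f(2) U(3) unfolding p0_def by blast
      then have "b f \<in> X1" unfolding X1_def using f by (intro nbrsI) (auto simp: U_def)
      moreover have "b f \<in> X2" unfolding X2_def using f by (intro nbrsI) (auto simp: U_def)
      ultimately show "r \<in> X1 \<inter> X2" using f(3) by blast
    qed
    have finX: "finite X1" "finite X2" unfolding X1_def X2_def by (rule fin1)+
    have cover: "nbrs E a b (T \<union> T') \<subseteq> insert r0 (X1 \<union> X2)"
    proof
      fix r assume "r \<in> nbrs E a b (T \<union> T')"
      then obtain f where f: "f \<in> E" "a f \<in> T \<union> T'" "b f = r" by (rule nbrsE)
      show "r \<in> insert r0 (X1 \<union> X2)"
      proof (cases "f = e0 \<or> f = e'")
        case True
        then show ?thesis using f(3) e'(3) \<open>r1 \<in> X1\<close> unfolding r0_def by blast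
      next
        case False
        then have "f \<in> E - {e0}" "f \<in> E - {e'}" using f(1) by blast+
        then show ?thesis using f(2,3) nbrsI[of f "E - {e0}" a T b] nbrsI[of f "E - {e'}" a T' b]
          unfolding X1_def X2_def by blast
      qed
    qed
    have big: "card (T \<union> T') \<le> card (X1 \<union> X2)"
    proof (cases "card (T \<union> T') < card (nbrs E a b (T \<union> T'))")
      case True
      have "card (nbrs E a b (T \<union> T')) \<le> card (insert r0 (X1 \<union> X2))"
        using finX by (intro card_mono cover) simp
      also have "\<dots> \<le> Suc (card (X1 \<union> X2))" by (rule card_insert_le_m1) simp_all
      finally show ?thesis using True by linarith
    next
      case False
      have TT: "T \<union> T' = P"
      proof (rule ccontr)
        assume "T \<union> T' \<noteq> P"
        then have "card (T \<union> T') < card (nbrs E a b (T \<union> T'))"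
          using e0(2) T'(1,2) by (intro surplus) blast+
        then show False using False by blast
      qed
      have "P - {p0} \<noteq> {}" "P - {p0} \<noteq> P" using ne p0(2) e0(2) by blast+
      then have "card (P - {p0}) < card (nbrs E a b (P - {p0}))" by (intro surplus) blast+
      then have "card (nbrs E a b P) \<le> card (nbrs E a b (P - {p0}))"
        using False p0(2) P(1) unfolding TT by simp
      then have "nbrs E a b (P - {p0}) = nbrs E a b P"
        by (intro card_seteq fin nbrs_mono) blast+
      moreover have "r0 \<in> nbrs E a b P" unfolding r0_def using e0(1) p0(2) by (intro nbrsI) (simp_all add: p0_def)
      ultimately obtain f where f: "f \<in> E" "a f \<in> P - {p0}" "b f = r0" by (metis nbrsE)
      have "f \<noteq> e0" using f(2) unfolding p0_def by blast
      have "a f \<notin> T"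
      proof
        assume "a f \<in> T"
        then have "r0 \<in> X1" unfolding X1_def using f \<open>f \<noteq> e0\<close> nbrsI[of f "E - {e0}" a T b] by simp
        then show False using r0X1 by blast
      qed
      then have "a f \<in> T'" using f(2) TT by blast
      moreover have "f \<noteq> e'" using f(3) e'(3) r1(2) by blast
      ultimately have "r0 \<in> X2" unfolding X2_def using f nbrsI[of f "E - {e'}" a T' b] by simp
      then have "nbrs E a b P \<subseteq> X1 \<union> X2" using cover unfolding TT by blast
      then have "card (nbrs E a b P) \<le> card (X1 \<union> X2)" using finX by (intro card_mono) simp_all
      then show ?thesis using tot unfolding TT by linarith
    qed
    have "card (nbrs (E - {e'}) a b U) \<le> card (X1 \<inter> X2)" using finX by (intro card_mono UX) simp
    moreover have "card (X1 \<union> X2) + card (X1 \<inter> X2) = card X1 + card X2" using card_Un_Int[OF finX] by simp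
    moreover have "card (T \<union> T') + card U = card T + card T'"
      unfolding U_def using card_Un_Int[OF finT[OF e0(2)] finT[OF T'(1)]] by simp
    moreover have "card X2 \<le> card T'" unfolding X2_def by (rule T'(3))
    ultimately have "card (nbrs (E - {e'}) a b U) \<le> card U" using big cX1(1) by linarith
    moreover have "card U < card (nbrs E a b U)" using U p0(2) by (intro surplus) blast+
    ultimately have "critical e' U" unfolding critical_def using e'(1) U by blast
    from least[OF this] have "card T \<le> card U" using T(2) by simp
    moreover have "card U < card T"
      using finT[OF e0(2)] p0(1) U(3) unfolding U_def by (intro psubset_card_mono) blast+
    ultimately show thesis by simp
  qed
qed

section \<open>Minimal counterexamples\<close>

definition conflicts :: "'e set \<Rightarrow> ('e \<Rightarrow> nat) \<Rightarrow> ('e \<Rightarrow> nat) \<Rightarrow> ('e \<times> 'e) set" where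
  "conflicts E a b = {(e, f). e \<in> E \<and> f \<in> E \<and> e \<noteq> f \<and> (a e = a f \<or> b e = b f)}"

text \<open>
  The measure decreases when edges are deleted and also when a vertex is split, since then the edges stay
  but fewer pairs of them meet.
\<close>

definition complexity :: "'e set \<Rightarrow> ('e \<Rightarrow> nat) \<Rightarrow> ('e \<Rightarrow> nat) \<Rightarrow> nat" where
  "complexity E a b = card E + card (conflicts E a b)"

lemma finite_conflicts: "finite E \<Longrightarrow> finite (conflicts E a b)"
  by (rule finite_subset[of _ "E \<times> E"]) (auto simp: conflicts_def)

lemma complexity_swap: "complexity E b a = complexity E a b"
  unfolding complexity_def conflicts_def by (simp add: disj_commute)

lemma complexity_less:
  assumes "finite E" "F \<subset> E" shows "complexity F a b < complexity E a b"
proof -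
  have "card F < card E" using assms by (rule psubset_card_mono)
  moreover have "conflicts F a b \<subseteq> conflicts E a b" using assms(2) unfolding conflicts_def by blast
  then have "card (conflicts F a b) \<le> card (conflicts E a b)"
    by (rule card_mono[OF finite_conflicts[OF assms(1)]])
  ultimately show ?thesis unfolding complexity_def by linarith
qed

definition minimal_counterexample :: "nat \<Rightarrow> 'e set \<Rightarrow> ('e \<Rightarrow> nat) \<Rightarrow> ('e \<Rightarrow> nat) \<Rightarrow> bool" where
  "minimal_counterexample n E a b \<longleftrightarrow>
     finite E \<and> nu E a b = 2 * n \<and> \<not> eta_at_least (Suc n) E a b \<and> \<not> decomposable n E a b \<and>
     (\<forall>(F :: 'e set) c d m. finite F \<longrightarrow> complexity F c d < complexity E a b \<longrightarrow> nu F c d = 2 * m \<longrightarrow>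
        \<not> eta_at_least (Suc m) F c d \<longrightarrow> decomposable m F c d)"

lemma mce_swap: "minimal_counterexample n E a b \<Longrightarrow> minimal_counterexample n E b a"
  unfolding minimal_counterexample_def nu_swap[of E b a] eta_at_least_swap[of _ E b a] complexity_swap[of E b a]
  using decomposable_swap by blast

context
  fixes n :: nat and E :: "'e set" and a b :: "'e \<Rightarrow> nat"
  assumes mce: "minimal_counterexample n E a b"
begin

lemma mce_facts:
  shows "finite E" "nu E a b = 2 * n" "\<not> eta_at_least (Suc n) E a b" "\<not> decomposable n E a b"
  using mce unfolding minimal_counterexample_def by simp_all

lemma mce_IH:
  fixes F :: "'e set"
  assumes "finite F" "complexity F c d < complexity E a b" "nu F c d = 2 * m" "\<not> eta_at_least (Suc m) F c d"
  shows "decomposable m F c d"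
  using mce assms unfolding minimal_counterexample_def by simp

lemma mce_not_decomposition:
  assumes "decomposition E a b D Q" "card D + card Q = n" shows False
  using assms mce_facts(2,4) unfolding decomposable_def by auto

lemma mce_n: "0 < n"
proof (rule ccontr)
  assume "\<not> 0 < n"
  then have n: "n = 0" by simp
  have "E = {}"
  proof (rule ccontr)
    assume "E \<noteq> {}"
    then obtain e where "e \<in> E" by blast
    then have "{e} \<in> matchings E a b" unfolding matchings_def by simp
    from card_le_nu[OF mce_facts(1) this] show False using mce_facts(2) n by simp
  qed
  then have "decomposition E a b {} {}"
    unfolding decomposition_def disjoint_pieces_def using empty_matching by simp
  from mce_not_decomposition[OF this] n show False by simp
qed

text \<open>
  The form in which minimality is applied to the graphs that arise as links: they have lost two in nu.
\<close>

lemma mce_subset: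
  assumes F: "F \<subset> E" and big: "2 * n \<le> nu F a b + 2" and eta: "\<not> eta_at_least n F a b"
  obtains D Q where "decomposition F a b D Q" "Suc (card D + card Q) = n" "nu F a b + 2 = 2 * n"
proof -
  have finF: "finite F" using F mce_facts(1) by (meson finite_subset psubset_imp_subset)
  have "\<not> 2 * n \<le> nu F a b + 1" using eta_ge_half_nu[OF finF] eta by blast
  then have nu: "nu F a b + 2 = 2 * n" using big by linarith
  obtain m where m: "n = Suc m" using mce_n by (cases n) simp_all
  have "decomposable m F a b"
    using nu eta m by (intro mce_IH[OF finF complexity_less[OF mce_facts(1) F]]) simp_all
  then show thesis using that nu m unfolding decomposable_def by blast
qed

text \<open>
  If the link of e were not as connected as possible, it would have a decomposition, and
  adding e as a middle edge would give one of the whole graph.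
\<close>

lemma mce_link:
  assumes e: "e \<in> E" shows "eta_at_least n (avoid E a b {a e} {b e}) a b"
proof (rule ccontr)
  let ?F = "avoid E a b {a e} {b e}"
  assume neg: "\<not> eta_at_least n ?F a b"
  have F: "?F \<subset> E" using e unfolding avoid_def by blast
  have big: "2 * n \<le> nu ?F a b + 2"
    using nu_delete_vertices[OF mce_facts(1), of "{a e}" "{b e}" a b] mce_facts(2) by simp
  obtain D Q where D: "decomposition ?F a b D Q" "Suc (card D + card Q) = n"
    using mce_subset[OF F big neg] by blast
  have cov: "absorbed a b (insert e D) Q f" if "f \<in> E - ?F" for f
    using that unfolding avoid_def absorbed_def by auto
  note ins = decomposition_insert_centre[OF D(1) mce_facts(1) e subset_refl cov]
  show False using mce_not_decomposition[OF ins(1)] ins(2) D(2) by simp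
qed

text \<open>
  Deleting e keeps both nu and the failure of connectivity, so the rest has a decomposition, which
  cannot also absorb e.
\<close>

lemma mce_delete:
  assumes e: "e \<in> E" and I: "I \<in> matchings E a b" "e \<notin> I" "2 * n \<le> card I"
  obtains D Q where "decomposition (E - {e}) a b D Q" "card D + card Q = n" "\<not> absorbed a b D Q e"
proof -
  have fin: "finite (E - {e})" using mce_facts(1) by simp
  have I': "I \<in> matchings (E - {e}) a b"
    using matchingsD[OF I(1)] I(2) by (intro matchingsI) blast+
  have "2 * n \<le> nu (E - {e}) a b" using I(3) card_le_nu[OF fin I'] by (rule order_trans)
  moreover have "nu (E - {e}) a b \<le> 2 * n"
    using nu_mono[OF mce_facts(1), of "E - {e}" a b] mce_facts(2) by auto
  ultimately have nu: "nu (E - {e}) a b = 2 * n" by simp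
  have "\<not> eta_at_least (Suc n) (E - {e}) a b"
    using eta_delete_edge[OF mce_facts(1) e _ mce_link[OF e]] mce_facts(3) by blast
  moreover have "E - {e} \<subset> E" using e by blast
  ultimately have "decomposable n (E - {e}) a b"
    by (intro mce_IH[OF fin complexity_less[OF mce_facts(1)] nu])
  then obtain D Q where D: "decomposition (E - {e}) a b D Q" "card D + card Q = n"
    unfolding decomposable_def by blast
  have "\<not> absorbed a b D Q e"
  proof
    assume "absorbed a b D Q e"
    then have "absorbed a b D Q f" if "f \<in> E - (E - {e})" for f using that by simp
    from decomposition_superset[OF D(1) _ this] show False
      using mce_not_decomposition D(2) by blast
  qed
  then show thesis using that D by blast
qed

lemma mce_max_matching:
  obtains I where "I \<in> matchings E a b" "card I = 2 * n"
  using nu_attained[OF mce_facts(1), of a b] mce_facts(2) by metis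

text \<open>
  A decomposition that absorbs an edge absorbs every parallel one.
\<close>

lemma mce_simple:
  assumes e: "e \<in> E" and f: "f \<in> E" and par: "a e = a f" "b e = b f"
  shows "e = f"
proof (rule ccontr)
  assume ne: "e \<noteq> f"
  have key: False if h: "e \<in> E" "f \<in> E" "a e = a f" "b e = b f" "e \<noteq> f" "e \<notin> I" "I \<in> matchings E a b" "card I = 2 * n" for e f I
  proof -
    have "2 * n \<le> card I" using h(8) by simp
    then obtain D Q where D: "decomposition (E - {e}) a b D Q" "\<not> absorbed a b D Q e"
      using mce_delete[OF h(1,7,6)] by blast
    have "f \<in> E - {e}" using h(2,5) by blast
    then have "absorbed a b D Q f" using D(1) unfolding decomposition_def by blast
    then show False using D(2) h(3,4) unfolding absorbed_def by simp
  qed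
  obtain I where I: "I \<in> matchings E a b" "card I = 2 * n" by (rule mce_max_matching)
  have "\<not> (e \<in> I \<and> f \<in> I)" using inj_onD[OF matchingsD(2)[OF I(1)] par(1)] ne by blast
  then consider "e \<notin> I" | "f \<notin> I" by blast
  then show False
  proof cases
    case 1
    show False by (rule key[OF e f par ne 1 I])
  next
    case 2
    show False by (rule key[OF f e par[symmetric] ne[symmetric] 2 I])
  qed
qed

text \<open>
  A proper splitting of a vertex is less complex but has matchings at least as large, so one of the
  links in the splitting lemma has to be bad; otherwise the decomposition of the split graph could be merged.
\<close>

lemma mce_split:
  assumes S: "S \<subseteq> {e \<in> E. b e = r}" "S \<noteq> {}" and g: "g \<in> E" "b g = r" "g \<notin> S"
  obtains e f where "e \<in> S" "f \<in> E" "b f = r" "f \<notin> S" "a e \<noteq> a f"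
    "\<not> eta_at_least n (avoid E a b {a e, a f} {r}) a b"
proof (rule ccontr)
  note found = that
  assume neg: "\<not> thesis"
  note fin = mce_facts(1)
  obtain r' where r': "r' \<notin> b ` E" using fin by (meson ex_new_if_finite finite_imageI infinite_UNIV_nat)
  define b' where "b' e = (if e \<in> S then r' else b e)" for e
  have fresh: "b e \<noteq> r'" if "e \<in> E" for e using r' that by blast
  have lk: "eta_at_least n (avoid E a b {a e, a f} {r}) a b"
    if "e \<in> S" "f \<in> E" "b f = r" "f \<notin> S" "a e \<noteq> a f" for e f
    using neg found[OF that] by blast
  have noteta: "\<not> eta_at_least (Suc n) E a b'"
    using eta_split_vertex[OF fin S(1) fresh _ lk] mce_facts(3) unfolding b'_def by blast
  have b'_eq: "b e = b f" if "b' e = b' f" "e \<in> E" "f \<in> E" for e f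
    using that S(1) fresh[of e] fresh[of f] unfolding b'_def by (auto split: if_splits)
  have "nu E a b \<le> nu E a b'"
  proof (rule nu_le[OF fin])
    fix I assume I: "I \<in> matchings E a b"
    note m = matchingsD[OF I]
    have "inj_on b' I"
      by (rule inj_onI) (use b'_eq m(1) inj_onD[OF m(3)] in blast)
    then have "I \<in> matchings E a b'" using m by (intro matchingsI)
    then show "card I \<le> nu E a b'" by (rule card_le_nu[OF fin])
  qed
  moreover have "\<not> 2 * Suc n \<le> nu E a b' + 1" using eta_ge_half_nu[OF fin] noteta by blast
  ultimately have nu: "nu E a b' = 2 * n" using mce_facts(2) by simp
  obtain e where e: "e \<in> S" using S(2) by blast
  have eE: "e \<in> E" "b e = r" using S(1) e by blast+
  have "e \<noteq> g" using e g(3) by blast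
  have "conflicts E a b' \<subset> conflicts E a b"
  proof
    show "conflicts E a b' \<subseteq> conflicts E a b"
      unfolding conflicts_def using b'_eq by blast
    have "(e, g) \<in> conflicts E a b"
      unfolding conflicts_def using eE g \<open>e \<noteq> g\<close> by simp
    moreover have "(e, g) \<notin> conflicts E a b'"
    proof
      assume "(e, g) \<in> conflicts E a b'"
      then have "a e = a g \<or> b' e = b' g" unfolding conflicts_def by simp
      moreover have "b' e \<noteq> b' g" unfolding b'_def using e g(3) fresh[OF g(1)] by simp
      ultimately have "a e = a g" by blast
      then show False using mce_simple[OF eE(1) g(1)] eE(2) g(2) \<open>e \<noteq> g\<close> by simp
    qed
    ultimately show "conflicts E a b' \<noteq> conflicts E a b" by blast
  qed
  then have "card (conflicts E a b') < card (conflicts E a b)"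
    by (rule psubset_card_mono[OF finite_conflicts[OF fin]])
  then have "complexity E a b' < complexity E a b" unfolding complexity_def by simp
  then have "decomposable n E a b'" by (rule mce_IH[OF fin _ nu noteta])
  then have "decomposable n E a b"
    unfolding b'_def using mce_facts(2) by (intro decomposable_merge[OF fin S(1) fresh]) simp_all
  then show False using mce_facts(4) by blast
qed

text \<open>
  Splitting off the leaf edge yields an edge f at its other end with a bad link; the decomposition of this link
  extends by f as a new middle edge, and that absorbs the leaf edge too.
\<close>

lemma mce_no_leaf:
  assumes e: "e \<in> E" and leaf: "\<And>f. f \<in> E \<Longrightarrow> a f = a e \<Longrightarrow> f = e"
  shows False
proof (cases "\<exists>g\<in>E. g \<noteq> e \<and> b g = b e")
  case False
  then have "a f \<noteq> a e \<and> b f \<noteq> b e" if "f \<in> E" "f \<noteq> e" for f using leaf that by blast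
  then have "eta_at_least (Suc n) E a b" by (rule eta_isolated_edge[OF mce_facts(1) e])
  then show False using mce_facts(3) by blast
next
  case True
  then obtain g where g: "g \<in> E" "g \<noteq> e" "b g = b e" by blast
  have S: "{e} \<subseteq> {f \<in> E. b f = b e}" "{e} \<noteq> {}" "g \<notin> {e}" using e g(2) by simp_all
  obtain e' f where f: "e' \<in> {e}" "f \<in> E" "b f = b e" "f \<notin> {e}" "a e' \<noteq> a f"
    "\<not> eta_at_least n (avoid E a b {a e', a f} {b e}) a b"
    by (rule mce_split[OF S(1,2) g(1,3) S(3)])
  have "avoid E a b {a e', a f} {b e} = avoid E a b {a f} {b f}"
    unfolding avoid_def using f(1,3) leaf by auto
  then show False using f(6) mce_link[OF f(2)] by simp
qed

lemma mce_degree: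
  assumes "p \<in> a ` E" shows "2 \<le> card (nbrs E a b {p})"
proof (rule ccontr)
  assume neg: "\<not> ?thesis"
  obtain e where e: "p = a e" "e \<in> E" using assms by (rule imageE)
  have be: "b e \<in> nbrs E a b {p}" using e by (intro nbrsI) simp_all
  have fin: "finite (nbrs E a b {p})" using mce_facts(1) by (rule finite_nbrs)
  have "f = e" if f: "f \<in> E" "a f = a e" for f
  proof -
    have bf: "b f \<in> nbrs E a b {p}" using f e(1) by (intro nbrsI) simp_all
    have "b f = b e"
    proof (rule ccontr)
      assume "b f \<noteq> b e"
      then have "card {b e, b f} = 2" by simp
      moreover have "card {b e, b f} \<le> card (nbrs E a b {p})" using be bf by (intro card_mono[OF fin]) simp
      ultimately show False using neg by simp
    qed
    then show ?thesis using mce_simple[OF f(1) e(2)] f(2) by simp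
  qed
  then show False by (rule mce_no_leaf[OF e(2)])
qed

end

lemma mce_split_a:
  assumes mce: "minimal_counterexample n E a b"
    and S: "S \<subseteq> {e \<in> E. a e = p}" "S \<noteq> {}" and g: "g \<in> E" "a g = p" "g \<notin> S"
  obtains e f where "e \<in> S" "f \<in> E" "a f = p" "f \<notin> S" "b e \<noteq> b f"
    "\<not> eta_at_least n (avoid E a b {p} {b e, b f}) a b"
proof -
  obtain e f where "e \<in> S" "f \<in> E" "a f = p" "f \<notin> S" "b e \<noteq> b f"
    "\<not> eta_at_least n (avoid E b a {b e, b f} {p}) b a"
    by (rule mce_split[OF mce_swap[OF mce] S g])
  then show thesis using that unfolding avoid_swap[of E b a] eta_at_least_swap[of n _ b a] by blast
qed

text \<open>
  Splitting the two edges at p apart leaves only one candidate for the bad link.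
\<close>

lemma mce_degree_two:
  assumes mce: "minimal_counterexample n E a b" and p: "card (nbrs E a b {p}) = 2"
  obtains r s where "r \<noteq> s" "nbrs E a b {p} = {r, s}" "\<not> eta_at_least n (avoid E a b {p} {r, s}) a b"
proof -
  note simple = mce_simple[OF mce]
  obtain r s where rs: "nbrs E a b {p} = {r, s}" "r \<noteq> s" using p by (meson card_2_iff)
  have "r \<in> nbrs E a b {p}" "s \<in> nbrs E a b {p}" using rs(1) by simp_all
  then obtain e f where e: "e \<in> E" "a e = p" "b e = r" and f: "f \<in> E" "a f = p" "b f = s"
    by (auto elim!: nbrsE)
  have S: "{e} \<subseteq> {e \<in> E. a e = p}" "{e} \<noteq> {}" "f \<notin> {e}" using e f rs(2) by auto
  obtain e' f' where ef: "e' \<in> {e}" "f' \<in> E" "a f' = p" "f' \<notin> {e}" "b e' \<noteq> b f'"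
    "\<not> eta_at_least n (avoid E a b {p} {b e', b f'}) a b"
    by (rule mce_split_a[OF mce S(1,2) f(1,2) S(3)])
  have "b f' \<in> {r, s}" using ef(2,3) rs(1) nbrsI[of f' E a "{p}" b] by simp
  then have "b f' = s" using ef(1,5) e(3) by auto
  then show thesis using that[OF rs(2,1)] ef(1,6) e(3) by simp
qed

lemma card_le_Suc_card_Diff:
  assumes "finite S" shows "card S \<le> Suc (card (S - {t}))"
  using assms by (cases "t \<in> S") (simp_all add: card_Suc_Diff1 del: card_Diff_insert)

text \<open>
  Deleting r and s costs T at most two neighbours.  Two are lost only if
  both are neighbours of T, and then p can be added to T without new neighbours, so the surplus was at least two.
\<close>

lemma hall_after_deleting_neighbours:
  assumes E: "finite E" and p: "nbrs E a b {p} = {r, s}" "r \<noteq> s" and T: "T \<noteq> {}" "p \<notin> T" "finite T"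
    and sp: "card T < card (nbrs E a b T)"
    and sp': "r \<in> nbrs E a b T \<Longrightarrow> s \<in> nbrs E a b T \<Longrightarrow> card (insert p T) < card (nbrs E a b (insert p T))"
  shows "card T \<le> card (nbrs (avoid E a b {p} {r, s}) a b T)"
proof -
  have eq: "nbrs (avoid E a b {p} {r, s}) a b T = nbrs E a b T - {r, s}"
    unfolding nbrs_def avoid_def using T(2) by auto
  have fin: "finite (nbrs E a b T)" using E by (rule finite_nbrs)
  show ?thesis
  proof (cases "r \<in> nbrs E a b T \<and> s \<in> nbrs E a b T")
    case True
    have "nbrs E a b (insert p T) = nbrs E a b {p} \<union> nbrs E a b T" unfolding nbrs_def by blast
    also have "\<dots> = nbrs E a b T" unfolding p(1) using True by blast
    finally have "Suc (card T) < card (nbrs E a b T)" using sp' True T(2,3) by simp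
    moreover have "card (nbrs E a b T - {r, s}) = card (nbrs E a b T) - card {r, s}"
      using True by (intro card_Diff_subset) simp_all
    ultimately show ?thesis unfolding eq using p(2) by simp
  next
    case False
    then obtain t where "nbrs E a b T - {t} \<subseteq> nbrs E a b T - {r, s}" by blast
    then have "card (nbrs E a b T - {t}) \<le> card (nbrs E a b T - {r, s})" using fin by (intro card_mono) simp_all
    moreover have "card (nbrs E a b T) \<le> Suc (card (nbrs E a b T - {t}))"
      using fin by (rule card_le_Suc_card_Diff)
    ultimately show ?thesis unfolding eq using sp by linarith
  qed
qed

text \<open>
  If all of the left side had surplus, a vertex p of degree two would exist there.  After deleting p and
  its neighbours Hall's condition still holds for the rest of the left side, so that nu drops by
  at most one; but the link at p is bad, and this requires a drop of two.
\<close>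

lemma mce_not_everywhere_surplus:
  assumes mce: "minimal_counterexample n E a b"
    and surplus: "\<And>X. X \<subseteq> a ` E \<Longrightarrow> X \<noteq> {} \<Longrightarrow> card X < card (nbrs E a b X)"
  shows False
proof -
  note fin = mce_facts(1)[OF mce] and nu = mce_facts(2)[OF mce]
  let ?P = "a ` E"
  have finP: "finite ?P" using fin by simp
  obtain M where M: "M \<in> matchings E a b" "card M = 2 * n" by (rule mce_max_matching[OF mce])
  have "card M = card (a ` M)" using matchingsD(2)[OF M(1)] by (rule card_image[symmetric])
  also have "\<dots> \<le> card ?P" using matchingsD(1)[OF M(1)] by (intro card_mono finP image_mono)
  finally have P2n: "2 * n \<le> card ?P" using M(2) by simp
  have "?P \<noteq> {}" using P2n mce_n[OF mce] by auto
  have crit: "\<exists>T\<subseteq>?P. a e \<in> T \<and> card (nbrs (E - {e}) a b T) \<le> card T \<and> card T < card (nbrs E a b T)"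
    if e: "e \<in> E" for e
  proof (rule ccontr)
    assume neg: "\<not> ?thesis"
    let ?F = "E - {e}"
    have finF: "finite ?F" using fin by simp
    have sp: "card T < card (nbrs ?F a b T)" if T: "T \<subseteq> ?P" "T \<noteq> {}" for T
    proof (cases "a e \<in> T")
      case True
      then show ?thesis using neg surplus[OF T] T(1) by (meson not_le)
    next
      case False
      then show ?thesis using surplus[OF T] by (simp add: nbrs_delete)
    qed
    have miss: "\<exists>I\<in>matchings ?F a b. card I = card ?P \<and> y \<notin> b ` I" for y
    proof -
      let ?H = "avoid ?F a b {} {y}"
      have finH: "finite ?H" using avoid_subset finF by (rule finite_subset)
      have hall: "card T \<le> card (nbrs ?H a b T)" if T: "T \<subseteq> ?P" for T
      proof (cases "T = {}")
        case False
        have "nbrs ?H a b T = nbrs ?F a b T - {y}" unfolding nbrs_def avoid_def by auto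
        then have "card (nbrs ?F a b T) \<le> Suc (card (nbrs ?H a b T))"
          using card_le_Suc_card_Diff[OF finite_nbrs[OF finF, of a b T], of y] by (simp only:)
        then show ?thesis using sp[OF T False] by linarith
      qed simp
      obtain I where I: "I \<in> matchings ?H a b" "a ` I = ?P" "card I = card ?P"
        by (rule hall_matching[OF finH finP hall])
      have "y \<notin> b ` I" using matchingsD(1)[OF I(1)] unfolding avoid_def by blast
      moreover have "I \<in> matchings ?F a b" by (rule subsetD[OF matchings_mono[OF avoid_subset] I(1)])
      ultimately show ?thesis using I(3) by blast
    qed
    obtain I where I: "I \<in> matchings ?F a b" "card I = card ?P" using miss by blast
    have "I \<in> matchings E a b" using I(1) matchings_mono[of ?F E] by blast
    moreover have "e \<notin> I" using matchingsD(1)[OF I(1)] by blast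
    moreover have "2 * n \<le> card I" using I(2) P2n by simp
    ultimately obtain D Q where D: "decomposition ?F a b D Q" "card D + card Q = n"
      using mce_delete[OF mce e] by blast
    have "y \<notin> b ` D" "\<And>q. q \<in> Q \<Longrightarrow> y \<notin> snd q" for y
    proof -
      obtain J where J: "J \<in> matchings ?F a b" "card J = card ?P" "y \<notin> b ` J" using miss by blast
      have "2 * (card D + card Q) \<le> card J" using J(2) D(2) P2n by simp
      from missed_vertex(1,2)[OF D(1) finF J(1) this J(3)]
      show "y \<notin> b ` D" "\<And>q. q \<in> Q \<Longrightarrow> y \<notin> snd q" by blast+
    qed
    then have "D = {}" "\<And>q. q \<in> Q \<Longrightarrow> snd q = {}" by blast+
    moreover have "disjoint_pieces ?F a b D Q" using D(1) unfolding decomposition_def by blast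
    ultimately have "Q = {}" using pieces_nonempty(2) by blast
    then show False using D(2) \<open>D = {}\<close> mce_n[OF mce] by simp
  qed
  have tot: "card ?P \<le> card (nbrs E a b ?P)" using surplus[of ?P] \<open>?P \<noteq> {}\<close> by simp
  obtain p where p: "p \<in> ?P" "card (nbrs E a b {p}) = 2"
  proof (rule degree_two_vertex[OF fin finP \<open>?P \<noteq> {}\<close> subset_refl _ _ tot])
    show "2 \<le> card (nbrs E a b {p})" if "p \<in> ?P" for p using mce_degree[OF mce that] .
    show "card X < card (nbrs E a b X)" if "X \<subseteq> ?P" "X \<noteq> {}" for X using surplus that .
    show "\<exists>T\<subseteq>?P. a e \<in> T \<and> card (nbrs (E - {e}) a b T) \<le> card T \<and> card T < card (nbrs E a b T)"
      if "e \<in> E" for e using crit that .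
  qed blast
  obtain r s where rs: "r \<noteq> s" "nbrs E a b {p} = {r, s}"
    and eta: "\<not> eta_at_least n (avoid E a b {p} {r, s}) a b"
    by (rule mce_degree_two[OF mce p(2)])
  let ?E3 = "avoid E a b {p} {r, s}"
  have fin3: "finite ?E3" using avoid_subset fin by (rule finite_subset)
  have hall: "card T \<le> card (nbrs ?E3 a b T)" if T: "T \<subseteq> ?P - {p}" for T
  proof (cases "T = {}")
    case False
    have TP: "T \<subseteq> ?P" "p \<notin> T" using T by blast+
    show ?thesis
    proof (rule hall_after_deleting_neighbours[OF fin rs(2,1) False TP(2)])
      show "finite T" using TP(1) finP by (rule finite_subset)
      show "card T < card (nbrs E a b T)" using TP(1) False by (rule surplus)
      show "card (insert p T) < card (nbrs E a b (insert p T))"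
        using TP(1) p(1) by (intro surplus) blast+
    qed
  qed simp
  have finP': "finite (?P - {p})" using finP by simp
  obtain J where J: "J \<in> matchings ?E3 a b" "a ` J = ?P - {p}" "card J = card (?P - {p})"
    by (rule hall_matching[OF fin3 finP' hall])
  have "card ?P - 1 \<le> nu ?E3 a b" using card_le_nu[OF fin3 J(1)] J(3) p(1) by simp
  then have "2 * n \<le> nu ?E3 a b + 1" using P2n by linarith
  then show False using eta_ge_half_nu[OF fin3] eta by blast
qed

section \<open>The contradiction from a tight set\<close>

lemma matching_onto_neighbours:
  assumes E: "finite E" and P: "finite P" and hall: "\<And>X. X \<subseteq> P \<Longrightarrow> card X \<le> card (nbrs E a b X)"
    and R: "nbrs E a b P \<subseteq> R" "finite R" "card R \<le> card P"
  obtains J where "J \<in> matchings E a b" "a ` J = P" "b ` J = R"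
proof -
  obtain J where J: "J \<in> matchings E a b" "a ` J = P" "card J = card P"
    by (rule hall_matching[OF E P hall])
  have "b ` J \<subseteq> R"
  proof (rule image_subsetI)
    fix e assume "e \<in> J"
    then have "e \<in> E" "a e \<in> P" using matchingsD(1)[OF J(1)] J(2) by blast+
    then show "b e \<in> R" using nbrsI[of e E a P b] R(1) by blast
  qed
  moreover have "card (b ` J) = card P" using card_image[OF matchingsD(3)[OF J(1)]] J(3) by simp
  ultimately have "b ` J = R" using R(2,3) by (intro card_seteq) simp_all
  then show thesis using that J(1,2) by blast
qed

lemma surplus_hall:
  assumes E: "finite E" and sp: "\<And>X. X \<subseteq> P \<Longrightarrow> X \<noteq> {} \<Longrightarrow> X \<noteq> P \<Longrightarrow> card X < card (nbrs E a b X)"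
    and tot: "card P \<le> card (nbrs E a b P)" and X: "X \<subseteq> P"
  shows "card X \<le> card (nbrs E a b X)"
proof (cases "X = {} \<or> X = P")
  case True
  then show ?thesis using tot by auto
next
  case False
  then show ?thesis using sp[OF X] by simp
qed

text \<open>
  By the preceding section a minimal counterexample has a set on its left side without surplus.  P is an
  inclusion-minimal one.
\<close>

locale tight_source =
  fixes n :: nat and E :: "'e set" and a b :: "'e \<Rightarrow> nat" and P :: "nat set"
  assumes mce: "minimal_counterexample n E a b"
    and P: "P \<subseteq> a ` E" "P \<noteq> {}"
    and tight: "card (nbrs E a b P) \<le> card P"
    and surplus: "\<And>X. X \<subseteq> P \<Longrightarrow> X \<noteq> {} \<Longrightarrow> X \<noteq> P \<Longrightarrow> card X < card (nbrs E a b X)"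
begin

abbreviation "R \<equiv> nbrs E a b P"

lemma finE: "finite E" using mce_facts(1)[OF mce] .

lemma finP: "finite P" using P(1) finE by (meson finite_imageI finite_subset)

lemma finR: "finite R" using finE by (rule finite_nbrs)

lemma card_P: "2 \<le> card P"
proof -
  obtain p where p: "p \<in> P" using P(2) by blast
  have "2 \<le> card (nbrs E a b {p})" using P(1) p by (intro mce_degree[OF mce]) blast
  also have "\<dots> \<le> card R" using p by (intro card_mono finR nbrs_mono) simp
  finally show ?thesis using tight by simp
qed

lemma proper_part: "p \<in> P \<Longrightarrow> P - {p} \<noteq> {}"
proof
  assume "p \<in> P" "P - {p} = {}"
  then have "P = {p}" by blast
  then show False using card_P by simp
qed

lemma card_R: "card R = card P"
proof -
  obtain p where p: "p \<in> P" using P(2) by blast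
  have "card (P - {p}) < card (nbrs E a b (P - {p}))"
    using p proper_part by (intro surplus) blast+
  also have "\<dots> \<le> card R" by (intro card_mono finR nbrs_mono) blast
  finally show ?thesis using tight p finP by simp
qed

lemma big_matching_through:
  assumes J: "J \<in> matchings E a b" "a ` J = P" "b ` J = R"
  obtains I where "I \<in> matchings E a b" "2 * n \<le> card I" "\<And>e. e \<in> I \<Longrightarrow> b e \<in> R \<Longrightarrow> e \<in> J" "J \<subseteq> I"
proof -
  obtain M where M: "M \<in> matchings E a b" "card M = 2 * n" by (rule mce_max_matching[OF mce])
  have "a ` J \<subseteq> P" using J(2) by simp
  note s = swap_in_matching[OF finE M(1) J(1) this J(3) subset_refl]
  show thesis
  proof (rule that[OF s(1)])
    show "2 * n \<le> card ({e \<in> M. b e \<notin> R} \<union> J)" using s(2) M(2) by simp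
  qed (use s(3) in blast)+
qed

lemma perfect_matching:
  obtains J where "J \<in> matchings E a b" "a ` J = P" "b ` J = R"
proof -
  have tot: "card P \<le> card R" using card_R by simp
  have "card X \<le> card (nbrs E a b X)" if "X \<subseteq> P" for X
    by (rule surplus_hall[OF finE _ tot that]) (fact surplus)
  from matching_onto_neighbours[OF finE finP this subset_refl finR tight] show thesis using that by blast
qed

lemma aligned_matching:
  obtains I where "I \<in> matchings E a b" "2 * n \<le> card I" "\<And>e. e \<in> I \<Longrightarrow> b e \<in> R \<Longrightarrow> a e \<in> P"
proof -
  obtain J where J: "J \<in> matchings E a b" "a ` J = P" "b ` J = R" by (rule perfect_matching)
  obtain I where I: "I \<in> matchings E a b" "2 * n \<le> card I" "\<And>e. e \<in> I \<Longrightarrow> b e \<in> R \<Longrightarrow> e \<in> J"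
    by (rule big_matching_through[OF J]) blast
  have "a e \<in> P" if "e \<in> I" "b e \<in> R" for e using I(3)[OF that] J(2) by blast
  then show thesis by (rule that[OF I(1,2)])
qed

text \<open>
  If deleting e left the surplus of all proper subsets of P intact, some maximum matching would avoid e, and
  in the decomposition of the rest the set P would be a source whose neighbourhood absorbs e.
\<close>

lemma critical_set:
  assumes e: "e \<in> E" "a e \<in> P"
  shows "\<exists>T\<subseteq>P. a e \<in> T \<and> card (nbrs (E - {e}) a b T) \<le> card T \<and> card T < card (nbrs E a b T)"
proof (rule ccontr)
  assume neg: "\<not> ?thesis"
  let ?F = "E - {e}"
  have finF: "finite ?F" using finE by simp
  have sp: "card X < card (nbrs ?F a b X)" if X: "X \<subseteq> P" "X \<noteq> {}" "X \<noteq> P" for X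
  proof (cases "a e \<in> X")
    case True
    then show ?thesis using neg surplus[OF X] X(1) by (meson not_le)
  next
    case False
    then show ?thesis using surplus[OF X] by (simp add: nbrs_delete)
  qed
  have "card (P - {a e}) < card (nbrs ?F a b (P - {a e}))"
    using e(2) proper_part by (intro sp) blast+
  also have "\<dots> \<le> card (nbrs ?F a b P)" by (intro card_mono finite_nbrs finF nbrs_mono) blast
  finally have tot: "card P \<le> card (nbrs ?F a b P)" using e(2) finP by simp
  have RF: "nbrs ?F a b P = R"
    using tot card_R by (intro card_seteq finR nbrs_edge_mono) simp_all
  have "card X \<le> card (nbrs ?F a b X)" if "X \<subseteq> P" for X
    by (rule surplus_hall[OF finF _ tot that]) (fact sp)
  then obtain J where J: "J \<in> matchings ?F a b" "a ` J = P" "b ` J = R"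
    using matching_onto_neighbours[OF finF finP _ _ finR tight] RF by blast
  have JE: "J \<in> matchings E a b" using J(1) matchings_mono[of ?F E] by blast
  obtain I where I: "I \<in> matchings E a b" "2 * n \<le> card I" "\<And>e. e \<in> I \<Longrightarrow> b e \<in> R \<Longrightarrow> e \<in> J"
    by (rule big_matching_through[OF JE J(2,3)]) blast
  have beR: "b e \<in> R" using e by (intro nbrsI)
  have eI: "e \<notin> I" using I(3) beR matchingsD(1)[OF J(1)] by blast
  obtain D Q where D: "decomposition ?F a b D Q" "card D + card Q = n" "\<not> absorbed a b D Q e"
    by (rule mce_delete[OF mce e(1) I(1) eI I(2)])
  have IF: "I \<in> matchings ?F a b" using I(1) eI matchingsD[OF I(1)] by (intro matchingsI) blast+
  have big: "2 * (card D + card Q) \<le> card I" using I(2) D(2) by simp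
  have tF: "card (nbrs ?F a b P) \<le> card P" unfolding RF by (rule tight)
  have "a e \<in> P" if "e \<in> I" "b e \<in> nbrs ?F a b P" for e
    using I(3)[OF that(1)] that(2) J(2) unfolding RF by blast
  from source_set[OF D(1) finF IF big finP P(2) tF sp this]
  have "R \<subseteq> b ` D \<or> (P, R) \<in> Q" unfolding RF .
  then have "absorbed a b D Q e"
    unfolding absorbed_def using beR e(2) by (metis fst_conv snd_conv subsetD)
  then show False using D(3) by blast
qed

text \<open>
  After deleting a crossing edge, P is still tight and becomes one side of a four-cycle: if all of its
  neighbourhood were ends of middle edges, the crossing edge would be absorbed.
\<close>

lemma crossing_edge:
  assumes g: "g \<in> E" "b g \<in> R" "a g \<notin> P" shows "card P = 2"
proof -
  obtain I where I: "I \<in> matchings E a b" "2 * n \<le> card I" "\<And>e. e \<in> I \<Longrightarrow> b e \<in> R \<Longrightarrow> a e \<in> P"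
    by (rule aligned_matching) blast
  have gI: "g \<notin> I" using I(3) g(2,3) by blast
  obtain D Q where D: "decomposition (E - {g}) a b D Q" "card D + card Q = n" "\<not> absorbed a b D Q g"
    by (rule mce_delete[OF mce g(1) I(1) gI I(2)])
  have same: "nbrs (E - {g}) a b X = nbrs E a b X" if "X \<subseteq> P" for X
    using g(3) that by (intro nbrs_delete) blast
  have IF: "I \<in> matchings (E - {g}) a b" using I(1) gI matchingsD[OF I(1)] by (intro matchingsI) blast+
  have finF: "finite (E - {g})" using finE by simp
  have big: "2 * (card D + card Q) \<le> card I" using I(2) D(2) by simp
  have "R \<subseteq> b ` D \<or> (P, R) \<in> Q"
    using source_set[OF D(1) finF IF big finP P(2)] tight surplus I(3) same subset_refl[of P] by auto
  moreover have "\<not> R \<subseteq> b ` D" using D(3) g(2) unfolding absorbed_def by blast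
  ultimately have "(P, R) \<in> Q" by blast
  moreover have "disjoint_pieces (E - {g}) a b D Q" using D(1) unfolding decomposition_def by blast
  ultimately show ?thesis using disjoint_piecesD(3) by fastforce
qed

text \<open>
  Let p in P have degree two, with neighbours r and s, and consider the decomposition of the graph F without these
  three.  The other vertices of P can be missed by maximum matchings of F, so their neighbours are all
  ends of middle edges that come from outside of P, and such crossing edges exist only if P has two elements.
  Then P and its neighbourhood span a four-cycle.  It can be added to the decomposition, unless a crossing
  edge leaves it; but splitting there yields a decomposition of the whole graph as well.
\<close>

lemma contradiction: False
proof -
  note nu = mce_facts(2)[OF mce]
  have tot: "card P \<le> card R" using card_R by simp
  have deg: "2 \<le> card (nbrs E a b {p})" if "p \<in> P" for p using P(1) that by (intro mce_degree[OF mce]) blast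
  obtain p where p: "p \<in> P" "card (nbrs E a b {p}) = 2"
    by (rule degree_two_vertex[OF finE finP P(2,1) deg surplus tot critical_set])
  obtain r s where rs: "r \<noteq> s" "nbrs E a b {p} = {r, s}"
    and eta: "\<not> eta_at_least n (avoid E a b {p} {r, s}) a b"
    by (rule mce_degree_two[OF mce p(2)])
  let ?F = "avoid E a b {p} {r, s}"
  have FE: "?F \<subset> E"
  proof -
    obtain e where "e \<in> E" "a e = p" using p(1) P(1) by blast
    then show ?thesis unfolding avoid_def by blast
  qed
  have finF: "finite ?F" using FE finE by (meson finite_subset psubset_imp_subset)
  have rsR: "{r, s} \<subseteq> R" using rs(2) nbrs_mono[of "{p}" P E a b] p(1) by blast
  have big: "2 * n \<le> nu ?F a b + 2"
  proof -
    obtain M where M: "M \<in> matchings E a b" "card M = 2 * n" by (rule mce_max_matching[OF mce])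
    note m = matchingsD[OF M(1)]
    have "card {f \<in> M. a f \<in> {p} \<or> b f \<in> {r, s}} \<le> card {r, s}"
    proof (rule card_inj_on_le[of b])
      show "inj_on b {f \<in> M. a f \<in> {p} \<or> b f \<in> {r, s}}" using m(3) by (rule inj_on_subset) blast
      show "b ` {f \<in> M. a f \<in> {p} \<or> b f \<in> {r, s}} \<subseteq> {r, s}"
      proof (rule image_subsetI)
        fix f assume "f \<in> {f \<in> M. a f \<in> {p} \<or> b f \<in> {r, s}}"
        then have "f \<in> E" "a f \<in> {p} \<or> b f \<in> {r, s}" using m(1) by blast+
        then show "b f \<in> {r, s}" using nbrsI[of f E a "{p}" b] rs(2) by blast
      qed
    qed simp
    then have "card {f \<in> M. a f \<in> {p} \<or> b f \<in> {r, s}} \<le> 2" using rs(1) by simp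
    from nu_avoid_ge[OF finE M(1) this] show ?thesis using M(2) by simp
  qed
  obtain D Q where D: "decomposition ?F a b D Q" "Suc (card D + card Q) = n" and nuF: "nu ?F a b + 2 = 2 * n"
    by (rule mce_subset[OF mce FE big eta])
  have dp: "disjoint_pieces ?F a b D Q" using D(1) unfolding decomposition_def by blast
  note pc = disjoint_piecesD[OF dp]
  have DF: "D \<subseteq> ?F" using matchingsD(1)[OF pc(1)] .
  define P' where "P' = P - {p}"
  define R' where "R' = R - {r, s}"
  have nF: "nbrs ?F a b P' \<subseteq> R'"
    unfolding nbrs_def avoid_def R'_def P'_def by blast
  have cR': "card R' = card P - 2"
    unfolding R'_def using rsR rs(1) card_R by (subst card_Diff_subset) simp_all
  \<comment> \<open>all of P except for p and q can be matched into the neighbourhood of P without r and s, which it fills; nothing is left for q\<close>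
  have missed: "\<exists>I\<in>matchings ?F a b. 2 * (card D + card Q) \<le> card I \<and> q \<notin> a ` I" if q: "q \<in> P'" for q
  proof -
    have qP: "q \<in> P" "q \<noteq> p" using q unfolding P'_def by blast+
    have finT: "finite (P' - {q})" unfolding P'_def using finP by simp
    have hall: "card X \<le> card (nbrs ?F a b X)" if X: "X \<subseteq> P' - {q}" for X
    proof (cases "X = {}")
      case False
      have XP: "X \<subseteq> P" "X \<noteq> P" "p \<notin> X" "q \<notin> X" using X qP unfolding P'_def by blast+
      show ?thesis
      proof (rule hall_after_deleting_neighbours[OF finE rs(2,1) False XP(3)])
        show "finite X" using XP(1) finP by (rule finite_subset)
        show "card X < card (nbrs E a b X)" by (rule surplus[OF XP(1) False XP(2)])
        have "insert p X \<subseteq> P" "insert p X \<noteq> {}" "insert p X \<noteq> P" using XP qP p(1) by blast+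
        then show "card (insert p X) < card (nbrs E a b (insert p X))" by (rule surplus)
      qed
    qed simp
    have sub: "nbrs ?F a b (P' - {q}) \<subseteq> R'" using nF nbrs_mono[of "P' - {q}" P' ?F a b] by blast
    have "card (P' - {q}) = card P - 2" using q p(1) finP unfolding P'_def by simp
    then have cle: "card R' \<le> card (P' - {q})" using cR' by simp
    have finR': "finite R'" unfolding R'_def using finR by simp
    obtain J where J: "J \<in> matchings ?F a b" "a ` J = P' - {q}" "b ` J = R'"
      by (rule matching_onto_neighbours[OF finF finT hall sub finR' cle])
    obtain M where M: "M \<in> matchings ?F a b" "card M = nu ?F a b" by (rule nu_attained[OF finF])
    have "a ` J \<subseteq> P'" using J(2) by blast
    note sw = swap_in_matching[OF finF M(1) J(1) this J(3) nF]
    have "q \<notin> a ` ({e \<in> M. b e \<notin> R'} \<union> J)"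
    proof
      assume "q \<in> a ` ({e \<in> M. b e \<notin> R'} \<union> J)"
      then obtain e where e: "q = a e" "e \<in> {e \<in> M. b e \<notin> R'} \<union> J" by (rule imageE)
      have "e \<in> J" using sw(4)[OF e(2)] e(1) q by simp
      then have "q \<in> P' - {q}" using J(2) e(1) by blast
      then show False by blast
    qed
    moreover have "2 * (card D + card Q) \<le> card ({e \<in> M. b e \<notin> R'} \<union> J)" using sw(2) M(2) nuF D(2) by simp
    ultimately show ?thesis using sw(1) by blast
  qed
  have missable: "q \<notin> a ` D" "\<And>u. u \<in> Q \<Longrightarrow> q \<notin> fst u" "\<And>e. e \<in> ?F \<Longrightarrow> a e = q \<Longrightarrow> b e \<in> b ` D"
    if q: "q \<in> P'" for q
  proof -
    obtain I where I: "I \<in> matchings ?F a b" "2 * (card D + card Q) \<le> card I" "q \<notin> a ` I"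
      using missed[OF q] by blast
    have Ds: "decomposition ?F b a D (prod.swap ` Q)" using D(1) by (rule decomposition_swap)
    have cs: "card (prod.swap ` Q) = card Q" by (rule card_image) simp
    have Is: "I \<in> matchings ?F b a" using I(1) unfolding matchings_swap[of _ b a] .
    have big: "2 * (card D + card (prod.swap ` Q)) \<le> card I" unfolding cs by (rule I(2))
    note mv = missed_vertex[OF Ds finF Is big I(3)]
    show "q \<notin> a ` D" by (rule mv(1))
    show "q \<notin> fst u" if "u \<in> Q" for u using mv(2)[of "prod.swap u"] that by simp
    show "b e \<in> b ` D" if "e \<in> ?F" "a e = q" for e by (rule mv(3)[OF that])
  qed
  have R'D: "R' \<subseteq> b ` D"
  proof
    fix t assume t: "t \<in> R'"
    then have tR: "t \<in> R" "t \<noteq> r" "t \<noteq> s" unfolding R'_def by blast+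
    obtain f where f: "f \<in> E" "a f \<in> P" "b f = t" using tR(1) by (rule nbrsE)
    have "a f \<noteq> p"
    proof
      assume "a f = p"
      then have "b f \<in> {r, s}" using nbrsI[of f E a "{p}" b] f(1) rs(2) by simp
      then show False using f(3) tR(2,3) by simp
    qed
    then have "f \<in> ?F" "a f \<in> P'" using f tR(2,3) unfolding avoid_def P'_def by simp_all
    then show "t \<in> b ` D" using missable(3)[of "a f" f] f(3) by simp
  qed
  \<comment> \<open>otherwise a third neighbour of P is the end of a middle edge from outside of P, a crossing edge\<close>
  have k2: "card P = 2"
  proof (rule ccontr)
    assume "card P \<noteq> 2"
    then have "card R' \<noteq> 0" using cR' card_P by simp
    then have "R' \<noteq> {}" by auto
    then obtain t where t: "t \<in> R'" by blast
    have "t \<in> b ` D" using R'D t by blast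
    then obtain d where d: "t = b d" "d \<in> D" by (rule imageE)
    have "d \<in> ?F" using d(2) DF by blast
    then have "d \<in> E" "a d \<noteq> p" unfolding avoid_def by simp_all
    moreover have "a d \<notin> P'" using missable(1)[of "a d"] d(2) by blast
    moreover have "b d \<in> R" using t d(1) unfolding R'_def by blast
    ultimately have "card P = 2" by (intro crossing_edge[of d]) (simp_all add: P'_def)
    then show False using \<open>card P \<noteq> 2\<close> by blast
  qed
  obtain p' where p': "P = {p, p'}" "p \<noteq> p'"
  proof -
    have "card P' = 1" using k2 p(1) finP unfolding P'_def by simp
    then obtain p' where "P' = {p'}" by (rule card_1_singletonE)
    then show thesis using that[of p'] p(1) unfolding P'_def by blast
  qed
  have Req: "R = {r, s}" using card_seteq[OF finR rsR] card_R k2 rs(1) by simp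
  have all: "nbrs E a b {q} = {r, s}" if "q \<in> P" for q
  proof -
    have "nbrs E a b {q} \<subseteq> R" using that by (intro nbrs_mono) simp
    then have "nbrs E a b {q} = R" using card_seteq[OF finR] deg[OF that] card_R k2 by simp
    then show ?thesis using Req by simp
  qed
  have joined: "\<exists>e\<in>E. a e = q \<and> b e = t" if "q \<in> P" "t \<in> R" for q t
  proof -
    have "t \<in> nbrs E a b {q}" using all[OF that(1)] that(2) Req by simp
    then show ?thesis by (rule nbrsE) blast
  qed
  \<comment> \<open>a crossing edge at t: separate the edges from P at t from the other ones\<close>
  have nocross: "a g \<in> P" if g: "g \<in> E" "b g \<in> R" for g
  proof (rule ccontr)
    assume gP: "a g \<notin> P"
    define t where "t = b g"
    define S where "S = {e \<in> E. b e = t \<and> a e \<in> P}"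
    obtain e0 where e0: "e0 \<in> E" "a e0 = p" "b e0 = t" using joined[OF p(1) g(2)] unfolding t_def by blast
    have S: "S \<subseteq> {e \<in> E. b e = t}" "S \<noteq> {}" "g \<notin> S" using e0 p(1) gP unfolding S_def by blast+
    obtain e f where ef: "e \<in> S" "f \<in> E" "b f = t" "f \<notin> S" "a e \<noteq> a f"
      and eta4: "\<not> eta_at_least n (avoid E a b {a e, a f} {t}) a b"
      by (rule mce_split[OF mce S(1,2) g(1) t_def[symmetric] S(3)])
    let ?G = "avoid E a b {a e, a f} {t}"
    have e: "e \<in> E" "b e = t" "a e \<in> P" using ef(1) unfolding S_def by blast+
    have fP: "a f \<notin> P" using ef(2-4) unfolding S_def by blast
    define q where "q = (if a e = p then p' else p)"
    have q: "P = {a e, q}" "q \<noteq> a e" using p' e(3) unfolding q_def by (simp_all, blast+)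
    define t' where "t' = (if t = r then s else r)"
    have "t \<in> {r, s}" using g(2) unfolding Req t_def .
    then have t': "R = {t, t'}" "t' \<noteq> t" using rs(1) unfolding Req t'_def by auto
    have qP: "q \<in> P" and t'R: "t' \<in> R" using q(1) t'(1) by blast+
    obtain x where x: "x \<in> E" "a x = q" "b x = t'" using joined[OF qP t'R] by blast
    have J: "{e, x} \<in> matchings E a b"
      using e x q(2) t'(2) unfolding matchings_def by (auto simp: inj_on_def)
    have J2: "a ` {e, x} = P" "b ` {e, x} = R" using e x q t' by auto
    obtain I where I: "I \<in> matchings E a b" "2 * n \<le> card I" "{e, x} \<subseteq> I"
      by (rule big_matching_through[OF J J2])
    note m = matchingsD[OF I(1)]
    have GE: "?G \<subset> E" using e(1,2) unfolding avoid_def by blast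
    have finI: "finite I" using m(1) finE by (rule finite_subset)
    have "{h \<in> I. a h \<in> {a e, a f} \<or> b h \<in> {t}} \<subseteq> insert e {h \<in> I. a h \<in> {a f}}"
    proof
      fix h assume "h \<in> {h \<in> I. a h \<in> {a e, a f} \<or> b h \<in> {t}}"
      then have h: "h \<in> I" "a h = a e \<or> a h = a f \<or> b h = b e" using e(2) by auto
      have "e \<in> I" using I(3) by blast
      then show "h \<in> insert e {h \<in> I. a h \<in> {a f}}"
        using h inj_onD[OF m(2), of h e] inj_onD[OF m(3), of h e] by blast
    qed
    then have "card {h \<in> I. a h \<in> {a e, a f} \<or> b h \<in> {t}} \<le> card (insert e {h \<in> I. a h \<in> {a f}})"
      using finI by (intro card_mono) simp_all
    also have "\<dots> \<le> Suc (card {h \<in> I. a h \<in> {a f}})" by (rule card_insert_le_m1) simp_all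
    also have "card {h \<in> I. a h \<in> {a f}} \<le> card {a f}"
      by (rule card_inj_on_le[of a]) (auto intro: inj_on_subset[OF m(2)])
    finally have "card {h \<in> I. a h \<in> {a e, a f} \<or> b h \<in> {t}} \<le> 2" by simp
    from nu_avoid_ge[OF finE I(1) this] have bigG: "2 * n \<le> nu ?G a b + 2" using I(2) by simp
    obtain D4 Q4 where D4: "decomposition ?G a b D4 Q4" "Suc (card D4 + card Q4) = n"
      by (rule mce_subset[OF mce GE bigG eta4]) blast
    have xG: "x \<in> ?G" using x q(2) t'(2) fP qP unfolding avoid_def by auto
    have leaf: "h = x" if h: "h \<in> ?G" "a h = a x" for h
    proof -
      have hE: "h \<in> E" "b h \<noteq> t" using h(1) unfolding avoid_def by simp_all
      have "b h \<in> R" using nbrsI[of h E a P b] hE(1) h(2) x(2) qP by simp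
      then have "b h = b x" using hE(2) t'(1) x(3) by simp
      then show ?thesis using mce_simple[OF mce hE(1) x(1) h(2)] by blast
    qed
    \<comment> \<open>the other vertex q of P has lost its edge to t and become a leaf\<close>
    have t'D: "t' \<in> b ` D4" using leaf_neighbour[OF D4(1) xG leaf] x(3) by simp
    have Gsub: "?G \<subseteq> avoid E a b {a f} {b f}" using ef(3) unfolding avoid_def by auto
    have cov: "absorbed a b (insert f D4) Q4 h" if h: "h \<in> E - ?G" for h
    proof -
      have "h \<in> E" "a h = a e \<or> a h = a f \<or> b h = t" using h unfolding avoid_def by auto
      moreover have "b h \<in> {t, t'}" if "a h = a e"
        using nbrsI[of h E a P b] \<open>h \<in> E\<close> that e(3) t'(1) by simp
      ultimately show ?thesis using t'D ef(3) unfolding absorbed_def by auto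
    qed
    note ins = decomposition_insert_centre[OF D4(1) finE ef(2) Gsub cov]
    show False using mce_not_decomposition[OF mce ins(1)] ins(2) D4(2) by simp
  qed
  have FP: "a e \<notin> P" "b e \<notin> R" if "e \<in> ?F" for e
  proof -
    have e: "e \<in> E" "b e \<noteq> r" "b e \<noteq> s" using that unfolding avoid_def by simp_all
    then show "b e \<notin> R" using Req by simp
    then show "a e \<notin> P" using nbrsI[of e E a P b] e(1) by blast
  qed
  have new: "fst u \<inter> P = {}" "snd u \<inter> R = {}" if u: "u \<in> Q" for u
  proof -
    obtain x y where xy: "x \<in> fst u" "y \<in> snd u" using pieces_nonempty(1,2)[OF dp u] by blast
    have "z \<notin> P" if "z \<in> fst u" for z using pc(5)[OF u that xy(2)] FP(1) by blast
    then show "fst u \<inter> P = {}" by blast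
    have "z \<notin> R" if "z \<in> snd u" for z using pc(5)[OF u xy(1) that] FP(2) by blast
    then show "snd u \<inter> R = {}" by blast
  qed
  have "(P, R) \<notin> Q" using new(1)[of "(P, R)"] P(2) by auto
  then have cQ: "card (insert (P, R) Q) = Suc (card Q)" using pc(2) by simp
  have "decomposition E a b D (insert (P, R) Q)"
    unfolding decomposition_def
  proof
    show "disjoint_pieces E a b D (insert (P, R) Q)"
    proof (rule disjoint_piecesI)
      show "D \<in> matchings E a b" using pc(1) matchings_mono[OF avoid_subset] by (rule subsetD[rotated])
      show "finite (insert (P, R) Q)" using pc(2) by simp
      show "card (fst u) = 2" "card (snd u) = 2" if "u \<in> insert (P, R) Q" for u
        using that pc(3,4)[of u] k2 card_R by auto
      show "\<exists>e\<in>E. a e = x \<and> b e = y" if "u \<in> insert (P, R) Q" "x \<in> fst u" "y \<in> snd u" for u x y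
      proof (cases "u = (P, R)")
        case True
        then show ?thesis using joined that(2,3) by simp
      next
        case False
        then have "u \<in> Q" using that(1) by blast
        from pc(5)[OF this that(2,3)] obtain e where e: "e \<in> ?F" "a e = x \<and> b e = y" by (rule bexE)
        have "e \<in> E" using avoid_subset e(1) by (rule subsetD)
        then show ?thesis using e(2) by (rule bexI[rotated])
      qed
      have PD: "P \<inter> a ` D = {}" and RD: "R \<inter> b ` D = {}"
      proof -
        have "a d \<notin> P" "b d \<notin> R" if "d \<in> D" for d
          by (rule FP(1)[OF subsetD[OF DF that]], rule FP(2)[OF subsetD[OF DF that]])
        then show "P \<inter> a ` D = {}" "R \<inter> b ` D = {}" by (simp_all only: disjoint_iff image_iff) metis+
      qed
      show "fst u \<inter> a ` D = {}" "snd u \<inter> b ` D = {}" if u: "u \<in> insert (P, R) Q" for u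
      proof -
        have "fst u \<inter> a ` D = {} \<and> snd u \<inter> b ` D = {}"
        proof (cases "u = (P, R)")
          case True
          then show ?thesis using PD RD by simp
        next
          case False
          then have "u \<in> Q" using u by simp
          then show ?thesis using pc(6,7) by simp
        qed
        then show "fst u \<inter> a ` D = {}" "snd u \<inter> b ` D = {}" by simp_all
      qed
      show "fst u \<inter> fst v = {}" "snd u \<inter> snd v = {}"
        if uv: "u \<in> insert (P, R) Q" "v \<in> insert (P, R) Q" "u \<noteq> v" for u v
      proof -
        have "fst u \<inter> fst v = {} \<and> snd u \<inter> snd v = {}"
        proof (cases "u = (P, R)")
          case True
          then have "v \<in> Q" using uv by simp
          then show ?thesis using new[of v] True by (simp add: Int_commute)
        next
          case False
          then have uQ: "u \<in> Q" using uv by simp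
          show ?thesis
          proof (cases "v = (P, R)")
            case True
            then show ?thesis using new[OF uQ] by simp
          next
            case False
            then have "v \<in> Q" using uv by simp
            then show ?thesis using pc(8,9)[OF uQ _ uv(3)] by simp
          qed
        qed
        then show "fst u \<inter> fst v = {}" "snd u \<inter> snd v = {}" by simp_all
      qed
    qed
    show "\<forall>e\<in>E. absorbed a b D (insert (P, R) Q) e"
    proof
      fix e assume e: "e \<in> E"
      show "absorbed a b D (insert (P, R) Q) e"
      proof (cases "e \<in> ?F")
        case True
        then have "absorbed a b D Q e" using D(1) unfolding decomposition_def by blast
        then show ?thesis unfolding absorbed_def by blast
      next
        case False
        then have "a e = p \<or> b e \<in> R" using e Req unfolding avoid_def by auto
        moreover have "b e \<in> R" if "a e = p" using nbrsI[of e E a P b] e p(1) that by simp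
        ultimately have "b e \<in> R" by blast
        then have "a e \<in> P" using nocross e by blast
        then show ?thesis unfolding absorbed_def using \<open>b e \<in> R\<close> by auto
      qed
    qed
  qed
  from mce_not_decomposition[OF mce this] show False using cQ D(2) by simp
qed

end

theorem no_minimal_counterexample: "\<not> minimal_counterexample n E a b"
proof
  assume mce: "minimal_counterexample n E a b"
  note fin = mce_facts(1)[OF mce]
  define bad where "bad X \<longleftrightarrow> X \<subseteq> a ` E \<and> X \<noteq> {} \<and> card (nbrs E a b X) \<le> card X" for X
  show False
  proof (cases "\<exists>X. bad X")
    case False
    then show False
      using mce_not_everywhere_surplus[OF mce] unfolding bad_def by (meson not_le)
  next
    case True
    then obtain P where P: "bad P" and least: "\<And>X. bad X \<Longrightarrow> card P \<le> card X"
      using ex_has_least_nat[of bad _ card] by blast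
    have finP: "finite P" using P fin unfolding bad_def by (meson finite_imageI finite_subset)
    have "tight_source n E a b P"
    proof
      show "minimal_counterexample n E a b" by (fact mce)
      show "P \<subseteq> a ` E" "P \<noteq> {}" "card (nbrs E a b P) \<le> card P" using P unfolding bad_def by blast+
      show "card X < card (nbrs E a b X)" if X: "X \<subseteq> P" "X \<noteq> {}" "X \<noteq> P" for X
      proof (rule ccontr)
        assume "\<not> ?thesis"
        then have "bad X" using X P unfolding bad_def by auto
        from least[OF this] show False using psubset_card_mono[OF finP, of X] X by auto
      qed
    qed
    then show False by (rule tight_source.contradiction)
  qed
qed

text \<open>
  The combinatorial core: a graph in which the lower bound half of nu is attained has a decomposition.
\<close>

theorem decomposable_if_tight:
  fixes E :: "'e set"
  assumes "finite E" "nu E a b = 2 * n" "\<not> eta_at_least (Suc n) E a b"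
  shows "decomposable n E a b"
  using assms
proof (induction "complexity E a b" arbitrary: E a b n rule: less_induct)
  case less
  show ?case
  proof (rule ccontr)
    assume "\<not> decomposable n E a b"
    then have "minimal_counterexample n E a b"
      unfolding minimal_counterexample_def using less by blast
    then show False using no_minimal_counterexample by blast
  qed
qed

section \<open>Spheres, balls and cross-polytopes\<close>

lemma geometric_realization_eq: "geometric_realization K = top_of_set (realize K)"
  unfolding geometric_realization_def realize_def euclidean_product_topology ..

definition unit_sphere :: "nat \<Rightarrow> (nat \<Rightarrow> real) set" where
  "unit_sphere m = {x. (\<Sum>i<m. x i ^ 2) = 1 \<and> (\<forall>i\<ge>m. x i = 0)}"

definition unit_ball :: "nat \<Rightarrow> (nat \<Rightarrow> real) set" where
  "unit_ball m = {x. (\<Sum>i<m. x i ^ 2) \<le> 1 \<and> (\<forall>i\<ge>m. x i = 0)}"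

lemma nsphere_eq: "nsphere m = top_of_set (unit_sphere (Suc m))"
  unfolding nsphere unit_sphere_def euclidean_product_topology lessThan_Suc_atMost
  by (simp add: Suc_le_eq)

lemma ball_top_eq: "ball_top (int m) = top_of_set (unit_ball m)"
  unfolding ball_top_def Euclidean_space_def unit_ball_def euclidean_product_topology
  by (simp add: subtopology_subtopology Collect_conj_eq Int_commute)

lemma sphere_top_eq: "sphere_top (int m - 1) = top_of_set (if m = 0 then {} else unit_sphere m)"
proof (cases m)
  case 0
  have "discrete_topology {} = top_of_set ({} :: (nat \<Rightarrow> real) set)"
    by (simp add: discrete_topology_unique)
  then show ?thesis using 0 by (simp add: sphere_top_def)
next
  case (Suc d)
  then show ?thesis by (simp add: sphere_top_def nsphere_eq)
qed

lemma unit_sphere_subset_ball: "unit_sphere m \<subseteq> unit_ball m"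
  unfolding unit_sphere_def unit_ball_def by auto

lemma closed_unit_sphere: "closed (unit_sphere m)"
proof -
  have c: "continuous_on UNIV (\<lambda>x::nat \<Rightarrow> real. x i)" for i by (rule continuous_on_product_coordinates)
  have 1: "closed {x::nat \<Rightarrow> real. (\<Sum>i<m. x i ^ 2) = 1}"
    by (rule closed_Collect_eq) (intro continuous_intros c)+
  have 2: "closed {x::nat \<Rightarrow> real. x i = 0}" for i
    by (rule closed_Collect_eq) (intro continuous_intros c)+
  have "unit_sphere m = {x. (\<Sum>i<m. x i ^ 2) = 1} \<inter> (\<Inter>i\<in>{m..}. {x. x i = 0})"
    unfolding unit_sphere_def by auto
  moreover have "closed \<dots>" using 1 2 by (intro closed_Int closed_INT) auto
  ultimately show ?thesis by simp
qed

text \<open>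
  The index d is the dimension of the ball; for d = 0 the sphere is empty, the ball is a point, and the condition
  says that the realization is nonempty.
\<close>

lemma k_connected_iff_ball:
  "k_connected (int m - 2) (geometric_realization K) \<longleftrightarrow>
     (\<forall>d<m. \<forall>f. continuous_on (if d = 0 then {} else unit_sphere d) f \<and>
        f ` (if d = 0 then {} else unit_sphere d) \<subseteq> realize K \<longrightarrow>
        (\<exists>g. continuous_on (unit_ball d) g \<and> g ` unit_ball d \<subseteq> realize K \<and>
           (\<forall>x\<in>(if d = 0 then {} else unit_sphere d). g x = f x)))"
  (is "?L \<longleftrightarrow> (\<forall>d<m. ?R d)")
proof -
  have each: "(\<forall>f. continuous_map (sphere_top (int d - 1)) (geometric_realization K) f \<longrightarrow>
       (\<exists>g. continuous_map (ball_top (int d - 1 + 1)) (geometric_realization K) g \<and>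
            (\<forall>x\<in>topspace (sphere_top (int d - 1)). g x = f x))) \<longleftrightarrow> ?R d" for d
  proof -
    have "int d - 1 + 1 = int d" by simp
    then show ?thesis
      unfolding geometric_realization_eq sphere_top_eq ball_top_eq
      by (simp only: ball_top_eq continuous_map_subtopology_eu topspace_subtopology topspace_euclidean Int_UNIV_left
          image_subset_iff_funcset continuous_map_in_subtopology continuous_map_iff_continuous conj_assoc)
  qed
  show ?thesis
  proof
    assume L: ?L
    show "\<forall>d<m. ?R d"
    proof (rule allI, rule impI)
      fix d assume "d < m"
      then have "- 1 \<le> int d - 1 \<and> int d - 1 \<le> int m - 2" by simp
      from mp[OF spec[OF L[unfolded k_connected_def]] this] show "?R d" by (rule iffD1[OF each])
    qed
  next
    assume R: "\<forall>d<m. ?R d"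
    show ?L
      unfolding k_connected_def
    proof (intro allI impI)
      fix j :: int and f
      assume j: "- 1 \<le> j \<and> j \<le> int m - 2" and f: "continuous_map (sphere_top j) (geometric_realization K) f"
      define d where "d = nat (j + 1)"
      have jd: "j = int d - 1" and "d < m" using j unfolding d_def by auto
      have "?R d" by (rule mp[OF spec[OF R, of d] \<open>d < m\<close>])
      from mp[OF spec[OF iffD2[OF each this]] f[unfolded jd]]
      show "\<exists>g. continuous_map (ball_top (j + 1)) (geometric_realization K) g \<and>
          (\<forall>x\<in>topspace (sphere_top j). g x = f x)"
        unfolding jd .
    qed
  qed
qed

lemma k_connected_if_eta_ge:
  assumes "eta_ge m (realize K)"
  shows "k_connected (int m - 2) (geometric_realization K)"
  unfolding k_connected_iff_ball
proof (intro allI impI)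
  fix d f
  let ?S = "if d = 0 then {} else unit_sphere d"
  assume "d < m" and f: "continuous_on ?S f \<and> f ` ?S \<subseteq> realize K"
  then have "eta_ge (Suc d) (realize K)" by (intro eta_ge_mono[OF assms]) simp
  then have ext: "extensor d (realize K)" by simp
  define a where "a i = (if i < d then - 1 else (0::real))" for i
  define b where "b i = (if i < d then 1 else (0::real))" for i
  have ab: "a \<le> b" unfolding a_def b_def le_fun_def by simp
  have ax: "axes a b = {..<d}" unfolding axes_def a_def b_def by auto
  have sub: "unit_ball d \<subseteq> brick a b"
  proof
    fix x assume x: "x \<in> unit_ball d"
    have "a i \<le> x i \<and> x i \<le> b i" for i
    proof (cases "i < d")
      case True
      then have "x i ^ 2 \<le> (\<Sum>i<d. x i ^ 2)" by (intro member_le_sum) simp_all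
      then have "x i ^ 2 \<le> 1" using x unfolding unit_ball_def by simp
      then have "\<bar>x i\<bar> \<le> 1" by (simp add: abs_square_le_1)
      then show ?thesis using True unfolding a_def b_def by auto
    next
      case False
      then show ?thesis using x unfolding unit_ball_def a_def b_def by simp
    qed
    then show "x \<in> brick a b" unfolding mem_brick by blast
  qed
  have clS: "closed ?S" using closed_unit_sphere[of d] by simp
  have SB: "?S \<subseteq> unit_ball d" using unit_sphere_subset_ball[of d] by simp
  obtain g where g: "continuous_on (brick a b) g" "g ` brick a b \<subseteq> realize K" "\<And>x. x \<in> ?S \<Longrightarrow> g x = f x"
  proof (rule extensorE[OF ext ab _ _ clS subset_trans[OF SB sub] conjunct1[OF f] conjunct2[OF f]])
    show "finite (axes a b)" "card (axes a b) \<le> d" unfolding ax by simp_all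
  qed (rule that)
  show "\<exists>g. continuous_on (unit_ball d) g \<and> g ` unit_ball d \<subseteq> realize K \<and> (\<forall>x\<in>?S. g x = f x)"
    using continuous_on_subset[OF g(1) sub] subset_trans[OF image_mono[OF sub] g(2)] g(3) by (intro exI[of _ g] conjI ballI)
qed

text \<open>
  Composing such a retraction with the contraction of the ball to its centre would contract the sphere.
\<close>

lemma no_retraction_of_ball:
  assumes r: "continuous_on (unit_ball (Suc m)) r" "r ` unit_ball (Suc m) \<subseteq> unit_sphere (Suc m)"
    and id: "\<And>x. x \<in> unit_sphere (Suc m) \<Longrightarrow> r x = x"
  shows False
proof -
  let ?S = "unit_sphere (Suc m)" and ?B = "unit_ball (Suc m)"
  define h where "h = (\<lambda>(t::real, x). r (\<lambda>i. (1 - t) * x i))"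
  have ball: "(\<lambda>i. (1 - t) * x i) \<in> ?B" if "t \<in> {0..1}" "x \<in> ?S" for t x
  proof -
    have "(\<Sum>i<Suc m. ((1 - t) * x i) ^ 2) = (1 - t) ^ 2 * (\<Sum>i<Suc m. x i ^ 2)"
      by (simp add: power_mult_distrib sum_distrib_left distrib_left)
    also have "\<dots> \<le> 1" using that by (simp add: unit_sphere_def power_le_one)
    finally show ?thesis using that(2) unfolding unit_ball_def unit_sphere_def by simp
  qed
  have "continuous_on ({0..1} \<times> ?S) h"
    unfolding h_def split_def
  proof (rule continuous_on_compose2[OF r(1)])
    show "continuous_on ({0..1} \<times> ?S) (\<lambda>p i. (1 - fst p) * snd p i)"
    proof (rule continuous_on_coordinatewise_then_product)
      fix i
      have "continuous_on ({0..1} \<times> ?S) (\<lambda>p. snd p i)"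
        by (rule continuous_on_compose2[OF continuous_on_product_coordinates[of i] continuous_on_snd[OF continuous_on_id]]) simp
      then show "continuous_on ({0..1} \<times> ?S) (\<lambda>p. (1 - fst p) * snd p i)" by (intro continuous_intros)
    qed
    show "(\<lambda>p i. (1 - fst p) * snd p i) ` ({0..1} \<times> ?S) \<subseteq> ?B" using ball by auto
  qed
  moreover have "h ` ({0..1} \<times> ?S) \<subseteq> ?S" using ball r(2) unfolding h_def by auto
  moreover have "h (0, x) = id x" if "x \<in> ?S" for x using id[OF that] unfolding h_def by simp
  moreover have "h (1, x) = r (\<lambda>_. 0)" for x unfolding h_def by simp
  ultimately have "homotopic_with (\<lambda>x. True) (top_of_set ?S) (top_of_set ?S) id (\<lambda>_. r (\<lambda>_. 0))"
    by (subst homotopic_with)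
       (auto intro!: exI[of _ h] simp: continuous_map_in_subtopology prod_topology_subtopology_eu image_subset_iff_funcset)
  then have "contractible_space (nsphere m)" unfolding contractible_space_def nsphere_eq by blast
  then show False using non_contractible_space_nsphere by blast
qed

text \<open>
  The choices of one vertex in each of n antipodal pairs span a cross-polytope, whose boundary is an
  (n-1)-sphere.  Labelling all vertices by pairs in a way that no simplex contains both labels of a pair
  retracts the complex onto this sphere, up to normalization.  Were the inclusion of the sphere
  to extend over the ball, the ball would retract onto the sphere.
\<close>

lemma not_k_connected_if_cross_polytope:
  fixes vp vm :: "nat \<Rightarrow> 'a" and idx :: "'a \<Rightarrow> nat"
  assumes K: "simplicial_complex K" and n: "0 < n"
    and vp: "\<And>i. i < n \<Longrightarrow> idx (vp i) = i" "\<And>i. i < n \<Longrightarrow> pos (vp i)"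
    and vm: "\<And>i. i < n \<Longrightarrow> idx (vm i) = i" "\<And>i. i < n \<Longrightarrow> \<not> pos (vm i)"
    and face: "\<And>s. (\<lambda>i. if i \<in> s then vp i else vm i) ` {..<n} \<in> K"
    and idx: "\<And>v. v \<in> \<Union>K \<Longrightarrow> idx v < n"
    and sign: "\<And>\<sigma> u v. \<sigma> \<in> K \<Longrightarrow> u \<in> \<sigma> \<Longrightarrow> v \<in> \<sigma> \<Longrightarrow> idx u = idx v \<Longrightarrow> pos u = pos v"
  shows "\<not> k_connected (int n - 1) (geometric_realization K)"
proof
  assume con: "k_connected (int n - 1) (geometric_realization K)"
  define V where "V = \<Union>K"
  have finV: "finite V" using K unfolding simplicial_complex_def V_def by blast
  \<comment> \<open>the radial projection of the Euclidean sphere to the boundary of the cross-polytope: positive parts at vp, negative parts at vm\<close>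
  define w where "w y v = (if idx v < n \<and> v = vp (idx v) then max 0 (y (idx v))
      else if idx v < n \<and> v = vm (idx v) then max 0 (- y (idx v)) else (0::real))" for y v
  define N where "N y = (\<Sum>i<n. \<bar>y i\<bar>)" for y :: "nat \<Rightarrow> real"
  define f where "f y v = w y v / N y" for y v
  \<comment> \<open>the simplicial map to the cross-polytope given by the labels, in Cartesian coordinates\<close>
  define z where "z x i = (if i < n then \<Sum>v\<in>{v\<in>V. idx v = i}. if pos v then x v else - x v else (0::real))" for x i
  define s where "s x = sqrt (\<Sum>j<n. z x j ^ 2)" for x
  define \<rho> where "\<rho> x i = z x i / s x" for x i
  have pm: "vm i \<noteq> vp i" if "i < n" for i using vp(2)[OF that] vm(2)[OF that] by metis
  have wp: "w y (vp i) = max 0 (y i)" and wm: "w y (vm i) = max 0 (- y i)" if "i < n" for y i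
    unfolding w_def vp(1)[OF that] vm(1)[OF that] using that pm[OF that] by simp_all
  have Npos: "0 < N y" if "y \<in> unit_sphere n" for y
  proof (rule ccontr)
    assume "\<not> 0 < N y"
    moreover have "0 \<le> N y" unfolding N_def by (intro sum_nonneg) simp
    ultimately have "N y = 0" by simp
    then have "\<forall>i\<in>{..<n}. \<bar>y i\<bar> = 0" unfolding N_def by (subst (asm) sum_nonneg_eq_0_iff) simp_all
    then have "(\<Sum>i<n. y i ^ 2) = 0" by simp
    then show False using that unfolding unit_sphere_def by simp
  qed
  have fK: "f y \<in> realize K" if y: "y \<in> unit_sphere n" for y
  proof (rule realizeI)
    let ?W = "vp ` {..<n} \<union> vm ` {..<n}"
    show "finite ?W" by simp
    show "0 \<le> f y v" for v unfolding f_def w_def using Npos[OF y] by simp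
    show "(\<lambda>i. if i \<in> {i. 0 < y i} then vp i else vm i) ` {..<n} \<in> K" by (rule face)
    show "simplicial_complex K" by (rule K)
    show "v \<in> (\<lambda>i. if i \<in> {i. 0 < y i} then vp i else vm i) ` {..<n}" if "f y v \<noteq> 0" for v
    proof -
      have "w y v \<noteq> 0" using that unfolding f_def by auto
      then show ?thesis unfolding w_def by (intro image_eqI[of _ _ "idx v"]) (auto split: if_splits)
    qed
    show "f y v = 0" if "v \<notin> ?W" for v using that unfolding f_def w_def by auto
    have ip: "inj_on vp {..<n}" and im: "inj_on vm {..<n}"
      using vp(1) vm(1) by (metis inj_onI lessThan_iff)+
    have dj: "vp ` {..<n} \<inter> vm ` {..<n} = {}" using vp(2) vm(2) by fastforce
    have "sum (w y) ?W = sum (w y) (vp ` {..<n}) + sum (w y) (vm ` {..<n})"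
      by (rule sum.union_disjoint[OF _ _ dj]) simp_all
    also have "\<dots> = (\<Sum>i<n. w y (vp i)) + (\<Sum>i<n. w y (vm i))"
      by (simp add: sum.reindex[OF ip] sum.reindex[OF im])
    also have "\<dots> = (\<Sum>i<n. max 0 (y i) + max 0 (- y i))" using wp wm by (simp add: sum.distrib)
    also have "\<dots> = N y" unfolding N_def by (intro sum.cong) auto
    finally have "sum (w y) ?W = N y" .
    then show "sum (f y) ?W = 1" unfolding f_def sum_divide_distrib[symmetric] using Npos[OF y] by simp
  qed
  have zf: "z (f y) i = y i / N y" if y: "y \<in> unit_sphere n" for y i
  proof (cases "i < n")
    case True
    have "vp i \<in> (\<lambda>i. if i \<in> UNIV then vp i else vm i) ` {..<n}" "vm i \<in> (\<lambda>i. if i \<in> {} then vp i else vm i) ` {..<n}"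
      using True by auto
    then have V: "vp i \<in> V" "vm i \<in> V" unfolding V_def using face[of UNIV] face[of "{}"] by blast+
    have "z (f y) i = (\<Sum>v\<in>{v\<in>V. idx v = i}. if pos v then f y v else - f y v)" unfolding z_def using True by simp
    also have "\<dots> = (\<Sum>v\<in>{vp i, vm i}. if pos v then f y v else - f y v)"
      by (rule sum.mono_neutral_right) (use finV V vp(1)[OF True] vm(1)[OF True] in \<open>auto simp: f_def w_def\<close>)
    also have "\<dots> = f y (vp i) - f y (vm i)" using pm[OF True] vp(2)[OF True] vm(2)[OF True] by (simp add: eq_commute)
    also have "\<dots> = y i / N y" unfolding f_def wp[OF True] wm[OF True] by (auto simp: max_def diff_divide_distrib[symmetric])
    finally show ?thesis .
  next
    case False
    then show ?thesis using y unfolding z_def unit_sphere_def by simp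
  qed
  have spos: "0 < s x" if x: "x \<in> realize K" for x
  proof -
    have "\<exists>v. x v \<noteq> 0"
    proof (rule ccontr)
      assume "\<not> (\<exists>v. x v \<noteq> 0)"
      then have "{v. x v \<noteq> 0} = {}" by simp
      moreover have "(\<Sum>v | x v \<noteq> 0. x v) = 1" using x unfolding realize_def by blast
      ultimately show False by (metis sum.empty zero_neq_one)
    qed
    then obtain v where v: "x v \<noteq> 0" by blast
    have vV: "v \<in> V" using realize_vertices[OF x v] unfolding V_def .
    define i where "i = idx v"
    have i: "i < n" unfolding i_def using idx vV unfolding V_def by simp
    have same: "(if pos u then x u else - x u) = (if pos v then 1 else - 1) * x u" if "u \<in> V" "idx u = i" for u
    proof (cases "x u = 0")
      case False
      have "pos u = pos v"
        by (rule sign[OF realizeD(2)[OF x]]) (use False v that in \<open>simp_all add: i_def\<close>)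
      then show ?thesis by simp
    qed simp
    have "z x i = (if pos v then 1 else - 1) * (\<Sum>u\<in>{u\<in>V. idx u = i}. x u)"
      unfolding z_def sum_distrib_left if_P[OF i] by (intro sum.cong refl, rule same) simp_all
    moreover have "x v \<le> (\<Sum>u\<in>{u\<in>V. idx u = i}. x u)"
      by (rule member_le_sum) (use vV finV realizeD(1)[OF x] in \<open>simp_all add: i_def\<close>)
    moreover have "0 < x v" using realizeD(1)[OF x, of v] v by simp
    ultimately have "z x i \<noteq> 0" by auto
    then have "0 < z x i ^ 2" by simp
    also have "z x i ^ 2 \<le> (\<Sum>j<n. z x j ^ 2)" by (rule member_le_sum) (use i in simp_all)
    finally show ?thesis unfolding s_def by simp
  qed
  have \<rho>S: "\<rho> x \<in> unit_sphere n" if x: "x \<in> realize K" for x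
  proof -
    have eq: "(\<Sum>i<n. \<rho> x i ^ 2) = (\<Sum>i<n. z x i ^ 2) / s x ^ 2"
      unfolding \<rho>_def by (simp add: power_divide sum_divide_distrib)
    have sq: "s x ^ 2 = (\<Sum>i<n. z x i ^ 2)" unfolding s_def by (simp add: sum_nonneg)
    have "(\<Sum>i<n. \<rho> x i ^ 2) = 1" unfolding eq sq[symmetric] using spos[OF x] by simp
    then show ?thesis unfolding unit_sphere_def \<rho>_def z_def by simp
  qed
  have \<rho>f: "\<rho> (f y) = y" if y: "y \<in> unit_sphere n" for y
  proof
    fix i
    have "(\<Sum>j<n. z (f y) j ^ 2) = (\<Sum>j<n. y j ^ 2) / N y ^ 2"
      unfolding zf[OF y] by (simp add: power_divide sum_divide_distrib)
    then have "s (f y) = 1 / N y" using y Npos[OF y] unfolding s_def unit_sphere_def by (simp add: real_sqrt_divide)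
    then show "\<rho> (f y) i = y i" unfolding \<rho>_def zf[OF y] using Npos[OF y] by simp
  qed
  have coord: "continuous_on S (\<lambda>y. y i)" for S :: "('b \<Rightarrow> real) set" and i
    by (rule continuous_on_subset[OF continuous_on_product_coordinates]) simp
  have constant_case: "continuous_on S (\<lambda>y. if P then p y else q y)"
    if "continuous_on S p" "continuous_on S q" for S :: "('b \<Rightarrow> real) set" and P and p q :: "('b \<Rightarrow> real) \<Rightarrow> real"
    using that by (cases P) simp_all
  have cN: "continuous_on S N" for S unfolding N_def by (intro continuous_intros coord)
  have cf: "continuous_on (unit_sphere n) f"
  proof (rule continuous_on_coordinatewise_then_product)
    fix v
    have "continuous_on (unit_sphere n) (\<lambda>y. w y v)"
      unfolding w_def
      by (intro constant_case continuous_on_max continuous_on_minus continuous_on_const coord)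
    then show "continuous_on (unit_sphere n) (\<lambda>y. f y v)"
      unfolding f_def by (rule continuous_on_divide[OF _ cN]) (use Npos in fastforce)
  qed
  have cz: "continuous_on S (\<lambda>x. z x i)" for S i
  proof -
    have "continuous_on S (\<lambda>x. if pos v then x v else - x v)" for v
      by (intro constant_case continuous_on_minus coord)
    then show ?thesis unfolding z_def by (cases "i < n") (simp_all add: continuous_on_sum)
  qed
  have c\<rho>: "continuous_on (realize K) \<rho>"
  proof (rule continuous_on_coordinatewise_then_product)
    fix i
    have "continuous_on (realize K) s" unfolding s_def by (intro continuous_intros cz)
    then show "continuous_on (realize K) (\<lambda>x. \<rho> x i)"
      unfolding \<rho>_def by (rule continuous_on_divide[OF cz]) (use spos in fastforce)
  qed
  have "k_connected (int (Suc n) - 2) (geometric_realization K)" using con by simp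
  from this[unfolded k_connected_iff_ball, rule_format, of n f] n cf image_subsetI[of "unit_sphere n" f, OF fK]
  obtain g where g: "continuous_on (unit_ball n) g" "g ` unit_ball n \<subseteq> realize K"
    "\<And>x. x \<in> unit_sphere n \<Longrightarrow> g x = f x"
    by auto
  obtain m where m: "n = Suc m" using n by (cases n) auto
  show False
  proof (rule no_retraction_of_ball)
    show "continuous_on (unit_ball (Suc m)) (\<lambda>x. \<rho> (g x))"
      using continuous_on_compose2[OF c\<rho> g(1,2)] unfolding m .
    show "(\<lambda>x. \<rho> (g x)) ` unit_ball (Suc m) \<subseteq> unit_sphere (Suc m)"
      using g(2) \<rho>S unfolding m by blast
    show "\<rho> (g x) = x" if "x \<in> unit_sphere (Suc m)" for x
      using g(3) \<rho>f that unfolding m by simp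
  qed
qed

section \<open>From graphs to matching complexes\<close>

lemma k_connected_mono: "k_connected k X \<Longrightarrow> j \<le> k \<Longrightarrow> k_connected j X"
  unfolding k_connected_def by simp

lemma conn_eqI:
  assumes "topspace X \<noteq> {}" "1 \<le> n" "k_connected (int n - 2) X" "\<not> k_connected (int n - 1) X"
  shows "conn X = ereal (real n - 2)"
proof -
  have "(GREATEST k. - 1 \<le> k \<and> k_connected k X) = int n - 2"
  proof (rule Greatest_equality)
    show "- 1 \<le> int n - 2 \<and> k_connected (int n - 2) X" using assms(2,3) by simp
    fix k assume "- 1 \<le> k \<and> k_connected k X"
    then show "k \<le> int n - 2" using k_connected_mono[of k X "int n - 1"] assms(4) by force
  qed
  moreover have "\<not> (\<forall>k\<ge>- 1. k_connected k X)" using assms(2,4) by (auto intro!: exI[of _ "int n - 1"])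
  ultimately show ?thesis using assms(1) unfolding conn_def by simp
qed

text \<open>
  Since conn is infinite or an integer, the value m / 2 - 2 forces m to be even.
\<close>

lemma conn_eqD:
  assumes "conn X = ereal (real m / 2 - 2)" "0 < m"
  obtains n where "m = 2 * n" "\<not> k_connected (int n - 1) X"
proof -
  have ne: "topspace X \<noteq> {}"
  proof
    assume "topspace X = {}"
    then have "ereal (real m / 2 - 2) = - 2" using assms(1) unfolding conn_def by simp
    then have "ereal (real m / 2 - 2) = ereal (- 2)" by simp
    then have "real m / 2 - 2 = - 2" by (simp only: ereal.inject)
    then show False using assms(2) by simp
  qed
  have bd: "\<not> (\<forall>k\<ge>- 1. k_connected k X)"
  proof
    assume all: "\<forall>k\<ge>- 1. k_connected k X"
    have "conn X = \<infinity>" unfolding conn_def if_not_P[OF ne] if_P[OF all] ..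
    then show False using assms(1) by simp
  qed
  define g where "g = (GREATEST k. - 1 \<le> k \<and> k_connected k X)"
  have "ereal (of_int g) = ereal (real m / 2 - 2)"
    using assms(1) unfolding conn_def if_not_P[OF ne] if_not_P[OF bd] g_def .
  then have "real_of_int g = real m / 2 - 2" by (simp only: ereal.inject)
  then have "real_of_int (int m) = real_of_int (2 * (g + 2))" by simp
  then have mg: "int m = 2 * (g + 2)" by (simp only: of_int_eq_iff)
  define n where "n = nat (g + 2)"
  have n: "int n = g + 2" unfolding n_def using mg by simp
  have "\<not> k_connected (int n - 1) X"
  proof
    assume c: "k_connected (int n - 1) X"
    obtain k where k: "- 1 \<le> k" "\<not> k_connected k X" using bd by blast
    let ?S = "{j. - 1 \<le> j \<and> k_connected j X}"
    have "?S \<subseteq> {- 1..k}"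
    proof
      fix j assume "j \<in> ?S"
      then have j: "- 1 \<le> j" "k_connected j X" by simp_all
      have "\<not> k \<le> j" using k_connected_mono[OF j(2)] k(2) by blast
      then show "j \<in> {- 1..k}" using j(1) by simp
    qed
    then have fin: "finite ?S" by (rule finite_subset) simp
    have inS: "int n - 1 \<in> ?S" using c by simp
    have "Max ?S \<in> ?S" by (rule Max_in[OF fin]) (use inS in blast)
    then have "g = Max ?S" unfolding g_def by (intro Greatest_equality) (auto intro: Max_ge[OF fin])
    then have "int n - 1 \<le> g" using Max_ge[OF fin inS] by simp
    then show False using n by simp
  qed
  moreover have "int m = int (2 * n)" using mg n by simp
  then have "m = 2 * n" by (simp only: of_nat_eq_iff)
  ultimately show ?thesis using that by blast
qed

lemma C4_not_P4:
  assumes "is_C4 H" shows "\<not> is_P4 H"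
proof
  assume "is_P4 H"
  then obtain e1 e2 e3 where "edges H = {e1, e2, e3}" unfolding is_P4_def by blast
  then have "card (edges H) \<le> 3" using card_length[of "[e1, e2, e3]"] by simp
  moreover obtain a b c d f1 f2 f3 f4 where H: "distinct [a, b, c, d]" "edges H = {f1, f2, f3, f4}"
    "ends H f1 = {a, b}" "ends H f2 = {b, c}" "ends H f3 = {c, d}" "ends H f4 = {d, a}"
    using assms unfolding is_C4_def by blast
  have "distinct [f1, f2, f3, f4]" using H(1,3-6) by (auto simp: doubleton_eq_iff)
  then have "card (edges H) = 4" unfolding H(2) by simp
  ultimately show False by simp
qed

lemma interior_verts_P4:
  assumes "distinct [p, q, s, t]" "verts H = {p, q, s, t}" "edges H = {e1, e2, e3}"
    "ends H e1 = {p, q}" "ends H e2 = {q, s}" "ends H e3 = {s, t}"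
  shows "interior_verts H = {q, s}"
proof -
  have d: "e1 \<noteq> e2" "e2 \<noteq> e3" using assms(1,4-6) by (auto simp: doubleton_eq_iff)
  have "{e \<in> edges H. incident H e p} = {e1}" "{e \<in> edges H. incident H e q} = {e1, e2}"
    "{e \<in> edges H. incident H e s} = {e2, e3}" "{e \<in> edges H. incident H e t} = {e3}"
    using assms(1,3-6) unfolding incident_def by auto
  then have "Defs.degree H p = 1" "Defs.degree H q = 2" "Defs.degree H s = 2" "Defs.degree H t = 1"
    unfolding Defs.degree_def using d by simp_all
  then show ?thesis unfolding interior_verts_def assms(2) by auto
qed

definition covered_by :: "('v, 'e) multigraph \<Rightarrow> ('v, 'e) multigraph \<Rightarrow> 'e \<Rightarrow> bool" where
  "covered_by G H e \<longleftrightarrow> is_C4 H \<and> (\<exists>f\<in>edges H. parallel G e f) \<or>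
     is_P4 H \<and> (\<exists>v\<in>interior_verts H. incident G e v)"

lemma subgraphD:
  assumes "subgraph H G"
  shows "ends H = ends G" "edges H \<subseteq> edges G"
    and "\<And>e. e \<in> edges H \<Longrightarrow> ends G e \<subseteq> verts H" "\<And>e. e \<in> edges H \<Longrightarrow> card (ends G e) = 2"
proof -
  show eq: "ends H = ends G" and "edges H \<subseteq> edges G" using assms unfolding subgraph_def by simp_all
  have "\<forall>e\<in>edges H. ends H e \<subseteq> verts H \<and> card (ends H e) = 2"
    using assms unfolding subgraph_def finite_multigraph_def by blast
  then show "\<And>e. e \<in> edges H \<Longrightarrow> ends G e \<subseteq> verts H" "\<And>e. e \<in> edges H \<Longrightarrow> card (ends G e) = 2"
    unfolding eq by simp_all
qed

lemma covered_by_meets: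
  assumes "subgraph H G" "covered_by G H e"
  shows "ends G e \<inter> verts H \<noteq> {}"
proof -
  have C4: "ends G e \<inter> verts H \<noteq> {}" if "f \<in> edges H" "parallel G e f" for f
  proof -
    have "ends G f \<subseteq> verts H" "card (ends G f) = 2" by (rule subgraphD(3,4)[OF assms(1) that(1)])+
    then have "ends G f \<inter> verts H = ends G f" "ends G f \<noteq> {}" by (simp_all add: Int_absorb2) auto
    then show ?thesis using that(2) unfolding parallel_def by simp
  qed
  have P4: "ends G e \<inter> verts H \<noteq> {}" if "v \<in> interior_verts H" "incident G e v" for v
    using that unfolding interior_verts_def incident_def by (intro notI) (simp add: disjoint_iff)
  from assms(2)[unfolded covered_by_def] show ?thesis
  proof (elim disjE conjE bexE)
    fix f assume "f \<in> edges H" "parallel G e f"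
    then show ?thesis by (rule C4)
  next
    fix v assume "v \<in> interior_verts H" "incident G e v"
    then show ?thesis by (rule P4)
  qed
qed

text \<open>
  The sign of a covered edge: in a four-cycle the two pairs of opposite edges, in a path the middle edge
  against all the other edges at interior vertices.  Edges of opposite sign always meet.
\<close>

lemma piece_signs:
  assumes H: "subgraph H G" and piece: "is_C4 H \<or> is_P4 H"
  shows "\<exists>p m S. p \<in> edges H \<and> m \<in> edges H \<and> S p \<and> \<not> S m \<and>
    (\<forall>e f. covered_by G H e \<longrightarrow> covered_by G H f \<longrightarrow> S e \<longrightarrow> \<not> S f \<longrightarrow> ends G e \<inter> ends G f \<noteq> {})"
  using piece
proof
  assume C: "is_C4 H"
  then obtain a b c d e1 e2 e3 e4 where *: "distinct [a, b, c, d]" "edges H = {e1, e2, e3, e4}"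
    "ends H e1 = {a, b}" "ends H e2 = {b, c}" "ends H e3 = {c, d}" "ends H e4 = {d, a}"
    unfolding is_C4_def by blast
  have e: "ends G = ends H" by (rule subgraphD(1)[OF H, symmetric])
  have cov: "ends G e \<in> {{a, b}, {b, c}, {c, d}, {d, a}}" if "covered_by G H e" for e
    using that C4_not_P4[OF C] *(2-6) unfolding covered_by_def parallel_def e by auto
  show ?thesis
  proof (intro exI conjI allI impI)
    show "e1 \<in> edges H" "e2 \<in> edges H" using *(2) by simp_all
    show "ends G e1 \<in> {{a, b}, {c, d}}" "\<not> ends G e2 \<in> {{a, b}, {c, d}}"
      using * unfolding e by (auto simp: doubleton_eq_iff)
    fix f g assume "covered_by G H f" "covered_by G H g"
      and "ends G f \<in> {{a, b}, {c, d}}" "\<not> ends G g \<in> {{a, b}, {c, d}}"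
    then show "ends G f \<inter> ends G g \<noteq> {}" using cov[of g] by auto
  qed
next
  assume P: "is_P4 H"
  then obtain a b c d e1 e2 e3 where *: "distinct [a, b, c, d]" "verts H = {a, b, c, d}"
    "edges H = {e1, e2, e3}" "ends H e1 = {a, b}" "ends H e2 = {b, c}" "ends H e3 = {c, d}"
    unfolding is_P4_def by blast
  have e: "ends G = ends H" by (rule subgraphD(1)[OF H, symmetric])
  have cov: "b \<in> ends G e \<or> c \<in> ends G e" if "covered_by G H e" for e
    using that C4_not_P4 P unfolding covered_by_def interior_verts_P4[OF *] incident_def by auto
  show ?thesis
  proof (intro exI conjI allI impI)
    show "e1 \<in> edges H" "e2 \<in> edges H" using *(3) by simp_all
    show "ends G e1 \<noteq> {b, c}" "\<not> ends G e2 \<noteq> {b, c}"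
      using * unfolding e by (auto simp: doubleton_eq_iff)
    fix f g assume "covered_by G H f" "covered_by G H g" "ends G f \<noteq> {b, c}" "\<not> ends G g \<noteq> {b, c}"
    then show "ends G f \<inter> ends G g \<noteq> {}" using cov[of f] by auto
  qed
qed

text \<open>
  A bipartite graph with chosen left and right ends of its edges and with its vertices numbered.  This is what
  is needed to pass to the encoding by two end maps.
\<close>

locale sided_graph =
  fixes G :: "('v, 'e) multigraph" and l r :: "'e \<Rightarrow> 'v" and h :: "'v \<Rightarrow> nat"
  assumes fin: "finite_multigraph G"
    and ends: "e \<in> edges G \<Longrightarrow> ends G e = {l e, r e}"
    and sides: "e \<in> edges G \<Longrightarrow> f \<in> edges G \<Longrightarrow> l e \<noteq> r f"
    and h: "inj_on h (verts G)"
begin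

abbreviation a :: "'e \<Rightarrow> nat" where "a e \<equiv> h (l e)"
abbreviation b :: "'e \<Rightarrow> nat" where "b e \<equiv> h (r e)"

lemma fin_edges: "finite (edges G)"
  using fin unfolding finite_multigraph_def by blast

lemma verts: assumes "e \<in> edges G" shows "l e \<in> verts G" "r e \<in> verts G"
  using fin ends[OF assms] assms unfolding finite_multigraph_def by auto

lemma same_left: assumes "e \<in> edges G" "f \<in> edges G" shows "a e = a f \<longleftrightarrow> l e = l f"
  using inj_on_eq_iff[OF h verts(1)[OF assms(1)] verts(1)[OF assms(2)]] .

lemma same_right: assumes "e \<in> edges G" "f \<in> edges G" shows "b e = b f \<longleftrightarrow> r e = r f"
  using inj_on_eq_iff[OF h verts(2)[OF assms(1)] verts(2)[OF assms(2)]] .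

lemma meet_iff:
  assumes "e \<in> edges G" "f \<in> edges G"
  shows "ends G e \<inter> ends G f \<noteq> {} \<longleftrightarrow> a e = a f \<or> b e = b f"
  unfolding same_left[OF assms] same_right[OF assms] ends[OF assms(1)] ends[OF assms(2)]
  using sides[OF assms] sides[OF assms(2,1)] by auto

lemma matchings_iff:
  "I \<in> matchings (edges G) a b \<longleftrightarrow>
    I \<subseteq> edges G \<and> (\<forall>e\<in>I. \<forall>f\<in>I. e \<noteq> f \<longrightarrow> ends G e \<inter> ends G f = {})"
proof (cases "I \<subseteq> edges G")
  case True
  then have "(\<forall>e\<in>I. \<forall>f\<in>I. e \<noteq> f \<longrightarrow> ends G e \<inter> ends G f = {}) \<longleftrightarrow>
      (\<forall>e\<in>I. \<forall>f\<in>I. e \<noteq> f \<longrightarrow> \<not> (a e = a f \<or> b e = b f))"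
    using meet_iff by (metis subsetD)
  then show ?thesis using True unfolding matchings_def inj_on_def by blast
next
  case False
  then show ?thesis unfolding matchings_def by blast
qed

lemma independence_complex_line_graph:
  "independence_complex (line_graph G) = matchings (edges G) a b"
proof -
  have "independent_set (line_graph G) I \<longleftrightarrow> I \<in> matchings (edges G) a b" for I
  proof -
    let ?L = "line_graph G"
    have L: "verts ?L = edges G" "\<And>p. ends ?L p = p"
      "edges ?L = {{e, f} | e f. e \<in> edges G \<and> f \<in> edges G \<and> e \<noteq> f \<and> ends G e \<inter> ends G f \<noteq> {}}"
      unfolding line_graph_def by simp_all
    show ?thesis
      unfolding matchings_iff independent_set_def L(1,2)
    proof (intro conj_cong refl iffI ballI impI notI)
      fix e f assume I: "I \<subseteq> edges G" "\<forall>p\<in>edges ?L. \<not> p \<subseteq> I" and ef: "e \<in> I" "f \<in> I" "e \<noteq> f"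
      show "ends G e \<inter> ends G f = {}"
      proof (rule ccontr)
        assume "ends G e \<inter> ends G f \<noteq> {}"
        then have "{e, f} \<in> edges ?L" unfolding L(3) using subsetD[OF I(1)] ef by blast
        from bspec[OF I(2) this] show False using ef(1,2) by simp
      qed
    next
      fix p assume I: "\<forall>e\<in>I. \<forall>f\<in>I. e \<noteq> f \<longrightarrow> ends G e \<inter> ends G f = {}" and p: "p \<in> edges ?L" "p \<subseteq> I"
      obtain e f where "p = {e, f}" "e \<noteq> f" "ends G e \<inter> ends G f \<noteq> {}" using p(1) unfolding L(3) by blast
      then show False using I p(2) by simp
    qed
  qed
  then show ?thesis unfolding independence_complex_def by blast
qed

lemma matching_number_eq: "matching_number G = nu (edges G) a b"
proof -
  have "is_matching G M \<longleftrightarrow> M \<in> matchings (edges G) a b" for M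
    unfolding matchings_iff is_matching_def disjoint_family_on_def by blast
  then show ?thesis unfolding matching_number_def nu_def by (simp add: setcompr_eq_image)
qed

text \<open>
  Label every edge by a piece that covers it and by its sign there.  Edges of a matching with the same piece have the same
  sign, and choosing from every piece an edge of either sign gives a matching, as pieces are disjoint.
\<close>

lemma not_k_connected_if_pieces:
  assumes \<C>: "finite \<C>" "\<C> \<noteq> {}"
    and piece: "\<And>H. H \<in> \<C> \<Longrightarrow> subgraph H G" "\<And>H. H \<in> \<C> \<Longrightarrow> is_C4 H \<or> is_P4 H"
    and disj: "disjoint_family_on verts \<C>"
    and cover: "\<And>e. e \<in> edges G \<Longrightarrow> \<exists>H\<in>\<C>. covered_by G H e"
  shows "\<not> k_connected (int (card \<C>) - 1) (geometric_realization (matchings (edges G) a b))"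
proof -
  let ?n = "card \<C>"
  obtain c where c: "bij_betw c {..<?n} \<C>"
    using ex_bij_betw_nat_finite[OF \<C>(1)] unfolding atLeast0LessThan by blast
  have c\<C>: "c i \<in> \<C>" if "i < ?n" for i using bij_betwE[OF c] that by blast
  have "\<exists>t. fst t \<in> edges (c i) \<and> fst (snd t) \<in> edges (c i) \<and> snd (snd t) (fst t) \<and> \<not> snd (snd t) (fst (snd t)) \<and>
    (\<forall>e f. covered_by G (c i) e \<longrightarrow> covered_by G (c i) f \<longrightarrow> snd (snd t) e \<longrightarrow> \<not> snd (snd t) f \<longrightarrow> ends G e \<inter> ends G f \<noteq> {})"
    (is "\<exists>t. ?\<Phi> i t") if "i < ?n" for i
  proof -
    from piece_signs[OF piece(1)[OF c\<C>[OF that]] piece(2)[OF c\<C>[OF that]]]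
    obtain p m S where "?\<Phi> i (p, m, S)" unfolding fst_conv snd_conv by (elim exE)
    then show ?thesis by (rule exI)
  qed
  then have "\<forall>i\<in>{..<?n}. \<exists>t. ?\<Phi> i t" by simp
  from bchoice[OF this] obtain t where t: "\<forall>i\<in>{..<?n}. ?\<Phi> i (t i)" by (elim exE)
  define vp vm S where "vp i = fst (t i)" and "vm i = fst (snd (t i))" and "S i = snd (snd (t i))" for i
  have vp: "vp i \<in> edges (c i)" and vm: "vm i \<in> edges (c i)" and Sp: "S i (vp i)" and Sm: "\<not> S i (vm i)"
    and meet: "\<And>e f. covered_by G (c i) e \<Longrightarrow> covered_by G (c i) f \<Longrightarrow> S i e \<Longrightarrow> \<not> S i f \<Longrightarrow> ends G e \<inter> ends G f \<noteq> {}"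
    if "i < ?n" for i
    using bspec[OF t, of i] that unfolding vp_def vm_def S_def by simp_all
  have sub: "edges (c i) \<subseteq> edges G" "\<And>e. e \<in> edges (c i) \<Longrightarrow> ends G e \<subseteq> verts (c i)" if "i < ?n" for i
    using subgraphD[OF piece(1)[OF c\<C>[OF that]]] by auto
  have dj: "verts (c i) \<inter> verts (c j) = {}" if "i < ?n" "j < ?n" "i \<noteq> j" for i j
  proof -
    have "c i \<noteq> c j" using c that unfolding bij_betw_def inj_on_def by blast
    then show ?thesis using disj c\<C>[OF that(1)] c\<C>[OF that(2)] unfolding disjoint_family_on_def by blast
  qed
  have "\<exists>i<?n. covered_by G (c i) e" if e: "e \<in> edges G" for e
  proof -
    obtain H where "H \<in> \<C>" "covered_by G H e" using cover[OF e] by blast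
    then have "H \<in> c ` {..<?n}" unfolding bij_betw_imp_surj_on[OF c] by simp
    then obtain i where "i < ?n" "H = c i" by auto
    then show ?thesis using \<open>covered_by G H e\<close> by blast
  qed
  then have "\<forall>e\<in>edges G. \<exists>i. i < ?n \<and> covered_by G (c i) e" by simp
  from bchoice[OF this] obtain idx where "\<forall>e\<in>edges G. idx e < ?n \<and> covered_by G (c (idx e)) e"
    by (elim exE)
  then have idx: "\<And>e. e \<in> edges G \<Longrightarrow> idx e < ?n" "\<And>e. e \<in> edges G \<Longrightarrow> covered_by G (c (idx e)) e"
    by simp_all
  \<comment> \<open>covering edges meet their piece, so an edge inside one piece is covered by no other\<close>
  have own: "idx e = i" if "i < ?n" "e \<in> edges (c i)" for i e
  proof (rule ccontr)
    assume ne: "idx e \<noteq> i"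
    have e: "e \<in> edges G" by (rule subsetD[OF sub(1)[OF that(1)] that(2)])
    have "ends G e \<inter> verts (c (idx e)) \<noteq> {}"
      by (rule covered_by_meets[OF piece(1)[OF c\<C>[OF idx(1)[OF e]]] idx(2)[OF e]])
    then show False
      using Int_mono[OF sub(2)[OF that] order_refl[of "verts (c (idx e))"]] dj[OF that(1) idx(1)[OF e] ne[symmetric]] by simp
  qed
  show ?thesis
  proof (rule not_k_connected_if_cross_polytope[where idx = idx and pos = "\<lambda>e. S (idx e) e" and vp = vp and vm = vm])
    show "simplicial_complex (matchings (edges G) a b)" by (rule simplicial_complex_matchings[OF fin_edges])
    show "0 < ?n" using \<C> by (simp add: card_gt_0_iff)
    show "idx (vp i) = i" "idx (vm i) = i" if "i < ?n" for i
      using own[OF that vp[OF that]] own[OF that vm[OF that]] by simp_all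
    then show "S (idx (vp i)) (vp i)" "\<not> S (idx (vm i)) (vm i)" if "i < ?n" for i
      using Sp[OF that] Sm[OF that] that by simp_all
    show "(\<lambda>i. if i \<in> s then vp i else vm i) ` {..<?n} \<in> matchings (edges G) a b" for s
    proof -
      let ?v = "\<lambda>i. if i \<in> s then vp i else vm i"
      have v: "?v i \<in> edges (c i)" if "i < ?n" for i using vp vm that by simp
      have dis: "ends G (?v i) \<inter> ends G (?v j) = {}" if "i < ?n" "j < ?n" "?v i \<noteq> ?v j" for i j
      proof -
        have "i \<noteq> j" using that(3) by metis
        from Int_mono[OF sub(2)[OF that(1) v[OF that(1)]] sub(2)[OF that(2) v[OF that(2)]]]
        show ?thesis unfolding dj[OF that(1,2) \<open>i \<noteq> j\<close>] by simp
      qed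
      have "?v i \<in> edges G" if "i < ?n" for i by (rule subsetD[OF sub(1)[OF that] v[OF that]])
      then have "?v ` {..<?n} \<subseteq> edges G" by (intro image_subsetI) simp
      moreover have "ends G e \<inter> ends G f = {}" if ef: "e \<in> ?v ` {..<?n}" "f \<in> ?v ` {..<?n}" "e \<noteq> f" for e f
      proof -
        obtain i where i: "i \<in> {..<?n}" "e = ?v i" using ef(1) by (elim imageE)
        obtain j where j: "j \<in> {..<?n}" "f = ?v j" using ef(2) by (elim imageE)
        show ?thesis
          unfolding i(2) j(2) by (rule dis[OF i(1)[unfolded lessThan_iff] j(1)[unfolded lessThan_iff] ef(3)[unfolded i(2) j(2)]])
      qed
      ultimately show ?thesis unfolding matchings_iff by blast
    qed
    show "idx e < ?n" if "e \<in> \<Union>(matchings (edges G) a b)" for e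
    proof -
      from that obtain I where I: "I \<in> matchings (edges G) a b" "e \<in> I" by (elim UnionE)
      show ?thesis by (rule idx(1)[OF subsetD[OF matchingsD(1)[OF I(1)] I(2)]])
    qed
    show "S (idx e) e = S (idx f) f" if \<sigma>: "\<sigma> \<in> matchings (edges G) a b" "e \<in> \<sigma>" "f \<in> \<sigma>" and eq: "idx e = idx f" for \<sigma> e f
    proof (rule ccontr)
      assume ne: "S (idx e) e \<noteq> S (idx f) f"
      then have "e \<noteq> f" by (intro notI) simp
      have E: "e \<in> edges G" "f \<in> edges G" by (rule subsetD[OF matchingsD(1)[OF \<sigma>(1)]], rule \<sigma>)+
      have dis: "ends G e \<inter> ends G f = {}"
        using \<sigma>(1)[unfolded matchings_iff] \<sigma>(2,3) \<open>e \<noteq> f\<close> by simp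
      note cov = idx(2)[OF E(1)] idx(2)[OF E(2), folded eq]
      show False
      proof (cases "S (idx e) e")
        case True
        then have "\<not> S (idx e) f" using ne eq by simp
        from meet[OF idx(1)[OF E(1)] cov True this] show False using dis by simp
      next
        case False
        then have "S (idx e) f" using ne eq by simp
        from meet[OF idx(1)[OF E(1)] cov(2,1) this False] show False using dis by (simp add: Int_commute)
      qed
    qed
  qed
qed

text \<open>
  Disjointness of pieces is checked on the numbers of their left and right vertices.
\<close>

definition confined :: "('v, 'e) multigraph \<Rightarrow> nat set \<Rightarrow> nat set \<Rightarrow> bool" where
  "confined H X Y \<longleftrightarrow> (\<forall>v\<in>verts H. (\<exists>e\<in>edges G. v = l e \<and> a e \<in> X) \<or> (\<exists>e\<in>edges G. v = r e \<and> b e \<in> Y))"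

lemma confined_disjoint:
  assumes "confined H X Y" "confined H' X' Y'" "X \<inter> X' = {}" "Y \<inter> Y' = {}"
  shows "verts H \<inter> verts H' = {}"
proof (rule ccontr)
  assume "verts H \<inter> verts H' \<noteq> {}"
  then obtain v where v: "v \<in> verts H" "v \<in> verts H'" by blast
  from bspec[OF assms(1)[unfolded confined_def] v(1)] bspec[OF assms(2)[unfolded confined_def] v(2)]
  show False
  proof (elim disjE bexE conjE)
    fix e f assume ef: "e \<in> edges G" "f \<in> edges G" "v = l e" "v = l f" "a e \<in> X" "a f \<in> X'"
    then show False using assms(3) by (auto simp: disjoint_iff)
  next
    fix e f assume ef: "e \<in> edges G" "f \<in> edges G" "v = r e" "v = r f" "b e \<in> Y" "b f \<in> Y'"
    then show False using assms(4) by (auto simp: disjoint_iff)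
  next
    fix e f assume ef: "e \<in> edges G" "f \<in> edges G" "v = l e" "v = r f"
    then show False using sides[OF ef(1,2)] by simp
  next
    fix e f assume ef: "e \<in> edges G" "f \<in> edges G" "v = r e" "v = l f"
    then show False using sides[OF ef(2,1)] by simp
  qed
qed

lemma P4_piece:
  assumes E: "m \<in> edges G" "d \<in> edges G" "m' \<in> edges G"
    and eq: "a m = a d" "b m' = b d" and ne: "b m \<noteq> b d" "a m' \<noteq> a d"
  obtains H where "subgraph H G" "is_P4 H" "confined H {a d, a m'} {b d, b m}" "interior_verts H = {l d, r d}"
proof -
  have lr: "l m = l d" "r m' = r d" "r m \<noteq> r d" "l m' \<noteq> l d"
    using eq ne same_left[OF E(1,2)] same_right[OF E(3,2)] by auto
  let ?H = "\<lparr>verts = {r m, l d, r d, l m'}, edges = {m, d, m'}, ends = ends G\<rparr>"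
  have H: "distinct [r m, l d, r d, l m']" "verts ?H = {r m, l d, r d, l m'}" "edges ?H = {m, d, m'}"
    "ends ?H m = {r m, l d}" "ends ?H d = {l d, r d}" "ends ?H m' = {r d, l m'}"
    using lr sides[OF E(2,1)] sides[OF E(3,1)] sides[OF E(2,2)] sides[OF E(3,2)] ends[OF E(1)] ends[OF E(2)] ends[OF E(3)]
    by auto
  have 1: "subgraph ?H G"
    unfolding subgraph_def finite_multigraph_def
    using E verts[OF E(1)] verts[OF E(2)] verts[OF E(3)] lr ends[OF E(1)] ends[OF E(2)] ends[OF E(3)]
      sides[OF E(1,1)] sides[OF E(2,2)] sides[OF E(3,3)] by auto
  have 2: "is_P4 ?H" unfolding is_P4_def using H by blast
  have 3: "confined ?H {a d, a m'} {b d, b m}" unfolding confined_def using E by auto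
  show ?thesis by (rule that[OF 1 2 3 interior_verts_P4[OF H]])
qed

lemma C4_piece:
  assumes P: "card P = 2" and R: "card R = 2" and full: "\<forall>p\<in>P. \<forall>s\<in>R. \<exists>e\<in>edges G. a e = p \<and> b e = s"
  obtains H where "subgraph H G" "is_C4 H" "confined H P R"
    "\<forall>p\<in>P. \<forall>s\<in>R. \<exists>f\<in>edges H. a f = p \<and> b f = s"
proof -
  obtain p p' where p: "P = {p, p'}" "p \<noteq> p'" using P unfolding card_2_iff by blast
  obtain s s' where s: "R = {s, s'}" "s \<noteq> s'" using R unfolding card_2_iff by blast
  obtain e1 where e1: "e1 \<in> edges G" "a e1 = p" "b e1 = s" using bspec[OF bspec[OF full, of "p"], of "s"] p s by auto
  obtain e2 where e2: "e2 \<in> edges G" "a e2 = p'" "b e2 = s" using bspec[OF bspec[OF full, of "p'"], of "s"] p s by auto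
  obtain e3 where e3: "e3 \<in> edges G" "a e3 = p'" "b e3 = s'" using bspec[OF bspec[OF full, of "p'"], of "s'"] p s by auto
  obtain e4 where e4: "e4 \<in> edges G" "a e4 = p" "b e4 = s'" using bspec[OF bspec[OF full, of "p"], of "s'"] p s by auto
  note E = e1(1) e2(1) e3(1) e4(1)
  have lr: "r e2 = r e1" "l e3 = l e2" "r e4 = r e3" "l e4 = l e1" "l e1 \<noteq> l e2" "r e1 \<noteq> r e3"
    using e1 e2 e3 e4 p(2) s(2) same_right[OF E(2,1)] same_left[OF E(3,2)] same_right[OF E(4,3)] same_left[OF E(4,1)] by auto
  let ?H = "\<lparr>verts = {l e1, r e1, l e2, r e3}, edges = {e1, e2, e3, e4}, ends = ends G\<rparr>"
  have H: "distinct [l e1, r e1, l e2, r e3]" "verts ?H = {l e1, r e1, l e2, r e3}" "edges ?H = {e1, e2, e3, e4}"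
    "ends ?H e1 = {l e1, r e1}" "ends ?H e2 = {r e1, l e2}" "ends ?H e3 = {l e2, r e3}" "ends ?H e4 = {r e3, l e1}"
    using lr sides[OF E(1,1)] sides[OF E(1,3)] sides[OF E(2,1)] sides[OF E(2,3)]
      ends[OF E(1)] ends[OF E(2)] ends[OF E(3)] ends[OF E(4)] by auto
  have 1: "subgraph ?H G"
    unfolding subgraph_def finite_multigraph_def
    using E verts[OF E(1)] verts[OF E(2)] verts[OF E(3)] H(1,4-7) by (auto simp: card_2_iff doubleton_eq_iff)
  have 2: "is_C4 ?H" unfolding is_C4_def using H by blast
  have 3: "confined ?H P R" unfolding confined_def using E e1(2,3) e2(2) e3(3) p(1) s(1) by auto
  have 4: "\<forall>p\<in>P. \<forall>s\<in>R. \<exists>f\<in>edges ?H. a f = p \<and> b f = s"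
    using e1(2,3) e2(2,3) e3(2,3) e4(2,3) unfolding p(1) s(1) by auto
  show ?thesis by (rule that[OF 1 2 3 4])
qed

text \<open>
  The outer edges of the paths come from a maximum matching M.  Comparing with the covers that use the right,
  respectively left, sides of all four-cycles shows that M matches the left, respectively right, end of
  a middle edge to a vertex outside of all pieces.
\<close>

lemma pieces_if_decomposition:
  assumes dec: "decomposition (edges G) a b D Q" and big: "2 * (card D + card Q) \<le> nu (edges G) a b"
  obtains \<C> where "finite \<C>" "card \<C> = card D + card Q" "\<And>H. H \<in> \<C> \<Longrightarrow> subgraph H G \<and> (is_C4 H \<or> is_P4 H)"
    "disjoint_family_on verts \<C>" "\<And>e. e \<in> edges G \<Longrightarrow> \<exists>H\<in>\<C>. covered_by G H e"
proof -
  let ?E = "edges G"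
  have dp: "disjoint_pieces ?E a b D Q" using dec unfolding decomposition_def by simp
  note dpD = disjoint_piecesD[OF dp]
  note DE = subsetD[OF matchingsD(1)[OF dpD(1)]]
  have finD: "finite D" by (rule finite_subset[OF matchingsD(1)[OF dpD(1)] fin_edges])
  obtain M where M: "M \<in> matchings ?E a b" "card M = nu ?E a b" by (rule nu_attained[OF fin_edges])
  note ME = subsetD[OF matchingsD(1)[OF M(1)]]
  note cov0 = decomposition_cover[OF dec fin_edges, of "{}"] and cov1 = decomposition_cover[OF dec fin_edges order_refl]
  have "\<exists>m. m \<in> M \<and> a m = a d \<and> b m \<notin> b ` D \<and> (\<forall>q\<in>Q. b m \<notin> snd q)" if "d \<in> D" for d
    using matching_meets_cover(2)[OF fin_edges M(1) cov0(1-3), of "a d"] cov0(4) big M(2) that by auto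
  then have "\<forall>d\<in>D. \<exists>m. m \<in> M \<and> a m = a d \<and> b m \<notin> b ` D \<and> (\<forall>q\<in>Q. b m \<notin> snd q)" by (rule ballI)
  from bchoice[OF this] obtain m where m0: "\<forall>d\<in>D. m d \<in> M \<and> a (m d) = a d \<and> b (m d) \<notin> b ` D \<and> (\<forall>q\<in>Q. b (m d) \<notin> snd q)"
    by (elim exE)
  have m: "m d \<in> M" "a (m d) = a d" "b (m d) \<notin> b ` D" "\<And>q. q \<in> Q \<Longrightarrow> b (m d) \<notin> snd q" if "d \<in> D" for d
    using bspec[OF m0 that] by simp_all
  have "\<exists>m. m \<in> M \<and> b m = b d \<and> a m \<notin> a ` D \<and> (\<forall>q\<in>Q. a m \<notin> fst q)" if "d \<in> D" for d
    using matching_meets_cover(3)[OF fin_edges M(1) cov1(1-3), of "b d"] cov1(4) big M(2) that by auto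
  then have "\<forall>d\<in>D. \<exists>m. m \<in> M \<and> b m = b d \<and> a m \<notin> a ` D \<and> (\<forall>q\<in>Q. a m \<notin> fst q)" by (rule ballI)
  from bchoice[OF this] obtain m' where m0': "\<forall>d\<in>D. m' d \<in> M \<and> b (m' d) = b d \<and> a (m' d) \<notin> a ` D \<and> (\<forall>q\<in>Q. a (m' d) \<notin> fst q)"
    by (elim exE)
  have m': "m' d \<in> M" "b (m' d) = b d" "a (m' d) \<notin> a ` D" "\<And>q. q \<in> Q \<Longrightarrow> a (m' d) \<notin> fst q" if "d \<in> D" for d
    using bspec[OF m0' that] by simp_all
  define J where "J = D <+> Q"
  \<comment> \<open>the left and right vertices of the piece with index j\<close>
  define X where "X j = (case j of Inl d \<Rightarrow> {a d, a (m' d)} | Inr q \<Rightarrow> fst q)" for j :: "'e + nat set \<times> nat set"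
  define Y where "Y j = (case j of Inl d \<Rightarrow> {b d, b (m d)} | Inr q \<Rightarrow> snd q)" for j :: "'e + nat set \<times> nat set"
  have injD: "a d \<noteq> a d'" "b d \<noteq> b d'" if "d \<in> D" "d' \<in> D" "d \<noteq> d'" for d d'
    using inj_on_eq_iff[OF matchingsD(2)[OF dpD(1)]] inj_on_eq_iff[OF matchingsD(3)[OF dpD(1)]] that by simp_all
  have injM: "e = f" if "e \<in> M" "f \<in> M" "a e = a f \<or> b e = b f" for e f
    using inj_on_eq_iff[OF matchingsD(2)[OF M(1)]] inj_on_eq_iff[OF matchingsD(3)[OF M(1)]] that by auto
  have XI: "X (Inl d) \<inter> X (Inl d') = {}" "Y (Inl d) \<inter> Y (Inl d') = {}" if d: "d \<in> D" "d' \<in> D" "d \<noteq> d'" for d d'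
  proof -
    have "a (m' d) \<noteq> a (m' d')"
      using injM[OF m'(1)[OF d(1)] m'(1)[OF d(2)]] m'(2)[OF d(1)] m'(2)[OF d(2)] injD(2)[OF d] by metis
    moreover have "a (m' d) \<noteq> a d'" "a (m' d') \<noteq> a d" using m'(3)[OF d(1)] m'(3)[OF d(2)] d(1,2) by (metis imageI)+
    ultimately show "X (Inl d) \<inter> X (Inl d') = {}" using injD(1)[OF d] unfolding X_def by auto
    have "b (m d) \<noteq> b (m d')"
      using injM[OF m(1)[OF d(1)] m(1)[OF d(2)]] m(2)[OF d(1)] m(2)[OF d(2)] injD(1)[OF d] by metis
    moreover have "b (m d) \<noteq> b d'" "b (m d') \<noteq> b d" using m(3)[OF d(1)] m(3)[OF d(2)] d(1,2) by (metis imageI)+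
    ultimately show "Y (Inl d) \<inter> Y (Inl d') = {}" using injD(2)[OF d] unfolding Y_def by auto
  qed
  have XQ: "X (Inl d) \<inter> X (Inr q) = {}" "Y (Inl d) \<inter> Y (Inr q) = {}" if d: "d \<in> D" "q \<in> Q" for d q
  proof -
    have "a d \<notin> fst q" "b d \<notin> snd q" using dpD(6,7)[OF d(2)] d(1) by (auto simp: disjoint_iff)
    then show "X (Inl d) \<inter> X (Inr q) = {}" "Y (Inl d) \<inter> Y (Inr q) = {}"
      using m'(4)[OF d] m(4)[OF d] unfolding X_def Y_def by simp_all
  qed
  have XY: "X i \<inter> X j = {} \<and> Y i \<inter> Y j = {}" if "i \<in> J" "j \<in> J" "i \<noteq> j" for i j
    using that(1) unfolding J_def
  proof (elim PlusE)
    fix d assume i: "i = Inl d" "d \<in> D"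
    from that(2) show ?thesis unfolding J_def
    proof (elim PlusE)
      fix d' assume "j = Inl d'" "d' \<in> D"
      then show ?thesis using XI[OF i(2), of d'] i(1) that(3) by simp
    next
      fix q assume "j = Inr q" "q \<in> Q"
      then show ?thesis using XQ[OF i(2), of q] i(1) by simp
    qed
  next
    fix q assume i: "i = Inr q" "q \<in> Q"
    from that(2) show ?thesis unfolding J_def
    proof (elim PlusE)
      fix d' assume "j = Inl d'" "d' \<in> D"
      then show ?thesis using XQ[OF _ i(2), of d'] i(1) by (simp add: Int_commute)
    next
      fix q' assume "j = Inr q'" "q' \<in> Q"
      then show ?thesis using dpD(8,9)[OF i(2), of q'] i(1) that(3) unfolding X_def Y_def by simp
    qed
  qed
  have Inl: "\<exists>H. subgraph H G \<and> is_P4 H \<and> confined H (X (Inl d)) (Y (Inl d)) \<and> interior_verts H = {l d, r d}"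
    if d: "d \<in> D" for d
  proof -
    have "b (m d) \<noteq> b d" "a (m' d) \<noteq> a d" using m(3)[OF d] m'(3)[OF d] d by (metis imageI)+
    from P4_piece[OF ME[OF m(1)[OF d]] DE[OF d] ME[OF m'(1)[OF d]] m(2)[OF d] m'(2)[OF d] this]
    obtain H where "subgraph H G" "is_P4 H" "confined H {a d, a (m' d)} {b d, b (m d)}" "interior_verts H = {l d, r d}" .
    then show ?thesis unfolding X_def Y_def by (intro exI[of _ H]) simp
  qed
  have Inr: "\<exists>H. subgraph H G \<and> is_C4 H \<and> confined H (X (Inr q)) (Y (Inr q)) \<and>
      (\<forall>p\<in>fst q. \<forall>s\<in>snd q. \<exists>f\<in>edges H. a f = p \<and> b f = s)"
    if q: "q \<in> Q" for q
  proof -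
    have "\<forall>p\<in>fst q. \<forall>s\<in>snd q. \<exists>e\<in>?E. a e = p \<and> b e = s"
      by (intro ballI) (rule dpD(5)[OF q])
    from C4_piece[OF dpD(3,4)[OF q] this]
    obtain H where "subgraph H G" "is_C4 H" "confined H (fst q) (snd q)"
      "\<forall>p\<in>fst q. \<forall>s\<in>snd q. \<exists>f\<in>edges H. a f = p \<and> b f = s" .
    then show ?thesis unfolding X_def Y_def by (intro exI[of _ H]) simp
  qed
  have "\<forall>d\<in>D. \<exists>H. subgraph H G \<and> is_P4 H \<and> confined H (X (Inl d)) (Y (Inl d)) \<and> interior_verts H = {l d, r d}"
    using Inl by (rule ballI)
  from bchoice[OF this] obtain F1 where "\<forall>d\<in>D. subgraph (F1 d) G \<and> is_P4 (F1 d) \<and>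
    confined (F1 d) (X (Inl d)) (Y (Inl d)) \<and> interior_verts (F1 d) = {l d, r d}" by (elim exE)
  then have F1: "subgraph (F1 d) G" "is_P4 (F1 d)" "confined (F1 d) (X (Inl d)) (Y (Inl d))" "interior_verts (F1 d) = {l d, r d}"
    if "d \<in> D" for d using that by simp_all
  have "\<forall>q\<in>Q. \<exists>H. subgraph H G \<and> is_C4 H \<and> confined H (X (Inr q)) (Y (Inr q)) \<and>
      (\<forall>p\<in>fst q. \<forall>s\<in>snd q. \<exists>f\<in>edges H. a f = p \<and> b f = s)"
    using Inr by (rule ballI)
  from bchoice[OF this] obtain F2 where "\<forall>q\<in>Q. subgraph (F2 q) G \<and> is_C4 (F2 q) \<and>
    confined (F2 q) (X (Inr q)) (Y (Inr q)) \<and> (\<forall>p\<in>fst q. \<forall>s\<in>snd q. \<exists>f\<in>edges (F2 q). a f = p \<and> b f = s)" by (elim exE)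
  then have F2: "subgraph (F2 q) G" "is_C4 (F2 q)" "confined (F2 q) (X (Inr q)) (Y (Inr q))"
    "\<And>p s. p \<in> fst q \<Longrightarrow> s \<in> snd q \<Longrightarrow> \<exists>f\<in>edges (F2 q). a f = p \<and> b f = s"
    if "q \<in> Q" for q using that by simp_all
  define F where "F = case_sum F1 F2"
  have F: "subgraph (F j) G \<and> (is_C4 (F j) \<or> is_P4 (F j)) \<and> confined (F j) (X j) (Y j)" if "j \<in> J" for j
    using that F1 F2 unfolding J_def F_def by auto
  have dj: "verts (F i) \<inter> verts (F j) = {}" if "i \<in> J" "j \<in> J" "i \<noteq> j" for i j
    using confined_disjoint[of "F i" "X i" "Y i" "F j" "X j" "Y j"] F[OF that(1)] F[OF that(2)] XY[OF that] by simp
  have inj: "inj_on F J"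
  proof (rule inj_onI, rule ccontr)
    fix i j assume ij: "i \<in> J" "j \<in> J" "F i = F j" "i \<noteq> j"
    have "verts (F i) \<noteq> {}" using F[OF ij(1)] unfolding is_C4_def is_P4_def by auto
    then show False using dj[OF ij(1,2,4)] ij(3) by simp
  qed
  show ?thesis
  proof (rule that[of "F ` J"])
    show "finite (F ` J)" unfolding J_def using finD dpD(2) by simp
    show "card (F ` J) = card D + card Q" unfolding card_image[OF inj] unfolding J_def by (rule card_Plus[OF finD dpD(2)])
    show "subgraph H G \<and> (is_C4 H \<or> is_P4 H)" if "H \<in> F ` J" for H
      using that F by (elim imageE) simp
    show "disjoint_family_on verts (F ` J)"
      unfolding disjoint_family_on_def
    proof (intro ballI impI)
      fix H H' assume "H \<in> F ` J" "H' \<in> F ` J" and ne: "H \<noteq> H'"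
      then obtain i j where "i \<in> J" "H = F i" "j \<in> J" "H' = F j" by (elim imageE)
      then show "verts H \<inter> verts H' = {}" using dj[of i j] ne by auto
    qed
    show "\<exists>H\<in>F ` J. covered_by G H e" if e: "e \<in> edges G" for e
    proof -
      have P4: "covered_by G (F (Inl d)) e" if "d \<in> D" "a e = a d \<or> b e = b d" for d
        using that F1(2,4)[OF that(1)] ends[OF e] same_left[OF e DE[OF that(1)]] same_right[OF e DE[OF that(1)]]
        unfolding covered_by_def incident_def F_def by auto
      have C4: "covered_by G (F (Inr q)) e" if q: "q \<in> Q" "a e \<in> fst q" "b e \<in> snd q" for q
      proof -
        obtain f where f: "f \<in> edges (F2 q)" "a f = a e" "b f = b e" using F2(4)[OF q] by blast
        have fE: "f \<in> edges G" by (rule subsetD[OF subgraphD(2)[OF F2(1)[OF q(1)]] f(1)])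
        have "parallel G e f"
          unfolding parallel_def ends[OF e] ends[OF fE] using f(2,3) same_left[OF fE e] same_right[OF fE e] by simp
        then show ?thesis using F2(2)[OF q(1)] f(1) unfolding covered_by_def F_def by auto
      qed
      have "absorbed a b D Q e" using dec e unfolding decomposition_def by simp
      then show ?thesis
        unfolding absorbed_def
      proof (elim disjE bexE conjE imageE)
        fix d assume "a e = a d" "d \<in> D"
        then show ?thesis using P4[of d] unfolding J_def by (intro bexI[of _ "F (Inl d)"]) auto
      next
        fix d assume "b e = b d" "d \<in> D"
        then show ?thesis using P4[of d] unfolding J_def by (intro bexI[of _ "F (Inl d)"]) auto
      next
        fix q assume "q \<in> Q" "a e \<in> fst q" "b e \<in> snd q"
        then show ?thesis using C4[of q] unfolding J_def by (intro bexI[of _ "F (Inr q)"]) auto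
      qed
    qed
  qed
qed

lemma conn_line_graph_iff:
  "graph_conn (line_graph G) = ereal (real (matching_number G) / 2 - 2) \<longleftrightarrow>
    (\<exists>\<C>. finite \<C> \<and> real (card \<C>) = real (matching_number G) / 2 \<and>
       (\<forall>H\<in>\<C>. subgraph H G \<and> (is_C4 H \<or> is_P4 H)) \<and> disjoint_family_on verts \<C> \<and>
       (\<forall>e\<in>edges G. \<exists>H\<in>\<C>. covered_by G H e))"
    (is "?L \<longleftrightarrow> (\<exists>\<C>. ?R \<C>)")
proof -
  let ?E = "edges G"
  let ?\<nu> = "nu ?E a b" and ?X = "geometric_realization (matchings ?E a b)"
  have conn: "graph_conn (line_graph G) = conn ?X" unfolding graph_conn_def independence_complex_line_graph ..
  show ?thesis
  proof (cases "?E = {}")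
    case True
    have "realize {{}} = ({} :: ('e \<Rightarrow> real) set)" unfolding realize_def by auto
    moreover have "matchings ?E a b = {{}}" unfolding matchings_def True by auto
    ultimately have "topspace ?X = {}" unfolding geometric_realization_eq by simp
    then have "conn ?X = - 2" unfolding conn_def by (rule if_P)
    have zero: "?\<nu> = 0" using nu_le[OF fin_edges, of a b 0] unfolding True matchings_def by simp
    have ?L unfolding conn matching_number_eq zero \<open>conn ?X = - 2\<close> by simp
    moreover have "?R {}"
      unfolding matching_number_eq zero disjoint_family_on_def using True by (intro conjI) simp_all
    ultimately show ?thesis by blast
  next
    case False
    then obtain e where e: "e \<in> ?E" by blast
    have sing: "{e} \<in> matchings ?E a b" using e unfolding matchings_def by simp
    have pos: "0 < ?\<nu>" using card_le_nu[OF fin_edges sing] by simp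
    have ne: "topspace ?X \<noteq> {}" using vertex_in_realize[OF sing] unfolding geometric_realization_eq by auto
    show ?thesis
    proof
      assume L: ?L
      obtain n where n: "?\<nu> = 2 * n" "\<not> k_connected (int n - 1) ?X"
        using conn_eqD[OF L[unfolded conn matching_number_eq] pos] .
      have "\<not> eta_at_least (Suc n) ?E a b"
        using k_connected_if_eta_ge[of "Suc n" "matchings ?E a b"] n(2) unfolding eta_at_least_def by auto
      from decomposable_if_tight[OF fin_edges n(1) this]
      obtain D Q where DQ: "decomposition ?E a b D Q" "card D + card Q = n" unfolding decomposable_def by blast
      obtain \<C> where \<C>: "finite \<C>" "card \<C> = card D + card Q" "\<And>H. H \<in> \<C> \<Longrightarrow> subgraph H G \<and> (is_C4 H \<or> is_P4 H)"
          "disjoint_family_on verts \<C>" "\<And>e. e \<in> edges G \<Longrightarrow> \<exists>H\<in>\<C>. covered_by G H e"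
        by (rule pieces_if_decomposition[OF DQ(1)]) (simp_all add: DQ(2) n(1))
      have "?R \<C>" unfolding matching_number_eq n(1) using \<C> DQ(2) by (intro conjI ballI) simp_all
      then show "\<exists>\<C>. ?R \<C>" by (rule exI)
    next
      assume "\<exists>\<C>. ?R \<C>"
      then obtain \<C> where R: "?R \<C>" by (elim exE)
      then have "real (2 * card \<C>) = real ?\<nu>" unfolding matching_number_eq by simp
      then have n: "?\<nu> = 2 * card \<C>" by (simp only: of_nat_eq_iff)
      have "eta_at_least (card \<C>) ?E a b" by (rule eta_ge_half_nu[OF fin_edges]) (simp add: n)
      then have low: "k_connected (int (card \<C>) - 2) ?X" unfolding eta_at_least_def by (rule k_connected_if_eta_ge)
      have "\<C> \<noteq> {}" using n pos by auto
      then have "\<not> k_connected (int (card \<C>) - 1) ?X"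
        using R by (intro not_k_connected_if_pieces) simp_all
      then have "conn ?X = ereal (real (card \<C>) - 2)"
        using n pos by (intro conn_eqI[OF ne _ low]) simp_all
      then show ?L unfolding conn matching_number_eq n by simp
    qed
  qed
qed

end

theorem theorem1p5:
  fixes G :: "('v, 'e) multigraph"
  assumes "finite_multigraph G" and "bipartite G"
  shows "graph_conn (line_graph G) = ereal (real (matching_number G) / 2 - 2) \<longleftrightarrow>
    (\<exists>\<C> :: ('v, 'e) multigraph set.
       finite \<C> \<and> real (card \<C>) = real (matching_number G) / 2 \<and>
       (\<forall>H\<in>\<C>. subgraph H G \<and> (is_C4 H \<or> is_P4 H)) \<and>
       disjoint_family_on verts \<C> \<and>
       (\<forall>e\<in>edges G. \<exists>H\<in>\<C>.
          is_C4 H \<and> (\<exists>f\<in>edges H. parallel G e f) \<or>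
          is_P4 H \<and> (\<exists>v\<in>interior_verts H. incident G e v)))"
proof -
  obtain A B where AB: "A \<inter> B = {}" "\<forall>e\<in>edges G. \<exists>x\<in>A. \<exists>y\<in>B. ends G e = {x, y}"
    using assms(2) unfolding bipartite_def by blast
  then have "\<forall>e\<in>edges G. \<exists>p. fst p \<in> A \<and> snd p \<in> B \<and> ends G e = {fst p, snd p}" by fastforce
  from bchoice[OF this] obtain p
    where p: "\<forall>e\<in>edges G. fst (p e) \<in> A \<and> snd (p e) \<in> B \<and> ends G e = {fst (p e), snd (p e)}" by (elim exE)
  obtain h :: "'v \<Rightarrow> nat" where h: "inj_on h (verts G)"
    using assms(1) finite_imp_inj_to_nat_seg unfolding finite_multigraph_def by metis
  interpret sided_graph G "\<lambda>e. fst (p e)" "\<lambda>e. snd (p e)" h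
    using assms(1) p AB(1) h by unfold_locales (auto simp: disjoint_iff)
  show ?thesis using conn_line_graph_iff unfolding covered_by_def .
qed

end
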